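(* The mapping $\widetilde{W}$, $\widetilde{W}(a) = (W_{ij}(a))_{i,j\ge 0}$, is a $^*$-isomorphism from the $C^*$-algebra $\mathcal{S}_N$ onto the $C^*$-algebra $\mathcal{T}_N \subseteq L(l^2(\mathbb{Z}^+, l^2(\mathbb{Z}^+)))$, and it maps the ideal $\mathcal{J}_N$ of $\mathcal{S}_N$ onto the ideal $\mathcal{C}_N$ of $\mathcal{T}_N$.
   Context: Let $N\ge 2$ be an integer, $\mathbb{Z}^+=\{0,1,2,\dots\}$, and let $L(H)$ denote the bounded linear operators on a Hilbert space $H$. "Ideal" means two-sided ideal. For $n\ge 1$, $P_n$ is the orthogonal projection of $l^2(\mathbb{Z}^+)$ onto the span of the first $n$ standard basis vectors, and $R_n : (x_k)_{k\ge0}\mapsto (x_{n-1},x_{n-2},\dots,x_0,0,0,\dots)$. For $i\in\Omega:=\{0,\dots,N-1\}$, $S_i\in L(l^2(\mathbb{Z}^+))$ is the isometry $(S_i x)_{rN+i}=x_r$ for $r\ge 0$, with all other components of $S_ix$ equal to $0$. The concrete Cuntz algebra $\mathcal{O}_N$ is the smallest $C^*$-subalgebra of $L(l^2(\mathbb{Z}^+))$ containing $S_0,\dots,S_{N-1}$. Let $\mathcal{F}_\eta$ (with $\eta(n)=N^n$) be the $C^*$-algebra of all bounded sequences $(A_n)_{n\ge 0}$ with $A_n\in\mathbb{C}^{N^n\times N^n}$ (identified with operators on $\mathrm{im}\,P_{N^n}$), with entrywise operations and supremum norm, and $\mathcal{G}_\eta$ its closed ideal of sequences with $\|A_n\|\to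 0$. $\mathcal{S}_\eta(\mathcal{O}_N)$ is the smallest $C^*$-subalgebra of $\mathcal{F}_\eta$ containing all sequences $(P_{N^n}AP_{N^n})_{n\ge0}$ with $A\in\mathcal{O}_N$; it contains $\mathcal{G}_\eta$, and $\mathcal{S}_N:=\mathcal{S}_\eta(\mathcal{O}_N)/\mathcal{G}_\eta$. Let $e$ be the identity of $\mathcal{S}_N$, $s_i:=(P_{N^n}S_iP_{N^n})_{n\ge0}+\mathcal{G}_\eta$, and $p_1:=s_0^*s_0$ (one has $p_1=s_i^*s_i$ for all $i\in\Omega$). $\mathcal{J}_N$ is the smallest closed ideal of $\mathcal{S}_N$ containing $e-p_1$. Definition of $\widetilde W$: for $a\in\mathcal{S}_N$ write $(e-p_1)a(e-p_1)=(A_n)_{n\ge0}+\mathcal{G}_\eta$ and let $W_{00}(a):=\mathrm{s\text{-}lim}_{n\to\infty} R_{N^n}A_nR_{N^n}$ (this strong limit exists and is independent of the representative). For $i,j\in\mathbb{Z}^+$ let $$W_{ij}(a):=(S_{N-1}^* )^i\, W_{00}\big((e-p_1)s_0^i\,a\,(s_0^* )^j(e-p_1)\big)\,S_{N-1}^j,$$ and $\widetilde W(a):=(W_{ij}(a))_{i,j\ge0}$, an infinite matrix of operators on $l^2(\mathbb{Z}^+)$, regarded as acting on $l^2(\mathbb{Z}^+,l^2(\mathbb{Z}^+))$ by $(\widetilde W(a)x)_i=\sum_j W_{ij}(a)x_j$. Definition of $\mathcal{T}_N$: for $i\in\Omega$ let $\Sigma_i\in L(l^2(\mathbb{Z}^+,l^2(\mathbb{Z}^+)))$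 be given by $(\Sigma_i x)_m=S_i x_{m+1}$, $m\ge0$. $\mathcal{T}_N$ is the smallest closed subalgebra of $L(l^2(\mathbb{Z}^+,l^2(\mathbb{Z}^+)))$ containing all $\Sigma_i,\Sigma_i^*$, $i\in\Omega$. $\mathcal{C}_N$ is the smallest closed ideal of $\mathcal{T}_N$ containing $\Pi_1:=\mathrm{diag}(I,0,0,\dots)$ (note $\Pi_1 = I-\Sigma_0^*\Sigma_0\in\mathcal{T}_N$). *)

theory Defs
  imports "HOL-Analysis.Analysis" "HOL-Algebra.QuotRing" "HOL-Algebra.Module"
begin

section \<open>Complex inner product spaces\<close>

text \<open>The library only has real inner product spaces. The complex inner product is linear in
  its first argument, and \<^const>\<open>inner\<close> is its real part, so both induce the same norm.\<close>

class complex_inner = real_inner +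
  fixes scaleC :: "complex \<Rightarrow> 'a \<Rightarrow> 'a"
    and cinner :: "'a \<Rightarrow> 'a \<Rightarrow> complex"
  assumes scaleC_add_right: "scaleC c (x + y) = scaleC c x + scaleC c y"
    and scaleC_add_left: "scaleC (c + d) x = scaleC c x + scaleC d x"
    and scaleC_scaleC: "scaleC c (scaleC d x) = scaleC (c * d) x"
    and scaleC_of_real: "scaleC (of_real r) x = r *\<^sub>R x"
    and cinner_commute: "cinner x y = cnj (cinner y x)"
    and cinner_add_left: "cinner (x + y) z = cinner x z + cinner y z"
    and cinner_scaleC_left: "cinner (scaleC c x) y = c * cinner x y"
    and Re_cinner: "Re (cinner x y) = inner x y"

lemma cinner_self: "cinner x x = of_real ((norm x)\<^sup>2)" for x :: "'a::complex_inner"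
proof -
  have "Im (cinner x x) = 0"
    using arg_cong[OF cinner_commute[of x x], of Im] by simp
  then show ?thesis
    by (simp add: complex_eq_iff Re_cinner power2_norm_eq_inner)
qed

lemma cinner_scaleC_right: "cinner x (scaleC c y) = cnj c * cinner x y"
  by (metis cinner_commute cinner_scaleC_left complex_cnj_mult)

lemma norm_scaleC: "norm (scaleC c x) = cmod c * norm x" for x :: "'a::complex_inner"
proof -
  have "complex_of_real ((norm (scaleC c x))\<^sup>2) = c * cnj c * of_real ((norm x)\<^sup>2)"
    by (simp only: cinner_self[symmetric] cinner_scaleC_left cinner_scaleC_right mult.assoc
        mult.left_commute)
  also have "\<dots> = of_real ((cmod c * norm x)\<^sup>2)"
    by (simp add: complex_norm_square[symmetric] power_mult_distrib)
  finally have "(norm (scaleC c x))\<^sup>2 = (cmod c * norm x)\<^sup>2"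
    by (simp only: of_real_eq_iff)
  then show ?thesis
    by (simp add: power2_eq_iff_nonneg)
qed

lemma norm_cinner_le: "cmod (cinner x y) \<le> norm x * norm y" for x :: "'a::complex_inner"
proof (cases "cinner x y = 0")
  case False
  define c where "c = cnj (cinner x y) / of_real (cmod (cinner x y))"
  have c: "cmod c = 1" using False by (simp add: c_def norm_divide)
  have "c * cinner x y = of_real (cmod (cinner x y))"
    using False complex_norm_square[of "cinner x y"]
    by (simp add: c_def field_simps power2_eq_square)
  then have "cmod (cinner x y) = Re (cinner (scaleC c x) y)"
    by (simp add: cinner_scaleC_left)
  also have "\<dots> \<le> norm (scaleC c x) * norm y"
    unfolding Re_cinner by (rule norm_cauchy_schwarz)
  finally show ?thesis by (simp add: norm_scaleC c)
qed simp

instantiation complex :: complex_inner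
begin

definition "scaleC c x = c * x" for c x :: complex
definition "cinner x y = x * cnj y" for x y :: complex

instance
  by standard (auto simp: scaleC_complex_def cinner_complex_def algebra_simps scaleR_conv_of_real
      inner_complex_def)

end


section \<open>Square-summable sequences\<close>

typedef (overloaded) 'a l2 = "{x :: nat \<Rightarrow> 'a::real_normed_vector. summable (\<lambda>n. (norm (x n))\<^sup>2)}"
  morphisms coord Abs_l2
  by (rule exI[of _ "\<lambda>_. 0"]) simp

setup_lifting type_definition_l2

lemma summable_coord: "summable (\<lambda>n. (norm (coord x n))\<^sup>2)"
  using coord[of x] by simp

lemma l2_eqI: "(\<And>n. coord x n = coord y n) \<Longrightarrow> x = y"
  by (simp add: coord_inject[symmetric] fun_eq_iff)

lemma norm_add_sq_le: "(norm (a + b))\<^sup>2 \<le> 2 * (norm a)\<^sup>2 + 2 * (norm b)\<^sup>2"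
  for a :: "'a::real_normed_vector"
proof -
  have "(norm (a + b))\<^sup>2 \<le> (norm a + norm b)\<^sup>2"
    by (simp add: norm_triangle_ineq power_mono)
  also have "\<dots> \<le> 2 * (norm a)\<^sup>2 + 2 * (norm b)\<^sup>2"
    using zero_le_power2[of "norm a - norm b"] by (simp add: power2_eq_square algebra_simps)
  finally show ?thesis .
qed

instantiation l2 :: (real_normed_vector) real_vector
begin

lift_definition zero_l2 :: "'a l2" is "\<lambda>_. 0" by simp

lift_definition plus_l2 :: "'a l2 \<Rightarrow> 'a l2 \<Rightarrow> 'a l2" is "\<lambda>x y n. x n + y n"
proof -
  fix x y :: "nat \<Rightarrow> 'a"
  assume "summable (\<lambda>n. (norm (x n))\<^sup>2)" "summable (\<lambda>n. (norm (y n))\<^sup>2)"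
  then have "summable (\<lambda>n. 2 * (norm (x n))\<^sup>2 + 2 * (norm (y n))\<^sup>2)"
    by (intro summable_add summable_mult)
  then show "summable (\<lambda>n. (norm (x n + y n))\<^sup>2)"
    by (rule summable_comparison_test') (simp add: norm_add_sq_le)
qed

lift_definition uminus_l2 :: "'a l2 \<Rightarrow> 'a l2" is "\<lambda>x n. - x n" by simp

lift_definition scaleR_l2 :: "real \<Rightarrow> 'a l2 \<Rightarrow> 'a l2" is "\<lambda>r x n. r *\<^sub>R x n"
  by (simp add: power_mult_distrib summable_mult)

definition minus_l2 :: "'a l2 \<Rightarrow> 'a l2 \<Rightarrow> 'a l2" where "minus_l2 x y = x + - y"

instance
  by standard (simp_all add: minus_l2_def, (transfer, simp add: algebra_simps)+)

end

lemma coord_simps [simp]: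
  "coord 0 n = 0" "coord (x + y) n = coord x n + coord y n"
  "coord (- x) n = - coord x n" "coord (x - y) n = coord x n - coord y n"
  "coord (r *\<^sub>R x) n = r *\<^sub>R coord x n"
  by (simp_all only: diff_conv_add_uminus zero_l2.rep_eq plus_l2.rep_eq uminus_l2.rep_eq
      scaleR_l2.rep_eq)

lemma summable_norm_mult:
  "summable (\<lambda>n. norm (coord x n) * norm (coord y n))"
proof (rule summable_comparison_test')
  show "summable (\<lambda>n. (norm (coord x n))\<^sup>2 + (norm (coord y n))\<^sup>2)"
    by (intro summable_add summable_coord)
  fix n :: nat
  have "2 * (norm (coord x n) * norm (coord y n)) \<le> (norm (coord x n))\<^sup>2 + (norm (coord y n))\<^sup>2"
    using sum_squares_bound[of "norm (coord x n)" "norm (coord y n)"] by simp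
  then show "norm (norm (coord x n) * norm (coord y n))
      \<le> (norm (coord x n))\<^sup>2 + (norm (coord y n))\<^sup>2"
    using mult_nonneg_nonneg[of "norm (coord x n)" "norm (coord y n)"]
    by (simp del: mult_nonneg_nonneg)
qed

lemma summable_inner: "summable (\<lambda>n. inner (coord x n) (coord y n))"
  for x y :: "'a::real_inner l2"
  by (rule summable_comparison_test'[OF summable_norm_mult[of x y]])
    (simp add: Cauchy_Schwarz_ineq2)

lemma summable_cinner: "summable (\<lambda>n. cinner (coord x n) (coord y n))"
  for x y :: "'a::complex_inner l2"
  by (rule summable_comparison_test'[OF summable_norm_mult[of x y]])
    (simp add: norm_cinner_le)

instantiation l2 :: (real_inner) real_inner
begin

definition "inner x y = (\<Sum>n. inner (coord x n) (coord y n))" for x y :: "'a l2"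
definition "norm x = sqrt (inner x x)" for x :: "'a l2"
definition "sgn x = inverse (norm x) *\<^sub>R x" for x :: "'a l2"
definition "dist x y = norm (x - y)" for x y :: "'a l2"
definition
  "(uniformity :: ('a l2 \<times> 'a l2) filter) = (INF e\<in>{0<..}. principal {(x, y). dist x y < e})"
definition
  "open (U :: 'a l2 set) \<longleftrightarrow> (\<forall>x\<in>U. eventually (\<lambda>(x', y). x' = x \<longrightarrow> y \<in> U) uniformity)"

instance
proof
  fix x y z :: "'a l2" and r :: real
  show "inner x y = inner y x"
    by (simp add: inner_l2_def inner_commute)
  show "inner (x + y) z = inner x z + inner y z"
    by (simp add: inner_l2_def inner_add_left suminf_add summable_inner)
  show "inner (r *\<^sub>R x) y = r * inner x y"
    by (simp add: inner_l2_def suminf_mult summable_inner)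
  show "0 \<le> inner x x"
    unfolding inner_l2_def by (intro suminf_nonneg summable_inner) simp
  have "inner x x = 0 \<longleftrightarrow> (\<forall>n. inner (coord x n) (coord x n) = 0)"
    unfolding inner_l2_def by (rule suminf_eq_zero_iff[OF summable_inner]) simp
  also have "\<dots> \<longleftrightarrow> x = 0"
    using l2_eqI[of x 0] by auto
  finally show "inner x x = 0 \<longleftrightarrow> x = 0" .
qed (fact norm_l2_def sgn_l2_def dist_l2_def uniformity_l2_def open_l2_def)+

end

lemma norm_l2_sq: "(norm x)\<^sup>2 = (\<Sum>n. (norm (coord x n))\<^sup>2)" for x :: "'a::real_inner l2"
  by (simp add: power2_norm_eq_inner inner_l2_def)

instantiation l2 :: (complex_inner) complex_inner
begin

lift_definition scaleC_l2 :: "complex \<Rightarrow> 'a l2 \<Rightarrow> 'a l2" is "\<lambda>c x n. scaleC c (x n)"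
  by (simp add: norm_scaleC power_mult_distrib summable_mult)

definition "cinner x y = (\<Sum>n. cinner (coord x n) (coord y n))" for x y :: "'a l2"

instance
proof
  fix x y z :: "'a l2" and r :: real and c d :: complex
  show "scaleC c (x + y) = scaleC c x + scaleC c y"
    by (rule l2_eqI) (simp add: scaleC_l2.rep_eq scaleC_add_right)
  show "scaleC (c + d) x = scaleC c x + scaleC d x"
    by (rule l2_eqI) (simp add: scaleC_l2.rep_eq scaleC_add_left)
  show "scaleC c (scaleC d x) = scaleC (c * d) x"
    by (rule l2_eqI) (simp add: scaleC_l2.rep_eq scaleC_scaleC)
  show "scaleC (of_real r) x = r *\<^sub>R x"
    by (rule l2_eqI) (simp add: scaleC_l2.rep_eq scaleC_of_real)
  have "(\<Sum>n. cinner (coord x n) (coord y n)) = (\<Sum>n. cnj (cinner (coord y n) (coord x n)))"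
    by (rule arg_cong[where f = suminf], rule ext, rule cinner_commute)
  also have "\<dots> = cnj (\<Sum>n. cinner (coord y n) (coord x n))"
    by (rule bounded_linear.suminf[OF bounded_linear_cnj summable_cinner, symmetric])
  finally show "cinner x y = cnj (cinner y x)"
    by (simp add: cinner_l2_def)
  show "cinner (x + y) z = cinner x z + cinner y z"
    by (simp add: cinner_l2_def cinner_add_left suminf_add summable_cinner)
  show "cinner (scaleC c x) y = c * cinner x y"
    by (simp add: cinner_l2_def scaleC_l2.rep_eq cinner_scaleC_left suminf_mult summable_cinner)
  show "Re (cinner x y) = inner x y"
    unfolding cinner_l2_def inner_l2_def
    by (simp add: bounded_linear.suminf[OF bounded_linear_Re summable_cinner] Re_cinner)
qed

end


section \<open>Algebras with involution and norm\<close>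

text \<open>Complex algebras with an involution and a norm, as a record extending the rings and
  modules of HOL-Algebra.\<close>

record 'b star_alg = "(complex, 'b) module" +
  star :: "'b \<Rightarrow> 'b"
  nrm :: "'b \<Rightarrow> real"

definition norm_conv :: "('b, 'm) star_alg_scheme \<Rightarrow> (nat \<Rightarrow> 'b) \<Rightarrow> 'b \<Rightarrow> bool"
  where "norm_conv A f x \<longleftrightarrow> (\<lambda>n. nrm A (f n \<ominus>\<^bsub>A\<^esub> x)) \<longlonglongrightarrow> 0"

locale c_star_algebra = ring A for A (structure) +
  assumes smult_closed: "x \<in> carrier A \<Longrightarrow> c \<odot> x \<in> carrier A"
    and smult_add_left: "x \<in> carrier A \<Longrightarrow> (c + d) \<odot> x = c \<odot> x \<oplus> d \<odot> x"
    and smult_add_right: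
      "\<lbrakk>x \<in> carrier A; y \<in> carrier A\<rbrakk> \<Longrightarrow> c \<odot> (x \<oplus> y) = c \<odot> x \<oplus> c \<odot> y"
    and smult_smult: "x \<in> carrier A \<Longrightarrow> (c * d) \<odot> x = c \<odot> (d \<odot> x)"
    and smult_1: "x \<in> carrier A \<Longrightarrow> 1 \<odot> x = x"
    and smult_mult_left:
      "\<lbrakk>x \<in> carrier A; y \<in> carrier A\<rbrakk> \<Longrightarrow> (c \<odot> x) \<otimes> y = c \<odot> (x \<otimes> y)"
    and smult_mult_right:
      "\<lbrakk>x \<in> carrier A; y \<in> carrier A\<rbrakk> \<Longrightarrow> x \<otimes> (c \<odot> y) = c \<odot> (x \<otimes> y)"
    and star_closed: "x \<in> carrier A \<Longrightarrow> star A x \<in> carrier A"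
    and star_star: "x \<in> carrier A \<Longrightarrow> star A (star A x) = x"
    and star_add:
      "\<lbrakk>x \<in> carrier A; y \<in> carrier A\<rbrakk> \<Longrightarrow> star A (x \<oplus> y) = star A x \<oplus> star A y"
    and star_smult: "x \<in> carrier A \<Longrightarrow> star A (c \<odot> x) = cnj c \<odot> star A x"
    and star_mult:
      "\<lbrakk>x \<in> carrier A; y \<in> carrier A\<rbrakk> \<Longrightarrow> star A (x \<otimes> y) = star A y \<otimes> star A x"
    and nrm_nonneg: "x \<in> carrier A \<Longrightarrow> 0 \<le> nrm A x"
    and nrm_eq_0: "x \<in> carrier A \<Longrightarrow> nrm A x = 0 \<longleftrightarrow> x = \<zero>"
    and nrm_smult: "x \<in> carrier A \<Longrightarrow> nrm A (c \<odot> x) = cmod c * nrm A x"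
    and nrm_add: "\<lbrakk>x \<in> carrier A; y \<in> carrier A\<rbrakk> \<Longrightarrow> nrm A (x \<oplus> y) \<le> nrm A x + nrm A y"
    and nrm_mult: "\<lbrakk>x \<in> carrier A; y \<in> carrier A\<rbrakk> \<Longrightarrow> nrm A (x \<otimes> y) \<le> nrm A x * nrm A y"
    and nrm_star: "x \<in> carrier A \<Longrightarrow> nrm A (star A x \<otimes> x) = (nrm A x)\<^sup>2"
    and complete:
      "\<lbrakk>range f \<subseteq> carrier A;
        \<And>e. e > 0 \<Longrightarrow> \<exists>M. \<forall>m\<ge>M. \<forall>n\<ge>M. nrm A (f m \<ominus> f n) < e\<rbrakk>
       \<Longrightarrow> \<exists>x\<in>carrier A. norm_conv A f x"

definition norm_closed :: "('b, 'm) star_alg_scheme \<Rightarrow> 'b set \<Rightarrow> bool"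
  where "norm_closed A B \<longleftrightarrow>
    (\<forall>f x. range f \<subseteq> B \<longrightarrow> x \<in> carrier A \<longrightarrow> norm_conv A f x \<longrightarrow> x \<in> B)"

text \<open>Subalgebras need not contain the identity of the ambient algebra.\<close>

definition closed_subalgebra :: "('b, 'm) star_alg_scheme \<Rightarrow> 'b set \<Rightarrow> bool"
  where "closed_subalgebra A B \<longleftrightarrow>
    B \<subseteq> carrier A \<and> \<zero>\<^bsub>A\<^esub> \<in> B \<and>
    (\<forall>x\<in>B. \<forall>y\<in>B. x \<oplus>\<^bsub>A\<^esub> y \<in> B \<and> x \<otimes>\<^bsub>A\<^esub> y \<in> B) \<and>
    (\<forall>c. \<forall>x\<in>B. c \<odot>\<^bsub>A\<^esub> x \<in> B) \<and>
    norm_closed A B"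

definition c_star_subalgebra :: "('b, 'm) star_alg_scheme \<Rightarrow> 'b set \<Rightarrow> bool"
  where "c_star_subalgebra A B \<longleftrightarrow> closed_subalgebra A B \<and> (\<forall>x\<in>B. star A x \<in> B)"

definition closed_ideal :: "('b, 'm) star_alg_scheme \<Rightarrow> 'b set \<Rightarrow> bool"
  where "closed_ideal A I \<longleftrightarrow> ideal I A \<and> (\<forall>c. \<forall>x\<in>I. c \<odot>\<^bsub>A\<^esub> x \<in> I) \<and> norm_closed A I"

definition closed_subalgebra_gen :: "('b, 'm) star_alg_scheme \<Rightarrow> 'b set \<Rightarrow> 'b set"
  where "closed_subalgebra_gen A X = \<Inter>{B. closed_subalgebra A B \<and> X \<subseteq> B}"

definition c_star_subalgebra_gen :: "('b, 'm) star_alg_scheme \<Rightarrow> 'b set \<Rightarrow> 'b set"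
  where "c_star_subalgebra_gen A X = \<Inter>{B. c_star_subalgebra A B \<and> X \<subseteq> B}"

definition closed_ideal_gen :: "('b, 'm) star_alg_scheme \<Rightarrow> 'b set \<Rightarrow> 'b set"
  where "closed_ideal_gen A X = \<Inter>{I. closed_ideal A I \<and> X \<subseteq> I}"

text \<open>Ring operations on cosets as in \<^const>\<open>FactRing\<close>; the norm is the quotient norm, the
  infimum of the norms of the representatives.\<close>

definition star_alg_quot :: "('b, 'm) star_alg_scheme \<Rightarrow> 'b set \<Rightarrow> 'b set star_alg"
  where "star_alg_quot A I =
    \<lparr>carrier = carrier (A Quot I), mult = mult (A Quot I), one = one (A Quot I),
     zero = zero (A Quot I), add = add (A Quot I),
     smult = (\<lambda>c X. \<Union>x\<in>X. I +>\<^bsub>A\<^esub> (c \<odot>\<^bsub>A\<^esub> x)),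
     star = (\<lambda>X. \<Union>x\<in>X. I +>\<^bsub>A\<^esub> (star A x)),
     nrm = (\<lambda>X. Inf (nrm A ` X))\<rparr>"

definition star_isomorphism ::
  "('a, 'm) star_alg_scheme \<Rightarrow> ('b, 'n) star_alg_scheme \<Rightarrow> ('a \<Rightarrow> 'b) \<Rightarrow> bool"
  where "star_isomorphism A B f \<longleftrightarrow>
    f \<in> ring_iso A B \<and>
    (\<forall>c. \<forall>x\<in>carrier A. f (c \<odot>\<^bsub>A\<^esub> x) = c \<odot>\<^bsub>B\<^esub> f x) \<and>
    (\<forall>x\<in>carrier A. f (star A x) = star B (f x))"


section \<open>Bounded operators on a complex inner product space\<close>

lift_definition scaleC_op :: "complex \<Rightarrow> 'a::complex_inner \<Rightarrow>\<^sub>L 'a" is scaleC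
proof (rule bounded_linear_intro)
  fix c :: complex and x y :: 'a and r :: real
  show "scaleC c (x + y) = scaleC c x + scaleC c y" by (rule scaleC_add_right)
  show "scaleC c (r *\<^sub>R x) = r *\<^sub>R scaleC c x"
    by (simp add: scaleC_of_real[symmetric] scaleC_scaleC mult.commute)
  show "norm (scaleC c x) \<le> norm x * cmod c" by (simp add: norm_scaleC)
qed

definition adj_op :: "('a::complex_inner \<Rightarrow>\<^sub>L 'a) \<Rightarrow> ('a \<Rightarrow>\<^sub>L 'a)"
  where "adj_op A = (THE B. \<forall>x y. cinner (blinfun_apply A x) y = cinner x (blinfun_apply B y))"

text \<open>The library's bounded operators are only real-linear; the carrier selects the complex-linear
  ones.\<close>

definition bounded_ops :: "('a::complex_inner \<Rightarrow>\<^sub>L 'a) star_alg"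
  where "bounded_ops =
    \<lparr>carrier = {A. \<forall>c x. blinfun_apply A (scaleC c x) = scaleC c (blinfun_apply A x)},
     mult = (o\<^sub>L), one = id_blinfun, zero = 0, add = (+),
     smult = (\<lambda>c A. scaleC_op c o\<^sub>L A), star = adj_op, nrm = norm\<rparr>"


section \<open>Concrete operators\<close>

lemma l2_inj_reindex:
  fixes x :: "'a::real_inner l2" and y :: "nat \<Rightarrow> 'b::real_normed_vector"
  assumes g: "inj_on g M" and y: "\<And>k. k \<in> M \<Longrightarrow> norm (y k) \<le> norm (coord x (g k))"
    and y0: "\<And>k. k \<notin> M \<Longrightarrow> y k = 0"
  shows "summable (\<lambda>k. (norm (y k))\<^sup>2)" and "(\<Sum>k. (norm (y k))\<^sup>2) \<le> (norm x)\<^sup>2"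
proof -
  have *: "sum (\<lambda>k. (norm (y k))\<^sup>2) K \<le> (norm x)\<^sup>2" if "finite K" for K
  proof -
    have "sum (\<lambda>k. (norm (y k))\<^sup>2) K = sum (\<lambda>k. (norm (y k))\<^sup>2) (K \<inter> M)"
      using that by (intro sum.mono_neutral_right) (auto simp: y0)
    also have "\<dots> \<le> sum (\<lambda>k. (norm (coord x (g k)))\<^sup>2) (K \<inter> M)"
      by (intro sum_mono power_mono) (auto simp: y)
    also have "\<dots> = sum (\<lambda>k. (norm (coord x k))\<^sup>2) (g ` (K \<inter> M))"
      using g by (subst sum.reindex) (auto intro: inj_on_subset)
    also have "\<dots> \<le> (norm x)\<^sup>2"
      unfolding norm_l2_sq using that by (intro sum_le_suminf summable_coord) auto
    finally show ?thesis .
  qed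
  show "summable (\<lambda>k. (norm (y k))\<^sup>2)"
    by (rule bounded_imp_summable[where B = "(norm x)\<^sup>2"]) (auto intro: *)
  then show "(\<Sum>k. (norm (y k))\<^sup>2) \<le> (norm x)\<^sup>2"
    by (rule suminf_le_const) (auto intro: *)
qed

lemma norm_le_l2I:
  fixes x :: "'a::real_inner l2" and y :: "'b::real_inner l2"
  assumes "inj_on g M" "\<And>k. k \<in> M \<Longrightarrow> norm (coord y k) \<le> norm (coord x (g k))"
    "\<And>k. k \<notin> M \<Longrightarrow> coord y k = 0"
  shows "norm y \<le> norm x"
  using l2_inj_reindex(2)[of g M "coord y" x, OF assms] unfolding norm_l2_sq[of y, symmetric]
  by (rule power2_le_imp_le) simp_all

lemma inj_on_div_mod: "inj_on (\<lambda>k. k div N) {k. k mod N = i}" for N i :: nat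
  by (rule inj_onI) (metis (mono_tags) div_mult_mod_eq mem_Collect_eq)

lemma inj_on_reflect: "inj_on (\<lambda>k. n - 1 - k) {k. k < n}" for n :: nat
  by (auto simp: inj_on_def)

lift_definition P_vec :: "nat \<Rightarrow> 'a::real_inner l2 \<Rightarrow> 'a l2"
  is "\<lambda>n x k. if k < n then x k else 0"
  subgoal for n x
    using l2_inj_reindex(1)[of id "{k. k < n}" "\<lambda>k. if k < n then x k else 0" "Abs_l2 x"]
    by (simp add: Abs_l2_inverse)
  done

lift_definition R_vec :: "nat \<Rightarrow> 'a::real_inner l2 \<Rightarrow> 'a l2"
  is "\<lambda>n x k. if k < n then x (n - 1 - k) else 0"
  subgoal for n x
    using l2_inj_reindex(1)[of "\<lambda>k. n - 1 - k" "{k. k < n}"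
        "\<lambda>k. if k < n then x (n - 1 - k) else 0" "Abs_l2 x"] inj_on_reflect
    by (simp add: Abs_l2_inverse)
  done

text \<open>For \<open>i < N\<close> the index \<open>k = r N + i\<close> is characterised by \<open>k mod N = i\<close>, and then
  \<open>r = k div N\<close>.\<close>

lift_definition S_vec :: "nat \<Rightarrow> nat \<Rightarrow> 'a::real_inner l2 \<Rightarrow> 'a l2"
  is "\<lambda>N i x k. if k mod N = i then x (k div N) else 0"
  subgoal for N i x
    using l2_inj_reindex(1)[of "\<lambda>k. k div N" "{k. k mod N = i}"
        "\<lambda>k. if k mod N = i then x (k div N) else 0" "Abs_l2 x"] inj_on_div_mod
    by (simp add: Abs_l2_inverse)
  done

lift_definition P_op :: "nat \<Rightarrow> 'a::real_inner l2 \<Rightarrow>\<^sub>L 'a l2" is P_vec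
proof (rule bounded_linear_intro[where K = 1])
  fix n and x :: "'a l2"
  show "norm (P_vec n x) \<le> norm x * 1"
    by (simp, rule norm_le_l2I[of id "{k. k < n}"]) (auto simp: P_vec.rep_eq)
qed (auto intro!: l2_eqI simp: P_vec.rep_eq)

lift_definition R_op :: "nat \<Rightarrow> complex l2 \<Rightarrow>\<^sub>L complex l2" is R_vec
proof (rule bounded_linear_intro[where K = 1])
  fix n and x :: "complex l2"
  show "norm (R_vec n x) \<le> norm x * 1"
    by (simp, rule norm_le_l2I[OF inj_on_reflect[of n]]) (auto simp: R_vec.rep_eq)
qed (auto intro!: l2_eqI simp: R_vec.rep_eq)

lift_definition S_op :: "nat \<Rightarrow> nat \<Rightarrow> complex l2 \<Rightarrow>\<^sub>L complex l2" is S_vec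
proof (rule bounded_linear_intro[where K = 1])
  fix N i and x :: "complex l2"
  show "norm (S_vec N i x) \<le> norm x * 1"
    by (simp, rule norm_le_l2I[OF inj_on_div_mod[of N i]]) (auto simp: S_vec.rep_eq)
qed (auto intro!: l2_eqI simp: S_vec.rep_eq)

lemma norm_S_op_le: "norm (blinfun_apply (S_op N i) x) \<le> norm x"
  by (simp add: S_op.rep_eq, rule norm_le_l2I[OF inj_on_div_mod[of N i]])
    (auto simp: S_vec.rep_eq)

lift_definition Sigma_vec :: "nat \<Rightarrow> nat \<Rightarrow> complex l2 l2 \<Rightarrow> complex l2 l2"
  is "\<lambda>N i x m. blinfun_apply (S_op N i) (x (Suc m))"
  subgoal for N i x
    using l2_inj_reindex(1)[of Suc UNIV "\<lambda>m. blinfun_apply (S_op N i) (x (Suc m))" "Abs_l2 x"]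
    by (simp add: Abs_l2_inverse norm_S_op_le)
  done

lift_definition Sigma_op :: "nat \<Rightarrow> nat \<Rightarrow> complex l2 l2 \<Rightarrow>\<^sub>L complex l2 l2" is Sigma_vec
proof (rule bounded_linear_intro[where K = 1])
  fix N i and x :: "complex l2 l2"
  show "norm (Sigma_vec N i x) \<le> norm x * 1"
    by (simp, rule norm_le_l2I[of Suc UNIV]) (auto simp: Sigma_vec.rep_eq norm_S_op_le)
qed (auto intro!: l2_eqI simp: Sigma_vec.rep_eq blinfun.add_right blinfun.scaleR_right)


section \<open>The algebra of finite sections of operators in the Cuntz algebra\<close>

definition Cuntz :: "nat \<Rightarrow> (complex l2 \<Rightarrow>\<^sub>L complex l2) set"
  where "Cuntz N = c_star_subalgebra_gen bounded_ops (S_op N ` {..<N})"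

definition section_seq ::
  "nat \<Rightarrow> (complex l2 \<Rightarrow>\<^sub>L complex l2) \<Rightarrow> nat \<Rightarrow> (complex l2 \<Rightarrow>\<^sub>L complex l2)"
  where "section_seq N A = (\<lambda>n. P_op (N ^ n) o\<^sub>L A o\<^sub>L P_op (N ^ n))"

text \<open>A matrix of size \<open>N ^ n\<close> is an operator on the range of \<open>P_op (N ^ n)\<close>, extended by zero to
  the orthogonal complement of that range.\<close>

definition F_alg :: "nat \<Rightarrow> (nat \<Rightarrow> (complex l2 \<Rightarrow>\<^sub>L complex l2)) star_alg"
  where "F_alg N =
    \<lparr>carrier = {A. (\<forall>n. A n \<in> carrier bounded_ops \<and>
                        P_op (N ^ n) o\<^sub>L A n o\<^sub>L P_op (N ^ n) = A n) \<and>
                   bdd_above (range (\<lambda>n. norm (A n)))},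
     mult = (\<lambda>A B n. A n o\<^sub>L B n), one = (\<lambda>n. P_op (N ^ n)),
     zero = (\<lambda>n. 0), add = (\<lambda>A B n. A n + B n),
     smult = (\<lambda>c A n. scaleC_op c o\<^sub>L A n), star = (\<lambda>A n. adj_op (A n)),
     nrm = (\<lambda>A. SUP n. norm (A n))\<rparr>"

definition G_ideal :: "nat \<Rightarrow> (nat \<Rightarrow> (complex l2 \<Rightarrow>\<^sub>L complex l2)) set"
  where "G_ideal N = {A \<in> carrier (F_alg N). (\<lambda>n. norm (A n)) \<longlonglongrightarrow> 0}"

definition section_alg :: "nat \<Rightarrow> (nat \<Rightarrow> (complex l2 \<Rightarrow>\<^sub>L complex l2)) star_alg"
  where "section_alg N =
    (F_alg N)\<lparr>carrier := c_star_subalgebra_gen (F_alg N) (section_seq N ` Cuntz N)\<rparr>"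

definition S_alg :: "nat \<Rightarrow> (nat \<Rightarrow> (complex l2 \<Rightarrow>\<^sub>L complex l2)) set star_alg"
  where "S_alg N = star_alg_quot (section_alg N) (G_ideal N)"

definition s_gen :: "nat \<Rightarrow> nat \<Rightarrow> (nat \<Rightarrow> (complex l2 \<Rightarrow>\<^sub>L complex l2)) set"
  where "s_gen N i = G_ideal N +>\<^bsub>section_alg N\<^esub> section_seq N (S_op N i)"

definition p1 :: "nat \<Rightarrow> (nat \<Rightarrow> (complex l2 \<Rightarrow>\<^sub>L complex l2)) set"
  where "p1 N = star (S_alg N) (s_gen N 0) \<otimes>\<^bsub>S_alg N\<^esub> s_gen N 0"

definition q1 :: "nat \<Rightarrow> (nat \<Rightarrow> (complex l2 \<Rightarrow>\<^sub>L complex l2)) set"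
  where "q1 N = \<one>\<^bsub>S_alg N\<^esub> \<ominus>\<^bsub>S_alg N\<^esub> p1 N"

definition J_ideal :: "nat \<Rightarrow> (nat \<Rightarrow> (complex l2 \<Rightarrow>\<^sub>L complex l2)) set set"
  where "J_ideal N = closed_ideal_gen (S_alg N) {q1 N}"


section \<open>The map into operators on \<open>l2\<close>-valued sequences\<close>

text \<open>The strong limit is required for every representative of the coset.\<close>

definition W00 ::
  "nat \<Rightarrow> (nat \<Rightarrow> (complex l2 \<Rightarrow>\<^sub>L complex l2)) set \<Rightarrow> (complex l2 \<Rightarrow>\<^sub>L complex l2)"
  where "W00 N a = (THE V. \<forall>A \<in> q1 N \<otimes>\<^bsub>S_alg N\<^esub> a \<otimes>\<^bsub>S_alg N\<^esub> q1 N. \<forall>x.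
    (\<lambda>n. blinfun_apply (R_op (N ^ n) o\<^sub>L A n o\<^sub>L R_op (N ^ n)) x) \<longlonglongrightarrow> blinfun_apply V x)"

definition W_entry ::
  "nat \<Rightarrow> nat \<Rightarrow> nat \<Rightarrow> (nat \<Rightarrow> (complex l2 \<Rightarrow>\<^sub>L complex l2)) set \<Rightarrow> (complex l2 \<Rightarrow>\<^sub>L complex l2)"
  where "W_entry N i j a =
    (adj_op (S_op N (N - 1)) [^]\<^bsub>bounded_ops\<^esub> i)
      o\<^sub>L W00 N (q1 N \<otimes>\<^bsub>S_alg N\<^esub> (s_gen N 0 [^]\<^bsub>S_alg N\<^esub> i) \<otimes>\<^bsub>S_alg N\<^esub> a
                 \<otimes>\<^bsub>S_alg N\<^esub> (star (S_alg N) (s_gen N 0) [^]\<^bsub>S_alg N\<^esub> j) \<otimes>\<^bsub>S_alg N\<^esub> q1 N)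
      o\<^sub>L (S_op N (N - 1) [^]\<^bsub>bounded_ops\<^esub> j)"

definition W_tilde ::
  "nat \<Rightarrow> (nat \<Rightarrow> (complex l2 \<Rightarrow>\<^sub>L complex l2)) set \<Rightarrow> (complex l2 l2 \<Rightarrow>\<^sub>L complex l2 l2)"
  where "W_tilde N a = (THE T. \<forall>x i.
    (\<lambda>j. blinfun_apply (W_entry N i j a) (coord x j)) sums coord (blinfun_apply T x) i)"

definition T_alg :: "nat \<Rightarrow> (complex l2 l2 \<Rightarrow>\<^sub>L complex l2 l2) star_alg"
  where "T_alg N = bounded_ops\<lparr>carrier := closed_subalgebra_gen bounded_ops
      (Sigma_op N ` {..<N} \<union> (\<lambda>i. adj_op (Sigma_op N i)) ` {..<N})\<rparr>"

text \<open>\<open>P_op 1\<close> on \<open>l2\<close>-valued sequences is the diagonal operator with entries \<open>I, 0, 0, \<dots>\<close>.\<close>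

definition C_ideal :: "nat \<Rightarrow> (complex l2 l2 \<Rightarrow>\<^sub>L complex l2 l2) set"
  where "C_ideal N = closed_ideal_gen (T_alg N) {P_op 1}"

end

(* The shift (Sigma_i) and the finite sections t_i of S_i are compared through explicit isometries
   J_n from the range of P_(N^n) into l2(l2).  Listing the N-adic digits of an index k < N^n makes
   C^(N^n) into a tree rooted at e_0; reflecting the index turns the tree distance from the leaves
   into the depth in l2(l2), so that s_i corresponds to Sigma_(N-1-i).  Only the loop S_0 e_0 = e_0
   obstructs an exact intertwiner.  J_n therefore spreads e_0 evenly over a chain of n div 2 depths,
   on which Sigma_(N-1) acts as a shift with an almost invariant vector, and gradually concentrates
   the distribution to a single depth along the branches.  This gives
   Sigma_(N-1-i) J_n - J_n t_i(n) -> 0 in norm (with adjoints), J_n J_n^* -> 1 strongly, and hence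
   T |-> (J_n^* T J_n)_n + G is an isometric star-isomorphism of T_N onto S_N, whose inverse is
   W~ because R_(N^n) intertwines the depth 0 component of J_n with a truncation. *)
theory Submission
  imports Defs "HOL-Library.Log_Nat"
begin

section \<open>Hilbert space preliminaries\<close>

text \<open>No exact intertwiner exists: the finite section of \<open>S_op N 0\<close> fixes
  \<open>e_0\<close>, whereas \<open>Sigma_op N (N - 1)\<close> has no nonzero fixed vector, since
  \<open>x_m = S x_(m+1)\<close> with an isometry \<open>S\<close> makes all components of
  \<open>x\<close> equally long. Two errors have to be paid. At the loop, a uniform window of
  \<open>K = n div 2\<close> depths moves by one, which changes the masses by \<open>2 / K\<close>
  in l1. Along the branches the window is dissolved over \<open>n - K\<close> levels, at a change of
  at most \<open>2 / (n - K)\<close> per level. Halving \<open>n\<close> makes both of order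
  \<open>1 / n\<close>. Amplitudes are square roots of masses, so l1 bounds on masses are l2 bounds
  on vectors; for fixed \<open>i\<close> the errors of different basis vectors are orthogonal, so
  passing to the operator norm costs no further factor. The levels near the leaves stay untouched,
  which gives exact formulas at depth 0. Sections are not multiplicative on the Cuntz algebra;
  surjectivity therefore goes through words in which every \<open>S_i\<close> stands left of every
  adjoint. The C*-axioms of the quotient are transported from T_N along the isometric
  bijection.\<close>

lemma sum_coord_le: "finite I \<Longrightarrow> (\<Sum>k\<in>I. (norm (coord x k))\<^sup>2) \<le> (norm x)\<^sup>2"
  for x :: "'a::real_inner l2"
  unfolding norm_l2_sq by (intro sum_le_suminf summable_coord) auto

lemma norm_coord_le: "norm (coord x k) \<le> norm x" for x :: "'a::real_inner l2"
  by (rule power2_le_imp_le) (use sum_coord_le[of "{k}" x] in simp_all)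

lemma norm_l2_leI:
  fixes x :: "'a::real_inner l2"
  assumes "\<And>L. (\<Sum>k<L. (norm (coord x k))\<^sup>2) \<le> e\<^sup>2" "0 \<le> e"
  shows "norm x \<le> e"
proof -
  have "(norm x)\<^sup>2 \<le> e\<^sup>2"
    unfolding norm_l2_sq by (rule suminf_le_const[OF summable_coord assms(1)])
  then show ?thesis using assms(2) by (rule power2_le_imp_le)
qed

lemma bounded_linear_coord: "bounded_linear (\<lambda>x::'a::real_inner l2. coord x k)"
  by (rule bounded_linear_intro[where K = 1]) (auto simp: norm_coord_le)

text \<open>The candidate is the coordinatewise limit \<open>y\<close>. The Cauchy bounds on partial
  sums survive the limit, so \<open>X M - y\<close> is square summable, and \<open>y\<close> lies in
  \<open>l2\<close> as the difference of \<open>X M\<close> and \<open>X M - y\<close>.\<close>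

lemma l2_Cauchy_convergent:
  fixes X :: "nat \<Rightarrow> 'a::{real_inner, banach} l2"
  assumes X: "Cauchy X"
  shows "convergent X"
proof -
  define y where "y k = lim (\<lambda>n. coord (X n) k)" for k
  have y: "(\<lambda>n. coord (X n) k) \<longlonglongrightarrow> y k" for k
    unfolding y_def convergent_LIMSEQ_iff[symmetric]
    by (rule Cauchy_convergent, rule bounded_linear.Cauchy[OF bounded_linear_coord X])
  have tail: "(\<Sum>k<L. (norm (coord (X m) k - y k))\<^sup>2) \<le> e\<^sup>2"
    if M: "\<And>n. n \<ge> M \<Longrightarrow> norm (X m - X n) < e" for m M e L
  proof (rule LIMSEQ_le_const2)
    show "(\<lambda>n. \<Sum>k<L. (norm (coord (X m) k - coord (X n) k))\<^sup>2)
        \<longlonglongrightarrow> (\<Sum>k<L. (norm (coord (X m) k - y k))\<^sup>2)"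
      by (intro tendsto_intros y)
    have "(\<Sum>k<L. (norm (coord (X m) k - coord (X n) k))\<^sup>2) \<le> e\<^sup>2" if "n \<ge> M" for n
    proof -
      have "(\<Sum>k<L. (norm (coord (X m - X n) k))\<^sup>2) \<le> (norm (X m - X n))\<^sup>2"
        by (rule sum_coord_le) simp
      also have "\<dots> \<le> e\<^sup>2" using M[OF that] by (intro power_mono) auto
      finally show ?thesis by simp
    qed
    then show "\<exists>N. \<forall>n\<ge>N. (\<Sum>k<L. (norm (coord (X m) k - coord (X n) k))\<^sup>2) \<le> e\<^sup>2"
      by blast
  qed
  obtain M where M: "\<And>m n. m \<ge> M \<Longrightarrow> n \<ge> M \<Longrightarrow> norm (X m - X n) < 1"
    using X unfolding Cauchy_iff by (metis zero_less_one)
  have "summable (\<lambda>k. (norm (coord (X M) k - y k))\<^sup>2)"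
    using tail[OF M] by (intro summableI_nonneg_bounded[where x = "1\<^sup>2"]) auto
  then have d: "coord (Abs_l2 (\<lambda>k. coord (X M) k - y k)) = (\<lambda>k. coord (X M) k - y k)"
    by (simp add: Abs_l2_inverse)
  define z where "z = X M - Abs_l2 (\<lambda>k. coord (X M) k - y k)"
  have z: "coord z k = y k" for k by (simp add: z_def d)
  have "X \<longlonglongrightarrow> z"
  proof (rule LIMSEQ_I)
    fix r :: real assume "r > 0"
    then obtain M where M: "\<And>m n. m \<ge> M \<Longrightarrow> n \<ge> M \<Longrightarrow> norm (X m - X n) < r / 2"
      using X unfolding Cauchy_iff by (metis half_gt_zero)
    have "norm (X m - z) \<le> r / 2" if "m \<ge> M" for m
      using \<open>r > 0\<close> by (intro norm_l2_leI) (auto simp: z intro!: tail M that)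
    moreover have "r / 2 < r" using \<open>r > 0\<close> by simp
    ultimately show "\<exists>no. \<forall>n\<ge>no. norm (X n - z) < r" using le_less_trans by blast
  qed
  then show ?thesis by (rule convergentI)
qed

instance l2 :: ("{real_inner, banach}") complete_space
  by standard (rule l2_Cauchy_convergent)

instance l2 :: ("{real_inner, banach}") banach ..

section \<open>Riesz representation and adjoints of real-linear operators\<close>

lemma parallelogram: "(norm (x + y))\<^sup>2 + (norm (x - y))\<^sup>2 = 2 * (norm x)\<^sup>2 + 2 * (norm y)\<^sup>2"
  for x y :: "'a::real_inner"
  by (simp add: power2_norm_eq_inner inner_add_left inner_add_right inner_diff_left inner_diff_right)

text \<open>The representing vector is found as the element of least norm on the affine hyperplane
  where the functional takes the value 1; the parallelogram law makes a minimizing sequence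
  Cauchy.\<close>

lemma riesz_representation:
  fixes f :: "'a::{real_inner, banach} \<Rightarrow> real"
  assumes f: "bounded_linear f"
  shows "\<exists>y. \<forall>x. f x = inner x y"
proof (cases "\<forall>x. f x = 0")
  case True
  then show ?thesis by (intro exI[of _ 0]) simp
next
  case False
  interpret f: bounded_linear f by fact
  define V where "V = {x. f x = 1}"
  from False obtain x0 where "f x0 \<noteq> 0" by blast
  then have "x0 /\<^sub>R f x0 \<in> V" by (simp add: V_def f.scaleR)
  then have ne: "V \<noteq> {}" by blast
  define d where "d = (INF x\<in>V. (norm x)\<^sup>2)"
  have dle: "d \<le> (norm x)\<^sup>2" if "x \<in> V" for x
    unfolding d_def using that by (intro cINF_lower bdd_belowI2[of _ 0]) auto
  have "\<exists>x\<in>V. (norm x)\<^sup>2 < d + inverse (real (Suc n))" for n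
    using cINF_less_iff[OF ne bdd_belowI2[of V 0 "\<lambda>x. (norm x)\<^sup>2"], of "d + inverse (real (Suc n))"]
    by (simp add: d_def)
  then obtain u where uV: "\<And>n. u n \<in> V"
    and u: "\<And>n. (norm (u n))\<^sup>2 < d + inverse (real (Suc n))" by metis
  have close: "(norm (u m - u n))\<^sup>2 \<le> 4 * inverse (real (Suc M))" if "m \<ge> M" "n \<ge> M" for m n M
  proof -
    have "(1/2) *\<^sub>R (u m + u n) \<in> V"
      using uV[of m] uV[of n] by (simp add: V_def f.scaleR f.add)
    then have "d \<le> (norm ((1/2) *\<^sub>R (u m + u n)))\<^sup>2" by (rule dle)
    then have "4 * d \<le> (norm (u m + u n))\<^sup>2" by (simp add: power_divide)
    moreover have "inverse (real (Suc m)) \<le> inverse (real (Suc M))"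
      "inverse (real (Suc n)) \<le> inverse (real (Suc M))" using that by auto
    ultimately show ?thesis using parallelogram[of "u m" "u n"] u[of m] u[of n] by linarith
  qed
  have "Cauchy u"
  proof (rule CauchyI)
    fix e :: real assume "e > 0"
    then obtain M where M: "inverse (real (Suc M)) < e\<^sup>2 / 4"
      using reals_Archimedean[of "e\<^sup>2 / 4"] by auto
    have "norm (u m - u n) < e" if "m \<ge> M" "n \<ge> M" for m n
    proof (rule power2_less_imp_less)
      show "(norm (u m - u n))\<^sup>2 < e\<^sup>2" using close[OF that] M by linarith
    qed (use \<open>e > 0\<close> in simp)
    then show "\<exists>M. \<forall>m\<ge>M. \<forall>n\<ge>M. norm (u m - u n) < e" by blast
  qed
  then obtain v where v: "u \<longlonglongrightarrow> v"
    by (metis Cauchy_convergent convergent_def)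
  have "(\<lambda>n. f (u n)) \<longlonglongrightarrow> f v" by (rule f.tendsto[OF v])
  moreover have "f (u n) = 1" for n using uV by (simp add: V_def)
  ultimately have fv: "f v = 1" using LIMSEQ_unique[of "\<lambda>n. 1" 1] by auto
  have nv: "(norm v)\<^sup>2 \<le> d"
  proof (rule LIMSEQ_le)
    show "(\<lambda>n. (norm (u n))\<^sup>2) \<longlonglongrightarrow> (norm v)\<^sup>2" by (intro tendsto_intros v)
    show "(\<lambda>n. d + inverse (real (Suc n))) \<longlonglongrightarrow> d"
      by (rule LIMSEQ_inverse_real_of_nat_add)
  qed (use u less_imp_le in blast)
  have orth: "inner x v = 0" if "f x = 0" for x
  proof (cases "x = 0")
    case False
    \<comment> \<open>The value of \<open>t\<close> that minimizes the norm of
      \<open>v + t *\<^sub>R x\<close>; minimality of \<open>v\<close> then forces the inner product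
      to vanish.\<close>
    define t where "t = - (inner x v / (norm x)\<^sup>2)"
    have "v + t *\<^sub>R x \<in> V" using that fv by (simp add: V_def f.add f.scaleR)
    then have "(norm v)\<^sup>2 \<le> (norm (v + t *\<^sub>R x))\<^sup>2" using dle nv by (meson order_trans)
    also have "\<dots> = (norm v)\<^sup>2 + 2 * t * inner x v + t\<^sup>2 * (norm x)\<^sup>2"
      by (simp add: power2_norm_eq_inner inner_add_left inner_add_right inner_commute[of v x]
          power2_eq_square[of t] algebra_simps)
    also have "\<dots> = (norm v)\<^sup>2 - (inner x v)\<^sup>2 / (norm x)\<^sup>2"
      using False by (simp add: t_def power2_eq_square field_simps)
    finally have "(inner x v)\<^sup>2 / (norm x)\<^sup>2 \<le> 0" by simp
    moreover have "(norm x)\<^sup>2 > 0" using False by simp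
    ultimately show ?thesis by (simp add: divide_le_0_iff)
  qed simp
  have "v \<noteq> 0" using fv f.zero by auto
  have "f x = inner x (v /\<^sub>R (norm v)\<^sup>2)" for x
  proof -
    have "f (x - f x *\<^sub>R v) = 0" by (simp add: f.diff f.scaleR fv)
    then have "inner x v = f x * (norm v)\<^sup>2"
      using orth[of "x - f x *\<^sub>R v"] by (simp add: inner_diff_left power2_norm_eq_inner)
    then show ?thesis using \<open>v \<noteq> 0\<close> by (simp add: field_simps)
  qed
  then show ?thesis by blast
qed

lemma inner_eqI: "(\<And>x. inner x y = inner x z) \<Longrightarrow> y = z" for y z :: "'a::real_inner"
  using vector_eq_ldot[of y z] by blast

text \<open>Unlike \<open>adj_op\<close>, this covers operators between different spaces, such as
  \<open>J_op\<close>. The real inner product suffices, by \<open>adj_op_eq_radj\<close>.\<close>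

definition radj :: "('a::real_inner \<Rightarrow>\<^sub>L 'b::real_inner) \<Rightarrow> ('b \<Rightarrow>\<^sub>L 'a)"
  where "radj A = (THE B. \<forall>x y. inner (blinfun_apply A x) y = inner x (blinfun_apply B y))"

lemma radj_eqI:
  assumes "\<And>x y. inner (blinfun_apply A x) y = inner x (blinfun_apply B y)"
  shows "radj A = B"
  unfolding radj_def
proof (rule the_equality)
  fix C assume "\<forall>x y. inner (blinfun_apply A x) y = inner x (blinfun_apply C y)"
  then have "inner x (C y) = inner x (B y)" for x y by (simp add: assms[symmetric])
  then show "C = B" using blinfun_eqI inner_eqI by blast
qed (use assms in blast)

lemma inner_radj:
  fixes A :: "'a::{real_inner, banach} \<Rightarrow>\<^sub>L 'b::real_inner"
  shows "inner (blinfun_apply A x) y = inner x (blinfun_apply (radj A) y)"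
proof -
  have "\<exists>z. \<forall>x. inner (blinfun_apply A x) y = inner x z" for y
    by (rule riesz_representation)
      (rule bounded_linear_compose[OF bounded_linear_inner_left blinfun.bounded_linear_right])
  then obtain B where B: "\<And>x y. inner (blinfun_apply A x) y = inner x (B y)" by metis
  have "bounded_linear B"
  proof (rule bounded_linear_intro[where K = "norm A"])
    fix y z :: 'b and r :: real
    have "inner x (B (y + z)) = inner x (B y + B z)" for x
      by (simp add: B[symmetric] inner_add_right)
    then show "B (y + z) = B y + B z" by (rule inner_eqI)
    have "inner x (B (r *\<^sub>R y)) = inner x (r *\<^sub>R B y)" for x
      by (simp add: B[symmetric])
    then show "B (r *\<^sub>R y) = r *\<^sub>R B y" by (rule inner_eqI)
    have "norm (B y) * norm (B y) = inner (A (B y)) y"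
      by (simp add: B power2_eq_square[symmetric] power2_norm_eq_inner)
    also have "\<dots> \<le> norm (A (B y)) * norm y" by (rule norm_cauchy_schwarz)
    also have "\<dots> \<le> norm (B y) * (norm y * norm A)"
      using mult_right_mono[OF norm_blinfun[of A "B y"] norm_ge_zero[of y]]
      by (simp add: algebra_simps)
    finally show "norm (B y) \<le> norm y * norm A"
      by (cases "B y = 0") (auto simp: mult_le_cancel_left)
  qed
  then have "radj A = Blinfun B"
    by (intro radj_eqI) (simp add: B bounded_linear_Blinfun_apply)
  then show ?thesis using \<open>bounded_linear B\<close> by (simp add: B bounded_linear_Blinfun_apply)
qed

context
  fixes A :: "'a::{real_inner, banach} \<Rightarrow>\<^sub>L 'b::{real_inner, banach}"
begin

lemma radj_radj: "radj (radj A) = A"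
  by (rule radj_eqI) (metis inner_commute inner_radj)

lemma norm_radj_apply_le: "norm (blinfun_apply (radj A) y) \<le> norm A * norm y"
proof -
  let ?z = "blinfun_apply (radj A) y"
  have "norm ?z * norm ?z = inner (A ?z) y"
    by (simp add: inner_radj[of A] power2_eq_square[symmetric] power2_norm_eq_inner)
  also have "\<dots> \<le> norm (A ?z) * norm y" by (rule norm_cauchy_schwarz)
  also have "\<dots> \<le> norm ?z * (norm A * norm y)"
    using mult_right_mono[OF norm_blinfun[of A ?z] norm_ge_zero[of y]]
    by (simp add: algebra_simps)
  finally show ?thesis by (cases "?z = 0") (auto simp: mult_le_cancel_left)
qed

lemma radj_add: "radj (A + B) = radj A + radj B"
  by (rule radj_eqI) (simp add: blinfun.add_left inner_add_left inner_add_right inner_radj)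

lemma radj_diff: "radj (A - B) = radj A - radj B"
  by (rule radj_eqI) (simp add: blinfun.diff_left inner_diff_left inner_diff_right inner_radj)

lemma radj_compose: "radj (A o\<^sub>L B) = radj B o\<^sub>L radj A"
  for B :: "'c::{real_inner, banach} \<Rightarrow>\<^sub>L 'a"
  by (rule radj_eqI) (simp add: inner_radj)

lemma norm_radj_compose_self: "norm (radj A o\<^sub>L A) = (norm A)\<^sup>2"
proof (rule antisym)
  have 1: "norm (radj A) \<le> norm A" by (rule norm_blinfun_bound) (simp_all add: norm_radj_apply_le)
  show "norm (radj A o\<^sub>L A) \<le> (norm A)\<^sup>2"
    using norm_blinfun_compose[of "radj A" A] mult_right_mono[OF 1 norm_ge_zero[of A]]
    by (simp add: power2_eq_square)
  have "norm A \<le> sqrt (norm (radj A o\<^sub>L A))"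
  proof (rule norm_blinfun_bound)
    fix x
    have "(norm (A x))\<^sup>2 = inner x ((radj A o\<^sub>L A) x)"
      by (simp add: power2_norm_eq_inner inner_radj[of A])
    also have "\<dots> \<le> norm x * norm ((radj A o\<^sub>L A) x)" by (rule norm_cauchy_schwarz)
    also have "\<dots> \<le> norm x * (norm (radj A o\<^sub>L A) * norm x)"
      by (intro mult_left_mono norm_blinfun) simp
    also have "\<dots> = (sqrt (norm (radj A o\<^sub>L A)) * norm x)\<^sup>2"
      by (simp add: power2_eq_square algebra_simps)
    finally show "norm (A x) \<le> sqrt (norm (radj A o\<^sub>L A)) * norm x"
      by (rule power2_le_imp_le) simp
  qed simp
  then have "(norm A)\<^sup>2 \<le> (sqrt (norm (radj A o\<^sub>L A)))\<^sup>2" by (rule power_mono) simp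
  then show "(norm A)\<^sup>2 \<le> norm (radj A o\<^sub>L A)" by simp
qed

end

lemma norm_radj: "norm (radj A) = norm A"
  for A :: "'a::{real_inner, banach} \<Rightarrow>\<^sub>L 'b::{real_inner, banach}"
proof (rule antisym)
  show *: "norm (radj A) \<le> norm A"
    for A :: "'a::{real_inner, banach} \<Rightarrow>\<^sub>L 'b::{real_inner, banach}"
    by (rule norm_blinfun_bound) (simp_all add: norm_radj_apply_le)
  have "norm (radj (radj A)) \<le> norm (radj A)"
    by (rule norm_blinfun_bound) (simp_all add: norm_radj_apply_le)
  then show "norm A \<le> norm (radj A)" by (simp add: radj_radj)
qed

lemma radj_id [simp]: "radj id_blinfun = id_blinfun"
  by (rule radj_eqI) simp

lemma radj_0 [simp]: "radj 0 = 0"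
  by (rule radj_eqI) simp

lemma tendsto_radj:
  fixes f :: "nat \<Rightarrow> 'a::{real_inner, banach} \<Rightarrow>\<^sub>L 'b::{real_inner, banach}"
  assumes "f \<longlonglongrightarrow> A"
  shows "(\<lambda>n. radj (f n)) \<longlonglongrightarrow> radj A"
proof -
  have "(\<lambda>n. norm (radj (f n) - radj A)) \<longlonglongrightarrow> 0"
    using assms by (simp add: radj_diff[symmetric] norm_radj LIM_zero_iff tendsto_norm_zero_iff)
  then show ?thesis by (simp add: LIM_zero_iff tendsto_norm_zero_iff)
qed

section \<open>Complex linearity and the complex adjoint\<close>

lemma inner_scaleC_left: "inner (scaleC c x) y = inner x (scaleC (cnj c) y)"
  for x y :: "'a::complex_inner"
  by (simp add: Re_cinner[symmetric] cinner_scaleC_left cinner_scaleC_right)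

lemma Im_cinner: "Im (cinner x y) = inner x (scaleC \<i> y)" for x y :: "'a::complex_inner"
  by (simp add: Re_cinner[symmetric] cinner_scaleC_right)

definition clinear_op :: "('a::complex_inner \<Rightarrow>\<^sub>L 'b::complex_inner) \<Rightarrow> bool"
  where "clinear_op A \<longleftrightarrow> (\<forall>c x. blinfun_apply A (scaleC c x) = scaleC c (blinfun_apply A x))"

lemma clinear_op_radj:
  fixes A :: "'a::{complex_inner, banach} \<Rightarrow>\<^sub>L 'b::{complex_inner, banach}"
  assumes "clinear_op A"
  shows "clinear_op (radj A)"
  unfolding clinear_op_def
proof (intro allI)
  fix c y
  have "inner x (radj A (scaleC c y)) = inner x (scaleC c (radj A y))" for x
  proof -
    have "inner x (radj A (scaleC c y)) = inner (A (scaleC (cnj c) x)) y"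
      using assms by (simp add: inner_radj[symmetric] clinear_op_def inner_scaleC_left)
    also have "\<dots> = inner x (scaleC c (radj A y))" by (simp add: inner_radj inner_scaleC_left)
    finally show ?thesis .
  qed
  then show "radj A (scaleC c y) = scaleC c (radj A y)" by (rule inner_eqI)
qed

text \<open>Real parts agree by the defining property of \<open>radj\<close>. Imaginary parts reduce
  to real parts after multiplying the second argument by \<open>i\<close>, which
  \<open>radj A\<close> respects because it is complex-linear with \<open>A\<close>.\<close>

lemma adj_op_eq_radj:
  fixes A :: "'a::{complex_inner, banach} \<Rightarrow>\<^sub>L 'a"
  assumes A: "clinear_op A"
  shows "adj_op A = radj A"
  unfolding adj_op_def
proof (rule the_equality)
  have "cinner (A x) y = cinner x (radj A y)" for x y
    using clinear_op_radj[OF A]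
    by (simp add: complex_eq_iff Re_cinner Im_cinner inner_radj clinear_op_def)
  then show "\<forall>x y. cinner (A x) y = cinner x (radj A y)" by blast
  fix B assume "\<forall>x y. cinner (blinfun_apply A x) y = cinner x (blinfun_apply B y)"
  then show "B = radj A" by (intro radj_eqI[symmetric]) (simp add: Re_cinner[symmetric])
qed

section \<open>Isometric isomorphisms\<close>

lemma ringI_transport:
  fixes A (structure) and B (structure)
  assumes "ring A" and bij: "bij_betw f (carrier A) (carrier B)"
    and add: "\<And>x y. \<lbrakk>x \<in> carrier A; y \<in> carrier A\<rbrakk> \<Longrightarrow> f (x \<oplus>\<^bsub>A\<^esub> y) = f x \<oplus>\<^bsub>B\<^esub> f y"
    and mult: "\<And>x y. \<lbrakk>x \<in> carrier A; y \<in> carrier A\<rbrakk> \<Longrightarrow> f (x \<otimes>\<^bsub>A\<^esub> y) = f x \<otimes>\<^bsub>B\<^esub> f y"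
    and one: "f \<one>\<^bsub>A\<^esub> = \<one>\<^bsub>B\<^esub>" and zero: "f \<zero>\<^bsub>A\<^esub> = \<zero>\<^bsub>B\<^esub>"
  shows "ring B"
proof -
  interpret A: ring A by fact
  have car: "carrier B = f ` carrier A" using bij by (simp add: bij_betw_def)
  show ?thesis
  proof (rule ringI)
    show "abelian_group B"
    proof (rule abelian_groupI)
      fix x assume "x \<in> carrier B"
      then obtain a where a: "a \<in> carrier A" "x = f a" by (auto simp: car)
      then have "f (\<ominus>\<^bsub>A\<^esub> a) \<oplus>\<^bsub>B\<^esub> x = \<zero>\<^bsub>B\<^esub>"
        by (simp add: add[symmetric] zero[symmetric] A.l_neg)
      then show "\<exists>y\<in>carrier B. y \<oplus>\<^bsub>B\<^esub> x = \<zero>\<^bsub>B\<^esub>" using a by (auto simp: car)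
    qed (auto simp: car add[symmetric] zero[symmetric] A.a_ac)
    show "Group.monoid B"
      by (rule monoidI) (auto simp: car mult[symmetric] one[symmetric] A.m_assoc)
  qed (auto simp: car add[symmetric] mult[symmetric] A.l_distr A.r_distr)
qed

text \<open>\<open>B\<close> is an arbitrary record, and all its axioms follow from those of
  \<open>A\<close> through \<open>f\<close>. With \<open>T_alg N\<close> as \<open>A\<close> and
  \<open>S_alg N\<close> as \<open>B\<close>, completeness and the C*-identity of the quotient norm
  come without any analysis of cosets.\<close>

locale isometric_iso =
  A: c_star_algebra A for A :: "('a, 'm) star_alg_scheme" and B :: "('b, 'n) star_alg_scheme" and f +
  assumes bij: "bij_betw f (carrier A) (carrier B)"
    and hom_add: "\<lbrakk>x \<in> carrier A; y \<in> carrier A\<rbrakk> \<Longrightarrow> f (x \<oplus>\<^bsub>A\<^esub> y) = f x \<oplus>\<^bsub>B\<^esub> f y"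
    and hom_mult: "\<lbrakk>x \<in> carrier A; y \<in> carrier A\<rbrakk> \<Longrightarrow> f (x \<otimes>\<^bsub>A\<^esub> y) = f x \<otimes>\<^bsub>B\<^esub> f y"
    and hom_one: "f \<one>\<^bsub>A\<^esub> = \<one>\<^bsub>B\<^esub>" and hom_zero: "f \<zero>\<^bsub>A\<^esub> = \<zero>\<^bsub>B\<^esub>"
    and hom_smult: "x \<in> carrier A \<Longrightarrow> f (c \<odot>\<^bsub>A\<^esub> x) = c \<odot>\<^bsub>B\<^esub> f x"
    and hom_star: "x \<in> carrier A \<Longrightarrow> f (star A x) = star B (f x)"
    and hom_nrm: "x \<in> carrier A \<Longrightarrow> nrm B (f x) = nrm A x"
begin

lemma car: "carrier B = f ` carrier A"
  using bij by (simp add: bij_betw_def)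

sublocale B: ring B
  by (rule ringI_transport[OF A.ring_axioms bij]) (simp_all add: hom_add hom_mult hom_one hom_zero)

lemma hom_minus:
  assumes "x \<in> carrier A" "y \<in> carrier A"
  shows "f (x \<ominus>\<^bsub>A\<^esub> y) = f x \<ominus>\<^bsub>B\<^esub> f y"
proof -
  have "\<ominus>\<^bsub>B\<^esub> f y = f (\<ominus>\<^bsub>A\<^esub> y)"
    using assms by (intro B.minus_equality)
      (auto simp: car hom_add[symmetric] hom_zero[symmetric] A.l_neg)
  then show ?thesis using assms by (simp add: A.minus_eq B.minus_eq hom_add)
qed

lemma norm_conv_hom:
  assumes "range g \<subseteq> carrier A" "x \<in> carrier A"
  shows "norm_conv B (f \<circ> g) (f x) \<longleftrightarrow> norm_conv A g x"
proof -
  have "nrm B (f (g n) \<ominus>\<^bsub>B\<^esub> f x) = nrm A (g n \<ominus>\<^bsub>A\<^esub> x)" for n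
    using assms by (simp add: hom_minus[symmetric] hom_nrm image_subset_iff)
  then show ?thesis by (simp add: norm_conv_def)
qed

lemma range_lift:
  assumes "range h \<subseteq> f ` I"
  obtains g where "range g \<subseteq> I" "h = f \<circ> g"
proof -
  have "\<forall>n. \<exists>a\<in>I. h n = f a" using assms by blast
  then obtain g where "\<And>n. g n \<in> I \<and> h n = f (g n)" by metis
  then show ?thesis by (intro that[of g]) auto
qed

lemma c_star_algebra_image: "c_star_algebra B"
proof
  fix h :: "nat \<Rightarrow> 'b"
  assume h: "range h \<subseteq> carrier B"
    and C: "\<And>e. e > 0 \<Longrightarrow> \<exists>M. \<forall>m\<ge>M. \<forall>n\<ge>M. nrm B (h m \<ominus>\<^bsub>B\<^esub> h n) < e"
  obtain g where g: "range g \<subseteq> carrier A" and hg: "h = f \<circ> g"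
    using h unfolding car by (rule range_lift)
  have "nrm B (h m \<ominus>\<^bsub>B\<^esub> h n) = nrm A (g m \<ominus>\<^bsub>A\<^esub> g n)" for m n
    using g by (simp add: hg hom_minus[symmetric] hom_nrm image_subset_iff)
  then have "\<exists>x\<in>carrier A. norm_conv A g x"
    using C by (intro A.complete[OF g]) simp
  then show "\<exists>x\<in>carrier B. norm_conv B h x"
    using norm_conv_hom[OF g] by (auto simp: car hg)
qed (auto simp: car hom_add[symmetric] hom_mult[symmetric] hom_smult[symmetric]
    hom_star[symmetric] hom_nrm A.smult_closed A.smult_add_left A.smult_add_right A.smult_smult
    A.smult_1 A.smult_mult_left A.smult_mult_right A.star_closed A.star_star A.star_add
    A.star_smult A.star_mult A.nrm_nonneg A.nrm_smult A.nrm_add A.nrm_mult A.nrm_star A.nrm_eq_0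
    hom_zero[symmetric] inj_on_eq_iff[OF bij_betw_imp_inj_on[OF bij]])

text \<open>Any left inverse on the carrier will do. This is how \<open>W_tilde N\<close> enters,
  for which only the values on the range of the isomorphism are computed.\<close>

lemma inverse:
  assumes g: "\<And>x. x \<in> carrier A \<Longrightarrow> g (f x) = x"
  shows "isometric_iso B A g"
proof -
  interpret B: c_star_algebra B by (rule c_star_algebra_image)
  show ?thesis
  proof
    show "bij_betw g (carrier B) (carrier A)"
      unfolding car by (rule bij_betw_byWitness[of _ f]) (auto simp: g)
  qed (auto simp: car hom_add[symmetric] hom_mult[symmetric] hom_smult[symmetric] g
      hom_star[symmetric] hom_nrm hom_one[symmetric] hom_zero[symmetric]
      A.star_closed A.smult_closed)
qed

lemma star_isomorphism: "star_isomorphism A B f"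
  using bij unfolding star_isomorphism_def ring_iso_def
  by (auto intro!: ring_hom_memI simp: hom_add hom_mult hom_one hom_smult hom_star car)

lemma closed_ideal_image:
  assumes I: "closed_ideal A I"
  shows "closed_ideal B (f ` I)"
proof -
  interpret I: ideal I A using I by (simp add: closed_ideal_def)
  have sub: "I \<subseteq> carrier A" by (rule I.a_subset)
  have inI: "f x \<in> f ` I \<longleftrightarrow> x \<in> I" if "x \<in> carrier A" for x
    using that sub bij_betw_imp_inj_on[OF bij] by (auto simp: inj_on_image_mem_iff)
  have "ideal (f ` I) B"
  proof (rule idealI)
    show "subgroup (f ` I) (add_monoid B)"
    proof
      show "f ` I \<subseteq> carrier (add_monoid B)" using sub by (auto simp: car)
      show "\<one>\<^bsub>add_monoid B\<^esub> \<in> f ` I"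
        by (auto simp: hom_zero[symmetric] intro: additive_subgroup.zero_closed[OF I.additive_subgroup_axioms])
    next
      fix x y assume "x \<in> f ` I" "y \<in> f ` I"
      then show "x \<otimes>\<^bsub>add_monoid B\<^esub> y \<in> f ` I"
        using sub by (auto simp: hom_add[symmetric] subset_iff I.a_closed)
    next
      fix x assume "x \<in> f ` I"
      then obtain a where a: "a \<in> I" "x = f a" by blast
      then have "\<ominus>\<^bsub>B\<^esub> x = f (\<ominus>\<^bsub>A\<^esub> a)"
        using sub by (intro B.minus_equality)
          (auto simp: car hom_add[symmetric] hom_zero[symmetric] A.l_neg subset_iff)
      then show "inv\<^bsub>add_monoid B\<^esub> x \<in> f ` I"
        using a by (simp add: a_inv_def[symmetric])
    qed
  next
    fix a x assume "a \<in> f ` I" "x \<in> carrier B"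
    then show "x \<otimes>\<^bsub>B\<^esub> a \<in> f ` I" "a \<otimes>\<^bsub>B\<^esub> x \<in> f ` I"
      using sub by (auto simp: car hom_mult[symmetric] subset_iff I.I_l_closed I.I_r_closed)
  qed (rule B.ring_axioms)
  moreover have "\<forall>c. \<forall>x\<in>f ` I. c \<odot>\<^bsub>B\<^esub> x \<in> f ` I"
    using I sub by (auto simp: closed_ideal_def hom_smult[symmetric] subset_iff)
  moreover have "norm_closed B (f ` I)"
    unfolding norm_closed_def
  proof (intro allI impI)
    fix h y assume h: "range h \<subseteq> f ` I" and "y \<in> carrier B" and conv: "norm_conv B h y"
    then obtain x where x: "x \<in> carrier A" "y = f x" by (auto simp: car)
    obtain g where g: "range g \<subseteq> I" and hg: "h = f \<circ> g" using h by (rule range_lift)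
    then have "norm_conv A g x" using conv sub norm_conv_hom[of g x] x by auto
    then have "x \<in> I" using I g x by (auto simp: closed_ideal_def norm_closed_def)
    then show "y \<in> f ` I" using x by blast
  qed
  ultimately show ?thesis by (simp add: closed_ideal_def)
qed

lemma closed_ideal_gen_image_subset:
  assumes "X \<subseteq> carrier A"
  shows "closed_ideal_gen B (f ` X) \<subseteq> f ` closed_ideal_gen A X"
proof
  fix y assume y: "y \<in> closed_ideal_gen B (f ` X)"
  have *: "y \<in> f ` I" if "closed_ideal A I" "X \<subseteq> I" for I
    using y closed_ideal_image[OF that(1)] that(2) by (auto simp: closed_ideal_gen_def)
  have "closed_ideal A (carrier A)"
    by (auto simp: closed_ideal_def norm_closed_def A.oneideal A.smult_closed)
  then obtain x where x: "x \<in> carrier A" "y = f x" using * assms by blast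
  have "x \<in> I" if I: "closed_ideal A I" "X \<subseteq> I" for I
  proof -
    have "I \<subseteq> carrier A" using I by (auto simp: closed_ideal_def dest!: ideal.axioms(1) additive_subgroup.a_subset)
    then show ?thesis using *[OF I] x bij_betw_imp_inj_on[OF bij] by (auto simp: inj_on_image_mem_iff)
  qed
  then show "y \<in> f ` closed_ideal_gen A X" using x by (auto simp: closed_ideal_gen_def)
qed

end

text \<open>Both inclusions come from \<open>closed_ideal_gen_image_subset\<close>: once for
  \<open>f\<close>, once for its inverse and then mapped back by \<open>f\<close>.\<close>

lemma (in isometric_iso) closed_ideal_gen_image:
  assumes X: "X \<subseteq> carrier A"
  shows "f ` closed_ideal_gen A X = closed_ideal_gen B (f ` X)"
proof
  define g where "g = inv_into (carrier A) f"
  have g: "g (f x) = x" if "x \<in> carrier A" for x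
    unfolding g_def using that bij_betw_imp_inj_on[OF bij] by simp
  interpret B: c_star_algebra B by (rule c_star_algebra_image)
  interpret G: isometric_iso B A g by (rule inverse[OF g])
  have gX: "g ` f ` X = X" using X g by (auto simp: subset_iff image_image)
  have 1: "closed_ideal_gen A X \<subseteq> g ` closed_ideal_gen B (f ` X)"
    using G.closed_ideal_gen_image_subset[of "f ` X"] X gX by (auto simp: car)
  have "closed_ideal B (carrier B)"
    by (auto simp: closed_ideal_def norm_closed_def B.oneideal B.smult_closed)
  then have 2: "closed_ideal_gen B (f ` X) \<subseteq> f ` carrier A"
    using X unfolding closed_ideal_gen_def car by (intro Inter_lower) auto
  have 3: "f (g y) = y" if "y \<in> f ` carrier A" for y using that g by auto
  show "f ` closed_ideal_gen A X \<subseteq> closed_ideal_gen B (f ` X)"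
  proof (rule image_subsetI)
    fix x assume "x \<in> closed_ideal_gen A X"
    then obtain y where "y \<in> closed_ideal_gen B (f ` X)" "x = g y" using 1 by blast
    then show "f x \<in> closed_ideal_gen B (f ` X)" using 2 3 by auto
  qed
qed (rule closed_ideal_gen_image_subset[OF X])


section \<open>Closed subalgebras\<close>

lemma closed_subalgebra_Inter:
  assumes "\<B> \<noteq> {}" "\<And>B. B \<in> \<B> \<Longrightarrow> closed_subalgebra A B"
  shows "closed_subalgebra A (\<Inter>\<B>)"
proof -
  have "norm_closed A (\<Inter>\<B>)"
    using assms unfolding closed_subalgebra_def norm_closed_def by (meson Inter_iff le_Inf_iff)
  then show ?thesis using assms unfolding closed_subalgebra_def by blast
qed

lemma closed_subalgebra_gen:
  assumes "closed_subalgebra A B" "X \<subseteq> B"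
  shows "closed_subalgebra A (closed_subalgebra_gen A X)" "X \<subseteq> closed_subalgebra_gen A X"
    "closed_subalgebra_gen A X \<subseteq> B"
  using assms unfolding closed_subalgebra_gen_def by (auto intro!: closed_subalgebra_Inter)

lemma c_star_subalgebra_gen:
  assumes "c_star_subalgebra A B" "X \<subseteq> B"
  shows "c_star_subalgebra A (c_star_subalgebra_gen A X)" "X \<subseteq> c_star_subalgebra_gen A X"
    "c_star_subalgebra_gen A X \<subseteq> B"
  using assms unfolding c_star_subalgebra_gen_def c_star_subalgebra_def
  by (auto intro!: closed_subalgebra_Inter)


section \<open>Algebras of bounded operators\<close>

lemma bounded_ops_simps [simp]:
  "carrier bounded_ops = Collect clinear_op" "mult bounded_ops = (o\<^sub>L)"
  "one bounded_ops = id_blinfun" "zero bounded_ops = 0" "add bounded_ops = (+)"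
  "smult bounded_ops = (\<lambda>c A. scaleC_op c o\<^sub>L A)" "star bounded_ops = adj_op"
  "nrm bounded_ops = norm"
  by (auto simp: bounded_ops_def clinear_op_def)

lemma scaleC_op_apply [simp]: "blinfun_apply (scaleC_op c) x = scaleC c x"
  by (simp add: scaleC_op.rep_eq)

lemma scaleC_simps [simp]:
  "scaleC c 0 = 0" "scaleC c (- x) = - scaleC c x" "scaleC c (x - y) = scaleC c x - scaleC c y"
  "scaleC 1 x = x" "scaleC (- 1) x = - x" "scaleC c (r *\<^sub>R x) = r *\<^sub>R scaleC c x"
  for x :: "'a::complex_inner"
proof -
  show z: "scaleC c 0 = 0" using scaleC_add_right[of c 0 0] by simp
  show m: "scaleC c (- x) = - scaleC c x" for x :: 'a
    using scaleC_add_right[of c x "- x"] z by (metis add.right_inverse minus_unique)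
  show "scaleC c (x - y) = scaleC c x - scaleC c y"
    using scaleC_add_right[of c x "- y"] m by simp
  show "scaleC 1 x = x" using scaleC_of_real[of 1 x] by simp
  show "scaleC (- 1) x = - x" using scaleC_of_real[of "- 1" x] by simp
  show "scaleC c (r *\<^sub>R x) = r *\<^sub>R scaleC c x"
    by (simp add: scaleC_of_real[symmetric] scaleC_scaleC mult.commute)
qed

lemma scaleC_op_neg_one [simp]: "scaleC_op (- 1) o\<^sub>L A = - A"
  by (rule blinfun_eqI) (simp add: blinfun.minus_left)

lemma blinfun_compose_assoc: "(A o\<^sub>L B) o\<^sub>L C = A o\<^sub>L (B o\<^sub>L C)"
  by (rule blinfun_eqI) simp

lemma blinfun_compose_distrib:
  "(A + B) o\<^sub>L C = (A o\<^sub>L C) + (B o\<^sub>L C)" "D o\<^sub>L (A + B) = (D o\<^sub>L A) + (D o\<^sub>L B)"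
  "(A - B) o\<^sub>L C = (A o\<^sub>L C) - (B o\<^sub>L C)" "D o\<^sub>L (A - B) = (D o\<^sub>L A) - (D o\<^sub>L B)"
  by (rule blinfun_eqI, simp add: blinfun.bilinear_simps)+

lemma blinfun_compose_simps [simp]:
  "id_blinfun o\<^sub>L A = A" "A o\<^sub>L id_blinfun = A" "0 o\<^sub>L A = 0" "A o\<^sub>L 0 = 0"
  by (rule blinfun_eqI, simp)+

lemma norm_scaleC_op_compose: "norm (scaleC_op c o\<^sub>L A) = cmod c * norm A"
  for A :: "'a::complex_inner \<Rightarrow>\<^sub>L 'a"
proof (rule antisym)
  have le: "norm (scaleC_op c o\<^sub>L A) \<le> cmod c * norm A" for c and A :: "'a \<Rightarrow>\<^sub>L 'a"
    by (rule norm_blinfun_bound)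
      (auto simp: norm_scaleC norm_blinfun mult.assoc intro!: mult_left_mono)
  show "norm (scaleC_op c o\<^sub>L A) \<le> cmod c * norm A" by (rule le)
  show "cmod c * norm A \<le> norm (scaleC_op c o\<^sub>L A)"
  proof (cases "c = 0")
    case False
    have "A = scaleC_op (inverse c) o\<^sub>L (scaleC_op c o\<^sub>L A)"
      using False by (intro blinfun_eqI) (simp add: scaleC_scaleC)
    then have "norm A \<le> cmod (inverse c) * norm (scaleC_op c o\<^sub>L A)" using le by metis
    then have "cmod c * norm A \<le> cmod c * (cmod (inverse c) * norm (scaleC_op c o\<^sub>L A))"
      by (intro mult_left_mono) auto
    then show ?thesis using False by (simp add: norm_inverse mult.assoc[symmetric])
  qed simp
qed

lemma clinear_opD: "clinear_op A \<Longrightarrow> blinfun_apply A (scaleC c x) = scaleC c (blinfun_apply A x)"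
  by (simp add: clinear_op_def)

lemma clinear_op_simps [simp]:
  "clinear_op 0" "clinear_op id_blinfun" "clinear_op (scaleC_op c)"
  by (auto simp: clinear_op_def scaleC_scaleC mult.commute)

lemma clinear_op_compose: "clinear_op A \<Longrightarrow> clinear_op B \<Longrightarrow> clinear_op (A o\<^sub>L B)"
  by (simp add: clinear_op_def)

lemma clinear_op_add: "clinear_op A \<Longrightarrow> clinear_op B \<Longrightarrow> clinear_op (A + B)"
  by (simp add: clinear_op_def blinfun.add_left scaleC_add_right)

lemma clinear_op_diff: "clinear_op A \<Longrightarrow> clinear_op B \<Longrightarrow> clinear_op (A - B)"
  by (simp add: clinear_op_def blinfun.diff_left)

lemma clinear_op_minus: "clinear_op A \<Longrightarrow> clinear_op (- A)"
  by (simp add: clinear_op_def blinfun.minus_left)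

lemmas clinear_op_intros = clinear_op_compose clinear_op_add clinear_op_diff clinear_op_minus
  clinear_op_radj

lemma blinfun_tendsto_apply: "f \<longlonglongrightarrow> A \<Longrightarrow> (\<lambda>n. blinfun_apply (f n) x) \<longlonglongrightarrow> blinfun_apply A x"
  by (intro tendsto_intros)

lemma clinear_op_LIMSEQ:
  assumes "\<And>n. clinear_op (f n)" "f \<longlonglongrightarrow> A"
  shows "clinear_op A"
  unfolding clinear_op_def
proof (intro allI)
  fix c x
  have "(\<lambda>n. f n (scaleC c x)) \<longlonglongrightarrow> A (scaleC c x)" by (rule blinfun_tendsto_apply[OF assms(2)])
  moreover have "(\<lambda>n. scaleC_op c (f n x)) \<longlonglongrightarrow> scaleC_op c (A x)"
    by (intro blinfun.tendsto tendsto_const blinfun_tendsto_apply assms(2))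
  ultimately show "A (scaleC c x) = scaleC c (A x)"
    using assms(1) by (intro LIMSEQ_unique) (auto simp: clinear_op_def)
qed

lemma radj_scaleC_op: "radj (scaleC_op c) = scaleC_op (cnj c)"
  by (rule radj_eqI) (simp add: inner_scaleC_left)

lemma radj_scaleC_compose:
  fixes A :: "'a::{complex_inner, banach} \<Rightarrow>\<^sub>L 'a"
  assumes "clinear_op A"
  shows "radj (scaleC_op c o\<^sub>L A) = scaleC_op (cnj c) o\<^sub>L radj A"
  using clinear_op_radj[OF assms]
  by (intro blinfun_eqI) (simp add: radj_compose radj_scaleC_op clinear_opD)

context
  fixes B :: "('a::{complex_inner, banach} \<Rightarrow>\<^sub>L 'a) set"
  assumes B: "\<And>x y. \<lbrakk>x \<in> B; y \<in> B\<rbrakk> \<Longrightarrow> x + y \<in> B"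
    "\<And>x y. \<lbrakk>x \<in> B; y \<in> B\<rbrakk> \<Longrightarrow> x o\<^sub>L y \<in> B" "\<And>x. x \<in> B \<Longrightarrow> - x \<in> B"
    "0 \<in> B" "id_blinfun \<in> B"
begin

lemma ring_ops: "ring (bounded_ops\<lparr>carrier := B\<rparr>)"
proof (rule ringI)
  let ?A = "bounded_ops\<lparr>carrier := B\<rparr>"
  show "abelian_group ?A"
  proof (rule abelian_groupI)
    fix x assume "x \<in> carrier ?A"
    then show "\<exists>y\<in>carrier ?A.
        y \<oplus>\<^bsub>?A\<^esub> x = \<zero>\<^bsub>?A\<^esub>"
      using B by (intro bexI[of _ "- x"]) auto
  qed (simp_all add: B)
  show "Group.monoid ?A"
    by (rule monoidI) (simp_all add: B blinfun_compose_assoc)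
qed (simp_all add: blinfun_compose_distrib)

lemma minus_ops:
  assumes "x \<in> B" "y \<in> B"
  shows "x \<ominus>\<^bsub>bounded_ops\<lparr>carrier := B\<rparr>\<^esub> y = x - y"
proof -
  interpret ring "bounded_ops\<lparr>carrier := B\<rparr>" by (rule ring_ops)
  have "\<ominus>\<^bsub>bounded_ops\<lparr>carrier := B\<rparr>\<^esub> y = - y"
    using assms B by (intro minus_equality) auto
  then show ?thesis using assms by (simp add: minus_eq)
qed

end

lemma bounded_ops_carrier_eq: "bounded_ops\<lparr>carrier := Collect clinear_op\<rparr> = bounded_ops"
  by (auto simp: bounded_ops_def clinear_op_def)

lemma norm_conv_bounded_ops:
  fixes A :: "'a::{complex_inner, banach} \<Rightarrow>\<^sub>L 'a"
  assumes "\<And>n. clinear_op (f n)" "clinear_op A"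
  shows "norm_conv bounded_ops f A \<longleftrightarrow> f \<longlonglongrightarrow> A"
proof -
  have "f n \<ominus>\<^bsub>bounded_ops\<^esub> A = f n - A" for n
    using minus_ops[of "Collect clinear_op" "f n" A] assms
    by (simp add: clinear_op_intros bounded_ops_carrier_eq)
  then show ?thesis
    by (simp add: norm_conv_def LIM_zero_iff tendsto_norm_zero_iff)
qed

lemma closed_subalgebra_opsI:
  fixes B :: "('a::{complex_inner, banach} \<Rightarrow>\<^sub>L 'a) set"
  assumes "\<And>x. x \<in> B \<Longrightarrow> clinear_op x" "0 \<in> B"
    "\<And>x y. \<lbrakk>x \<in> B; y \<in> B\<rbrakk> \<Longrightarrow> x + y \<in> B"
    "\<And>x y. \<lbrakk>x \<in> B; y \<in> B\<rbrakk> \<Longrightarrow> x o\<^sub>L y \<in> B"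
    "\<And>c x. x \<in> B \<Longrightarrow> scaleC_op c o\<^sub>L x \<in> B"
    "\<And>f x. \<lbrakk>\<And>n. f n \<in> B; f \<longlonglongrightarrow> x; clinear_op x\<rbrakk> \<Longrightarrow> x \<in> B"
  shows "closed_subalgebra bounded_ops B"
proof -
  have "norm_closed bounded_ops B"
    unfolding norm_closed_def
  proof (intro allI impI)
    fix f x assume f: "range f \<subseteq> B" and x: "x \<in> carrier bounded_ops"
      and conv: "norm_conv bounded_ops f x"
    then have "f \<longlonglongrightarrow> x"
      using assms(1) by (subst norm_conv_bounded_ops[symmetric]) auto
    then show "x \<in> B" using f x assms(6)[of f x] by auto
  qed
  then show ?thesis using assms(1-5) by (auto simp: closed_subalgebra_def)
qed

lemma closed_subalgebra_opsD:
  fixes B :: "('a::{complex_inner, banach} \<Rightarrow>\<^sub>L 'a) set"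
  assumes B: "closed_subalgebra bounded_ops B"
  shows "x \<in> B \<Longrightarrow> clinear_op x" "0 \<in> B"
    "\<lbrakk>x \<in> B; y \<in> B\<rbrakk> \<Longrightarrow> x + y \<in> B" "\<lbrakk>x \<in> B; y \<in> B\<rbrakk> \<Longrightarrow> x o\<^sub>L y \<in> B"
    "x \<in> B \<Longrightarrow> scaleC_op c o\<^sub>L x \<in> B"
    "x \<in> B \<Longrightarrow> - x \<in> B" "\<lbrakk>x \<in> B; y \<in> B\<rbrakk> \<Longrightarrow> x - y \<in> B"
    "\<lbrakk>\<And>n. f n \<in> B; f \<longlonglongrightarrow> x\<rbrakk> \<Longrightarrow> x \<in> B"
proof -
  show cl: "clinear_op x" if "x \<in> B" for x using B that by (auto simp: closed_subalgebra_def)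
  show "0 \<in> B" using B by (auto simp: closed_subalgebra_def)
  show ad: "x + y \<in> B" "x o\<^sub>L y \<in> B" if "x \<in> B" "y \<in> B" for x y
    using B that by (auto simp: closed_subalgebra_def)
  show sc: "scaleC_op c o\<^sub>L x \<in> B" if "x \<in> B" for c x
    using B that by (auto simp: closed_subalgebra_def)
  show mi: "- x \<in> B" if "x \<in> B" for x using sc[OF that, of "- 1"] by simp
  show "x - y \<in> B" if "x \<in> B" "y \<in> B" using ad(1)[OF that(1) mi[OF that(2)]] by simp
  show "x \<in> B" if f: "\<And>n. f n \<in> B" "f \<longlonglongrightarrow> x"
  proof -
    have "clinear_op x" using cl f by (blast intro: clinear_op_LIMSEQ)
    then have "norm_conv bounded_ops f x" using f cl by (subst norm_conv_bounded_ops) auto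
    then show ?thesis
      using B f(1) \<open>clinear_op x\<close> unfolding closed_subalgebra_def norm_closed_def
      by (metis bounded_ops_simps(1) image_subsetI mem_Collect_eq)
  qed
qed

lemma closed_subalgebra_Collect_clinear:
  "closed_subalgebra bounded_ops (Collect clinear_op :: ('a::{complex_inner, banach} \<Rightarrow>\<^sub>L 'a) set)"
  by (rule closed_subalgebra_opsI) (auto intro: clinear_op_intros)

lemma c_star_algebra_ops:
  fixes B :: "('a::{complex_inner, banach} \<Rightarrow>\<^sub>L 'a) set"
  assumes B: "closed_subalgebra bounded_ops B" and id: "id_blinfun \<in> B"
    and adj: "\<And>x. x \<in> B \<Longrightarrow> radj x \<in> B"
  shows "c_star_algebra (bounded_ops\<lparr>carrier := B\<rparr>)"
proof -
  let ?A = "bounded_ops\<lparr>carrier := B\<rparr>"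
  note D = closed_subalgebra_opsD[OF B]
  have st: "adj_op x = radj x" if "x \<in> B" for x using that D(1) by (simp add: adj_op_eq_radj)
  have comm: "scaleC_op c o\<^sub>L x = x o\<^sub>L scaleC_op c" if "x \<in> B" for c x
    using D(1)[OF that] by (intro blinfun_eqI) (simp add: clinear_opD)
  have mi: "x \<ominus>\<^bsub>?A\<^esub> y = x - y" if "x \<in> B" "y \<in> B" for x y
    using that by (intro minus_ops D(2-6) id)
  interpret ring ?A by (intro ring_ops D(2-6) id)
  show ?thesis
  proof
    fix f :: "nat \<Rightarrow> 'a \<Rightarrow>\<^sub>L 'a" assume f: "range f \<subseteq> carrier ?A"
      and C: "\<And>e. e > 0 \<Longrightarrow> \<exists>M. \<forall>m\<ge>M. \<forall>n\<ge>M.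
        nrm ?A (f m \<ominus>\<^bsub>?A\<^esub> f n) < e"
    have fB: "f n \<in> B" for n using f by auto
    have "Cauchy f" using C by (intro CauchyI) (simp add: mi fB)
    then obtain x where x: "f \<longlonglongrightarrow> x" by (metis Cauchy_convergent convergent_def)
    then have xB: "x \<in> B" using D(8) fB by blast
    have "norm_conv ?A f x"
      using x by (simp add: norm_conv_def mi fB xB LIM_zero_iff tendsto_norm_zero_iff)
    then show "\<exists>x\<in>carrier ?A. norm_conv ?A f x"
      using xB by auto
  next
    fix x y c assume "x \<in> carrier ?A"
      "y \<in> carrier ?A"
    then have x: "x \<in> B" and y: "y \<in> B" by auto
    show "x \<otimes>\<^bsub>?A\<^esub> (c \<odot>\<^bsub>?A\<^esub> y)
        = c \<odot>\<^bsub>?A\<^esub> (x \<otimes>\<^bsub>?A\<^esub> y)"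
      using x by (simp add: blinfun_compose_assoc[symmetric] comm)
    show "star ?A (c \<odot>\<^bsub>?A\<^esub> x)
        = cnj c \<odot>\<^bsub>?A\<^esub> star ?A x"
      using x by (simp add: st D(1,5) radj_scaleC_compose)
  qed (auto simp: D st adj radj_add radj_compose radj_radj norm_radj_compose_self norm_triangle_ineq
      norm_blinfun_compose norm_scaleC_op_compose blinfun_compose_assoc blinfun_compose_distrib
      scaleC_add_left scaleC_scaleC blinfun.add_left intro!: blinfun_eqI)
qed

section \<open>Coordinates, shifts and truncations\<close>

text \<open>Used at two levels: it gives the basis vectors of \<open>complex l2\<close>, and it
  embeds \<open>complex l2\<close> as the component at depth \<open>m\<close> of
  \<open>complex l2 l2\<close>.\<close>

lift_definition iota :: "nat \<Rightarrow> 'a::real_inner \<Rightarrow>\<^sub>L 'a l2"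
  is "\<lambda>m z. Abs_l2 (\<lambda>k. if k = m then z else 0)"
proof -
  fix m :: nat
  have coord: "coord (Abs_l2 (\<lambda>k. if k = m then z else 0)) = (\<lambda>k. if k = m then z else 0)"
    for z :: 'a
    by (subst Abs_l2_inverse) (auto intro!: summable_finite[of "{m}"] split: if_splits)
  show "bounded_linear (\<lambda>z::'a. Abs_l2 (\<lambda>k. if k = m then z else 0))"
  proof (rule bounded_linear_intro[where K = 1])
    fix z :: 'a
    have "(norm (Abs_l2 (\<lambda>k. if k = m then z else 0)))\<^sup>2 = (norm z)\<^sup>2"
      unfolding norm_l2_sq coord by (subst suminf_finite[of "{m}"]) auto
    then show "norm (Abs_l2 (\<lambda>k. if k = m then z else 0)) \<le> norm z * 1" by simp
  qed (auto intro!: l2_eqI simp: coord)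
qed

lemma coord_iota: "coord ((iota m) z) k = (if k = m then z else 0)"
  unfolding iota.rep_eq by (subst Abs_l2_inverse) (auto intro!: summable_finite[of "{m}"] split: if_splits)

lift_definition proj :: "nat \<Rightarrow> 'a::real_inner l2 \<Rightarrow>\<^sub>L 'a" is "\<lambda>m x. coord x m"
  by (rule bounded_linear_coord)

lemma inner_iota: "inner ((iota m) z) x = inner z (coord x m)"
  unfolding inner_l2_def by (subst suminf_finite[of "{m}"]) (auto simp: coord_iota)

lemma radj_iota: "radj (iota m :: 'a::real_inner \<Rightarrow>\<^sub>L _) = proj m"
  by (rule radj_eqI) (simp add: inner_iota proj.rep_eq)

lemma radj_proj: "radj (proj m :: _ \<Rightarrow>\<^sub>L 'a::{real_inner, banach}) = iota m"
  using radj_radj[of "iota m :: 'a \<Rightarrow>\<^sub>L _"] by (simp add: radj_iota)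

text \<open>Testing an adjoint against \<open>iota r c\<close> reads off its coordinates; the
  adjoints of all concrete operators are computed this way.\<close>

lemma coord_radjI:
  fixes A :: "'a::{real_inner, banach} l2 \<Rightarrow>\<^sub>L 'b::real_inner"
  assumes "\<And>c. inner (blinfun_apply A ((iota r) c)) v = inner c y"
  shows "coord ((radj A) v) r = y"
  by (rule inner_eqI) (simp add: assms inner_iota[symmetric] inner_radj[symmetric])

lemma coord_scaleC [simp]: "coord (scaleC c x) k = scaleC c (coord x k)"
  by (simp add: scaleC_l2.rep_eq)

definition fin_vec :: "nat \<Rightarrow> (nat \<Rightarrow> 'a::real_inner) \<Rightarrow> 'a l2"
  where "fin_vec L f = Abs_l2 (\<lambda>k. if k < L then f k else 0)"

lemma coord_fin_vec: "coord (fin_vec L f) k = (if k < L then f k else 0)"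
  unfolding fin_vec_def by (subst Abs_l2_inverse) (auto intro!: summable_finite[of "{..<L}"] split: if_splits)

lemma norm_sq_finite:
  assumes "\<And>k. k \<ge> L \<Longrightarrow> coord x k = 0"
  shows "(norm x)\<^sup>2 = (\<Sum>k<L. (norm (coord x k))\<^sup>2)"
  unfolding norm_l2_sq by (rule suminf_finite) (auto simp: assms)

lemma norm_fin_vec_sq: "(norm (fin_vec L f))\<^sup>2 = (\<Sum>k<L. (norm (f k))\<^sup>2)"
  by (subst norm_sq_finite[of L]) (auto simp: coord_fin_vec)

lemma coord_sum: "coord (\<Sum>i\<in>I. f i) k = (\<Sum>i\<in>I. coord (f i) k)"
  by (induction I rule: infinite_finite_induct) auto

lemma blinfun_sum_apply: "blinfun_apply (\<Sum>i\<in>I. f i) x = (\<Sum>i\<in>I. blinfun_apply (f i) x)"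
  by (induction I rule: infinite_finite_induct) (auto simp: blinfun.add_left)

lemma blinfun_compose_sum:
  "(\<Sum>i\<in>I. f i) o\<^sub>L A = (\<Sum>i\<in>I. f i o\<^sub>L A)" "B o\<^sub>L (\<Sum>i\<in>I. f i) = (\<Sum>i\<in>I. B o\<^sub>L f i)"
  by (induction I rule: infinite_finite_induct) (auto simp: blinfun_compose_distrib)

subsection \<open>Truncations and reflections\<close>

lemma coord_P_op: "coord ((P_op n) x) k = (if k < n then coord x k else 0)"
  by (simp add: P_op.rep_eq P_vec.rep_eq)

lemma coord_R_op: "coord ((R_op n) x) k = (if k < n then coord x (n - 1 - k) else 0)"
  by (simp add: R_op.rep_eq R_vec.rep_eq)

lemma P_op_iota: "(P_op n) ((iota r) c) = (if r < n then (iota r) c else 0)"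
  by (rule l2_eqI) (auto simp: coord_P_op coord_iota)

lemma R_op_iota:
  "(R_op n) ((iota r) c) = (if r < n then (iota (n - 1 - r)) c else 0)"
  by (rule l2_eqI) (auto simp: coord_R_op coord_iota)

lemma radj_P_op [simp]: "radj (P_op n) = (P_op n :: 'a::{real_inner, banach} l2 \<Rightarrow>\<^sub>L _)"
  by (intro blinfun_eqI l2_eqI coord_radjI) (auto simp: P_op_iota coord_P_op inner_iota)

lemma radj_R_op [simp]: "radj (R_op n) = R_op n"
  by (intro blinfun_eqI l2_eqI coord_radjI) (auto simp: R_op_iota coord_R_op inner_iota)

lemma P_op_P_op: "P_op m o\<^sub>L P_op n = P_op (min m n)"
  by (intro blinfun_eqI l2_eqI) (auto simp: coord_P_op)

lemma P_op_idem [simp]: "P_op n o\<^sub>L P_op n = P_op n"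
  by (simp add: P_op_P_op)

lemma clinear_P_op [simp]: "clinear_op (P_op n)"
  by (auto simp: clinear_op_def coord_P_op intro!: l2_eqI)

lemma norm_P_op_apply_le: "norm ((P_op n) x) \<le> norm x"
  by (rule norm_le_l2I[of id "{..<n}"]) (auto simp: coord_P_op)

lemma norm_P_op_le: "norm (P_op n) \<le> 1"
  by (rule norm_blinfun_bound) (auto simp: norm_P_op_apply_le)

lemma norm_R_op_le: "norm (R_op n) \<le> 1"
  by (rule norm_blinfun_bound) (auto intro!: norm_le_l2I[OF inj_on_reflect[of n]] simp: coord_R_op split: if_splits)

lemma P_op_tendsto: "(\<lambda>n. (P_op n) x) \<longlonglongrightarrow> x"
proof -
  have "(norm (x - P_op n x))\<^sup>2 = (\<Sum>k. (norm (coord x (k + n)))\<^sup>2)" for n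
    unfolding norm_l2_sq
    by (subst suminf_split_initial_segment[of _ n])
      (use summable_coord[of "x - P_op n x"] in \<open>auto simp: coord_P_op\<close>)
  moreover have "(\<lambda>n. \<Sum>k. (norm (coord x (k + n)))\<^sup>2) \<longlonglongrightarrow> 0"
    by (rule suminf_exist_split2[OF summable_coord])
  ultimately have "(\<lambda>n. (norm (x - P_op n x))\<^sup>2) \<longlonglongrightarrow> 0" by simp
  then have "(\<lambda>n. sqrt ((norm (x - P_op n x))\<^sup>2)) \<longlonglongrightarrow> sqrt 0" by (rule tendsto_real_sqrt)
  then have "(\<lambda>n. x - P_op n x) \<longlonglongrightarrow> 0" by (simp add: tendsto_norm_zero_iff)
  then have "(\<lambda>n. x - (x - P_op n x)) \<longlonglongrightarrow> x - 0" by (intro tendsto_intros)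
  then show ?thesis by simp
qed

lemma P_op_eq_sum: "(P_op n) x = (\<Sum>k<n. (iota k) (coord x k))"
  by (rule l2_eqI) (simp add: coord_P_op coord_sum coord_iota if_distrib cong: if_cong)

lemma l2_dense_induct:
  assumes "subspace V" "closed V" "\<And>m z. (iota m) z \<in> V"
  shows "x \<in> V"
proof -
  have "P_op n x \<in> V" for n
    unfolding P_op_eq_sum by (intro subspace_sum assms)
  then show ?thesis by (rule closed_sequentially[OF assms(2) _ P_op_tendsto])
qed

subsection \<open>The isometries generating the Cuntz algebra\<close>

lemma coord_S_op: "coord ((S_op N i) x) k = (if k mod N = i then coord x (k div N) else 0)"
  by (simp add: S_op.rep_eq S_vec.rep_eq)

lemma clinear_S_op [simp]: "clinear_op (S_op N i)"
  by (auto simp: clinear_op_def coord_S_op intro!: l2_eqI)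

lemma norm_S_op_le1: "norm (S_op N i) \<le> 1"
  by (rule norm_blinfun_bound) (auto simp: norm_S_op_le)

lemma S_op_iota: "i < N \<Longrightarrow> (S_op N i) ((iota r) c) = (iota (r * N + i)) c"
  by (rule l2_eqI) (auto simp: coord_S_op coord_iota mod_div_mult_eq)

lemma coord_radj_S_op: "i < N \<Longrightarrow> coord ((radj (S_op N i)) x) k = coord x (k * N + i)"
  by (rule coord_radjI) (simp add: S_op_iota inner_iota)

lemma radj_S_op_S_op:
  "i < N \<Longrightarrow> j < N \<Longrightarrow> radj (S_op N i) o\<^sub>L S_op N j = (if i = j then id_blinfun else 0)"
  by (intro blinfun_eqI l2_eqI) (auto simp: coord_radj_S_op coord_S_op)

lemma sum_S_op: "N > 0 \<Longrightarrow> (\<Sum>i<N. S_op N i o\<^sub>L radj (S_op N i)) = id_blinfun"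
proof (intro blinfun_eqI l2_eqI)
  fix x k assume "N > 0"
  have "coord (blinfun_apply (\<Sum>i<N. S_op N i o\<^sub>L radj (S_op N i)) x) k
      = (\<Sum>i<N. if k mod N = i then coord x k else 0)"
    unfolding blinfun_sum_apply coord_sum
    by (rule sum.cong) (auto simp: coord_S_op coord_radj_S_op)
  then show "coord (blinfun_apply (\<Sum>i<N. S_op N i o\<^sub>L radj (S_op N i)) x) k = coord (id_blinfun x) k"
    using \<open>N > 0\<close> by simp
qed

text \<open>The index \<open>r * N + i\<close> lies below \<open>a * N\<close> exactly when
  \<open>r\<close> lies below \<open>a\<close>. This makes powers of \<open>N\<close> the natural
  matrix sizes.\<close>

lemma P_op_S_op: "i < N \<Longrightarrow> P_op (a * N) o\<^sub>L S_op N i = S_op N i o\<^sub>L P_op a"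
  by (intro blinfun_eqI l2_eqI) (auto simp: coord_P_op coord_S_op less_mult_imp_div_less div_less_iff_less_mult)

section \<open>The generators of T_N\<close>

lemma coord_Sigma_op: "coord ((Sigma_op N i) x) m = (S_op N i) (coord x (Suc m))"
  by (simp add: Sigma_op.rep_eq Sigma_vec.rep_eq)

lemma clinear_Sigma_op [simp]: "clinear_op (Sigma_op N i)"
  unfolding clinear_op_def
  by (intro allI, rule l2_eqI) (simp add: coord_Sigma_op clinear_opD[OF clinear_S_op])

lemma Sigma_op_iota:
  "(Sigma_op N i) ((iota m) z) =
    (case m of 0 \<Rightarrow> 0 | Suc d \<Rightarrow> (iota d) ((S_op N i) z))"
  by (rule l2_eqI) (auto simp: coord_Sigma_op coord_iota split: nat.split)

lemma coord_radj_Sigma_op: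
  "coord ((radj (Sigma_op N i)) x) m =
    (case m of 0 \<Rightarrow> 0 | Suc d \<Rightarrow> (radj (S_op N i)) (coord x d))"
  by (rule coord_radjI) (auto simp: Sigma_op_iota inner_iota inner_radj[of "S_op N i"] split: nat.split)

lemma radj_Sigma_op_Sigma_op:
  "i < N \<Longrightarrow> j < N \<Longrightarrow>
    radj (Sigma_op N i) o\<^sub>L Sigma_op N j = (if i = j then id_blinfun - P_op 1 else 0)"
  using arg_cong[OF radj_S_op_S_op[of i N j], of blinfun_apply]
  by (intro blinfun_eqI l2_eqI)
    (auto simp: coord_radj_Sigma_op coord_Sigma_op blinfun.diff_left coord_P_op fun_eq_iff split: nat.split)

lemma sum_Sigma_op:
  assumes "N > 0"
  shows "(\<Sum>i<N. Sigma_op N i o\<^sub>L radj (Sigma_op N i)) = id_blinfun"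
proof (intro blinfun_eqI l2_eqI)
  fix x m k
  have "coord (blinfun_apply (\<Sum>i<N. Sigma_op N i o\<^sub>L radj (Sigma_op N i)) x) m
      = (\<Sum>i<N. S_op N i o\<^sub>L radj (S_op N i)) (coord x m)"
    unfolding blinfun_sum_apply coord_sum
    by (rule sum.cong) (auto simp: coord_Sigma_op coord_radj_Sigma_op)
  then show "coord (coord (blinfun_apply (\<Sum>i<N. Sigma_op N i o\<^sub>L radj (Sigma_op N i)) x) m) k
      = coord (coord (id_blinfun x) m) k"
    using assms by (simp add: sum_S_op)
qed

section \<open>Asymptotic intertwiners\<close>

text \<open>\<open>weight n m D\<close> is the mass that a basis vector at distance \<open>m\<close> from the leaves of the
  tree of depth \<open>n\<close> receives at depth \<open>D\<close>. Up to \<open>m = n div 2\<close> all of it sits at \<open>D = m\<close>;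
  from there on, the share \<open>ramp n m\<close>, growing linearly to 1 at the root, is spread evenly over
  the \<open>n div 2\<close> depths below \<open>m\<close>.\<close>

definition ramp :: "nat \<Rightarrow> nat \<Rightarrow> real"
  where "ramp n m = real (m - n div 2) / real (n - n div 2)"

definition weight :: "nat \<Rightarrow> nat \<Rightarrow> nat \<Rightarrow> real"
  where "weight n m D =
    (if D = m then 1 - ramp n m
     else if D < m \<and> m \<le> D + n div 2 then ramp n m / real (n div 2) else 0)"

lemma ramp_nonneg: "0 \<le> ramp n m"
  by (simp add: ramp_def)

lemma ramp_le_1: "m \<le> n \<Longrightarrow> ramp n m \<le> 1"
  by (auto simp: ramp_def divide_le_eq_1)

lemma ramp_Suc: "\<bar>ramp n (Suc m) - ramp n m\<bar> \<le> 1 / real (n - n div 2)"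
proof -
  have "\<bar>real (Suc m - n div 2) - real (m - n div 2)\<bar> \<le> 1" by linarith
  then show ?thesis
    unfolding ramp_def diff_divide_distrib[symmetric] abs_divide by (simp add: divide_right_mono)
qed

lemma sum_window: "m \<le> L \<Longrightarrow> (\<Sum>D<L. if D \<in> {a..<m} then c else 0) = real (m - a) * c"
  by (subst sum.inter_restrict[symmetric]) (auto simp: Int_absorb1 subset_iff)

lemma weight_nonneg: "m \<le> n \<Longrightarrow> 0 \<le> weight n m D"
  by (simp add: weight_def ramp_nonneg ramp_le_1)

lemma weight_gt: "D > m \<Longrightarrow> weight n m D = 0"
  by (simp add: weight_def)

text \<open>Up to \<open>n div 2\<close> all mass sits at \<open>m\<close> itself; above it, the
  window starts at \<open>m - n div 2\<close>, which is positive. So depth 0 receives mass from the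
  leaves only, and \<open>proj_J_op\<close> is exact.\<close>

lemma weight_0: "m \<noteq> 0 \<Longrightarrow> weight n m 0 = 0"
  by (auto simp: weight_def ramp_def)

lemma weight_low: "m \<le> n div 2 \<Longrightarrow> weight n m D = (if D = m then 1 else 0)"
  by (simp add: weight_def ramp_def)

lemma ramp_top: "n > 0 \<Longrightarrow> ramp n n = 1"
  by (auto simp: ramp_def)

text \<open>The window at the root lies strictly below depth \<open>n\<close>. Hence the
  intertwining error has no component at depth \<open>n\<close>.\<close>

lemma weight_top: "n > 0 \<Longrightarrow> weight n n n = 0"
  by (simp add: weight_def ramp_top)

text \<open>This is what makes \<open>J_op\<close> isometric. The bound \<open>n \<ge> 2\<close>
  keeps the window length \<open>n div 2\<close> positive.\<close>

lemma weight_sum: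
  assumes "n \<ge> 2" "m \<le> n"
  shows "(\<Sum>D<Suc n. weight n m D) = 1"
proof (cases "m \<le> n div 2")
  case True
  then show ?thesis using assms by (simp add: weight_low)
next
  case False
  define K where "K = n div 2"
  have K: "K > 0" "K < m" using assms False by (auto simp: K_def)
  have "(\<Sum>D<Suc n. weight n m D)
      = (\<Sum>D<Suc n. (if D = m then 1 - ramp n m else 0) + (if D \<in> {m-K..<m} then ramp n m / K else 0))"
    by (rule sum.cong) (use K in \<open>auto simp: weight_def K_def[symmetric]\<close>)
  also have "\<dots> = (1 - ramp n m) + real (m - (m - K)) * (ramp n m / K)"
    unfolding sum.distrib using assms by (subst sum_window) (auto simp del: sum.lessThan_Suc)
  also have "\<dots> = 1" using K by simp
  finally show ?thesis .
qed

text \<open>Raising \<open>m\<close> and \<open>D\<close> together carries the peak to the peak and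
  the window to the window, so only the ramp changes: by \<open>d\<close> at the peak and by
  \<open>d / K\<close> at each of at most \<open>K\<close> depths of the window.\<close>

lemma weight_step_sum:
  assumes "n \<ge> 2" "Suc m \<le> n"
  shows "(\<Sum>D<n. \<bar>weight n (Suc m) (Suc D) - weight n m D\<bar>) \<le> 2 / real (n div 2)"
proof -
  define K where "K = n div 2"
  define d where "d = \<bar>ramp n (Suc m) - ramp n m\<bar>"
  have K: "K > 0" using assms by (auto simp: K_def)
  have "(\<Sum>D<n. \<bar>weight n (Suc m) (Suc D) - weight n m D\<bar>)
      \<le> (\<Sum>D<n. (if D = m then d else 0) + (if D \<in> {m-K..<m} then d / K else 0))"
    by (rule sum_mono)
      (auto simp: weight_def K_def[symmetric] d_def abs_minus_commute diff_divide_distrib[symmetric])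
  \<comment> \<open>For \<open>m < K\<close> the window is cut off at depth 0, hence the truncated
    difference instead of \<open>K\<close>.\<close>
  also have "\<dots> = d + real (m - (m - K)) * (d / K)"
    unfolding sum.distrib using assms by (subst sum_window) auto
  also have "\<dots> \<le> d + real K * (d / K)"
    by (intro add_left_mono mult_right_mono) (auto simp: d_def)
  also have "\<dots> = d + d" using K by simp
  also have "\<dots> \<le> 2 * (1 / real (n - n div 2))" using ramp_Suc[of n m] by (simp add: d_def)
  also have "\<dots> \<le> 2 * (1 / real (n div 2))"
    using assms by (intro mult_left_mono divide_left_mono) auto
  finally show ?thesis by simp
qed

text \<open>At the root the distribution is uniform on a window of length \<open>n div 2\<close>.
  Shifting it by one changes only its two ends, each by \<open>1 / K\<close>.\<close>

lemma weight_loop_sum: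
  assumes "n \<ge> 2"
  shows "(\<Sum>D<n. \<bar>weight n n (Suc D) - weight n n D\<bar>) \<le> 2 / real (n div 2)"
proof -
  define K where "K = n div 2"
  have K: "K > 0" "K < n" using assms by (auto simp: K_def)
  have "(\<Sum>D<n. \<bar>weight n n (Suc D) - weight n n D\<bar>)
      \<le> (\<Sum>D<n. (if D = n - 1 then 1 / K else 0) + (if D = n - K - 1 then 1 / K else 0))"
    using K ramp_top[of n] by (intro sum_mono) (auto simp: weight_def K_def[symmetric])
  also have "\<dots> = 2 / K" using K by (simp add: sum.distrib)
  finally show ?thesis by (simp add: K_def)
qed

text \<open>One factor of the square is at most \<open>sqrt a + sqrt b\<close>. This converts l1
  bounds on masses into l2 bounds on amplitudes.\<close>

lemma sqrt_diff_sq_le: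
  assumes "0 \<le> a" "0 \<le> b"
  shows "(sqrt a - sqrt b)\<^sup>2 \<le> \<bar>a - b\<bar>"
proof -
  have "\<bar>sqrt a - sqrt b\<bar> * \<bar>sqrt a - sqrt b\<bar> \<le> \<bar>sqrt a - sqrt b\<bar> * (sqrt a + sqrt b)"
    using assms by (intro mult_left_mono) (auto simp: abs_le_iff)
  also have "\<dots> = \<bar>(sqrt a - sqrt b) * (sqrt a + sqrt b)\<bar>"
    using assms by (simp add: abs_mult)
  also have "(sqrt a - sqrt b) * (sqrt a + sqrt b) = a - b"
    using assms by (simp add: algebra_simps)
  finally show ?thesis by (simp add: power2_eq_square)
qed

text \<open>\<open>floorlog N k\<close> counts the \<open>N\<close>-adic digits of \<open>k\<close>,
  with none for \<open>k = 0\<close>. So \<open>depth\<close> is the distance from the leaves, which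
  are the indices with the full \<open>n\<close> digits, and the root 0 has depth
  \<open>n\<close>.\<close>

definition depth :: "nat \<Rightarrow> nat \<Rightarrow> nat \<Rightarrow> nat"
  where "depth N n k = n - floorlog N k"

lemma less_power_iff_floorlog: "N \<ge> 2 \<Longrightarrow> k < N ^ e \<longleftrightarrow> floorlog N k \<le> e"
proof (cases "k = 0")
  case False
  assume N: "N \<ge> 2"
  have b: "N ^ (floorlog N k - 1) \<le> k" "k < N ^ floorlog N k"
    using floorlog_bounds[of k N] False N by auto
  show ?thesis
  proof
    assume "k < N ^ e"
    then have "N ^ (floorlog N k - 1) < N ^ e" using b by linarith
    then show "floorlog N k \<le> e" using N by (simp add: power_less_imp_less_exp)
  next
    assume "floorlog N k \<le> e"
    then have "N ^ floorlog N k \<le> N ^ e" using N by (intro power_increasing) auto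
    then show "k < N ^ e" using b by linarith
  qed
qed (simp add: floorlog_def)

lemma depth_le: "depth N n k \<le> n"
  by (simp add: depth_def)

text \<open>Mass at depth \<open>D\<close> can only come from indices below
  \<open>N ^ (n - D)\<close>, so the reflection of that length in \<open>J_op\<close> loses
  nothing.\<close>

lemma le_depth_iff: "N \<ge> 2 \<Longrightarrow> k < N ^ n \<Longrightarrow> D \<le> n \<Longrightarrow> D \<le> depth N n k \<longleftrightarrow> k < N ^ (n - D)"
  by (auto simp: depth_def less_power_iff_floorlog)

text \<open>Appending a digit lengthens the expansion by one, except that the digit 0 appended to
  the root gives the root again. This is the loop.\<close>

lemma depth_child:
  assumes "N \<ge> 2" "k < N ^ (n - 1)" "n > 0" "i < N" "k * N + i \<noteq> 0"
  shows "depth N n k = Suc (depth N n (k * N + i))"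
proof -
  have "floorlog N (k * N + i) = Suc (floorlog N k)"
    using assms compute_floorlog[of N "k * N + i"] by simp
  then show ?thesis using assms by (simp add: depth_def less_power_iff_floorlog)
qed

lemma depth_0: "depth N n 0 = n"
  by (simp add: depth_def floorlog_def)

section \<open>Amplitudes and the approximate intertwiners \<open>J_op\<close>\<close>

definition amp :: "nat \<Rightarrow> nat \<Rightarrow> nat \<Rightarrow> nat \<Rightarrow> real"
  where "amp N n k D = sqrt (weight n (depth N n k) D)"

lemma amp_sq: "(amp N n k D)\<^sup>2 = weight n (depth N n k) D"
  by (simp add: amp_def weight_nonneg depth_le)

text \<open>The pair \<open>k\<close>, \<open>k * N + i\<close> is either the loop at the root or an
  edge of the tree. Both weight estimates have the same bound because \<open>n div 2\<close> is at
  most \<open>n - n div 2\<close>.\<close>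

lemma amp_diff_sum:
  assumes "N \<ge> 2" "n \<ge> 2" "k < N ^ (n - 1)" "i < N"
  shows "(\<Sum>D<n. (amp N n k (Suc D) - amp N n (k * N + i) D)\<^sup>2) \<le> 2 / real (n div 2)"
proof -
  have "(\<Sum>D<n. (amp N n k (Suc D) - amp N n (k * N + i) D)\<^sup>2)
      \<le> (\<Sum>D<n. \<bar>weight n (depth N n k) (Suc D) - weight n (depth N n (k * N + i)) D\<bar>)"
    unfolding amp_def by (intro sum_mono sqrt_diff_sq_le weight_nonneg depth_le)
  also have "\<dots> \<le> 2 / real (n div 2)"
  proof (cases "k * N + i = 0")
    case True
    then show ?thesis using assms weight_loop_sum[of n] by (simp add: depth_0)
  next
    case False
    then show ?thesis
      using assms depth_child[of N k n i] depth_le[of N n k] weight_step_sum[of n "depth N n (k * N + i)"]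
      by simp
  qed
  finally show ?thesis .
qed

text \<open>The depth-\<open>D\<close> component of \<open>J_op N n x\<close> is the reflection of length \<open>N ^ (n - D)\<close> of \<open>x\<close>,
  multiplied by the amplitudes \<open>amp N n k D\<close>.\<close>

lift_definition J_op :: "nat \<Rightarrow> nat \<Rightarrow> complex l2 \<Rightarrow>\<^sub>L complex l2 l2"
  is "\<lambda>N n x. fin_vec (Suc n) (\<lambda>D. fin_vec (N ^ (n - D))
        (\<lambda>r. amp N n (N ^ (n - D) - 1 - r) D *\<^sub>R coord x (N ^ (n - D) - 1 - r)))"
proof -
  fix N n :: nat
  \<comment> \<open>A crude Hilbert-Schmidt type bound, enough for boundedness; the exact norm
    identity is \<open>norm_J_op_apply\<close>.\<close>
  define C where "C = (\<Sum>D<Suc n. \<Sum>r<N ^ (n - D). (amp N n (N ^ (n - D) - 1 - r) D)\<^sup>2)"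
  have C: "C \<ge> 0" by (simp add: C_def sum_nonneg)
  show "bounded_linear (\<lambda>x::complex l2. fin_vec (Suc n) (\<lambda>D. fin_vec (N ^ (n - D))
        (\<lambda>r. amp N n (N ^ (n - D) - 1 - r) D *\<^sub>R coord x (N ^ (n - D) - 1 - r))))"
    (is "bounded_linear ?J")
  proof (rule bounded_linear_intro[where K = "sqrt C"])
    fix x :: "complex l2"
    have "(norm (?J x))\<^sup>2 \<le> C * (norm x)\<^sup>2"
      unfolding C_def norm_fin_vec_sq sum_distrib_right
      by (intro sum_mono) (auto simp: power_mult_distrib intro!: mult_left_mono power_mono norm_coord_le)
    also have "\<dots> = (norm x * sqrt C)\<^sup>2" using C by (simp add: power_mult_distrib)
    finally show "norm (?J x) \<le> norm x * sqrt C"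
      by (rule power2_le_imp_le) (simp add: C)
  qed (rule l2_eqI, rule l2_eqI, simp add: coord_fin_vec scaleR_add_right)+
qed

lemma coord_J_op:
  "coord (coord (blinfun_apply (J_op N n) x) D) r =
    (if D \<le> n \<and> r < N ^ (n - D)
     then amp N n (N ^ (n - D) - 1 - r) D *\<^sub>R coord x (N ^ (n - D) - 1 - r) else 0)"
  by (simp add: J_op.rep_eq coord_fin_vec)

lemma clinear_J_op [simp]: "clinear_op (J_op N n)"
  unfolding clinear_op_def
  by (intro allI, rule l2_eqI, rule l2_eqI) (simp add: coord_J_op)

text \<open>At each depth, different indices \<open>k\<close> occupy different positions, so no
  interference occurs and the squared norm is a double sum of weights. Positions with
  \<open>D\<close> beyond the depth of \<open>k\<close> have weight 0, so all
  \<open>k < N ^ n\<close> can be included for every \<open>D\<close>; then the order of summation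
  is exchanged and the weights sum to 1.\<close>

lemma norm_J_op_apply:
  assumes N: "N \<ge> 2" and n: "n \<ge> 2"
  shows "norm (blinfun_apply (J_op N n) x) = norm (blinfun_apply (P_op (N ^ n)) x)"
proof -
  let ?w = "\<lambda>k D. weight n (depth N n k) D * (norm (coord x k))\<^sup>2"
  have "(norm (J_op N n x))\<^sup>2
      = (\<Sum>D<Suc n. \<Sum>r<N ^ (n - D). ?w (N ^ (n - D) - Suc r) D)"
    unfolding J_op.rep_eq norm_fin_vec_sq
    by (simp add: power_mult_distrib amp_sq del: sum.lessThan_Suc)
  also have "\<dots> = (\<Sum>D<Suc n. \<Sum>k<N ^ (n - D). ?w k D)"
    by (subst sum.nat_diff_reindex) (rule refl)
  also have "\<dots> = (\<Sum>D<Suc n. \<Sum>k<N ^ n. ?w k D)"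
  proof (rule sum.cong[OF refl], rule sum.mono_neutral_left)
    fix D assume D: "D \<in> {..<Suc n}"
    have "N ^ (n - D) \<le> N ^ n" using N by (intro power_increasing) auto
    then show "{..<N ^ (n - D)} \<subseteq> {..<N ^ n}" by auto
    show "\<forall>k\<in>{..<N ^ n} - {..<N ^ (n - D)}. ?w k D = 0"
    proof
      fix k assume "k \<in> {..<N ^ n} - {..<N ^ (n - D)}"
      then have "\<not> D \<le> depth N n k" using D le_depth_iff[OF N, of k n D] by auto
      then show "?w k D = 0" by (simp add: weight_gt)
    qed
  qed simp
  also have "\<dots> = (\<Sum>k<N ^ n. (\<Sum>D<Suc n. weight n (depth N n k) D) * (norm (coord x k))\<^sup>2)"
    unfolding sum_distrib_right by (rule sum.swap)
  also have "\<dots> = (\<Sum>k<N ^ n. (norm (coord x k))\<^sup>2)"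
    using weight_sum[OF n depth_le] by (simp del: sum.lessThan_Suc)
  also have "\<dots> = (norm (P_op (N ^ n) x))\<^sup>2"
    by (subst norm_sq_finite[of "N ^ n"]) (auto simp: coord_P_op)
  finally show ?thesis by (simp add: power2_eq_iff_nonneg)
qed

text \<open>Polarization: norms determine inner products.\<close>

lemma radj_compose_self_eqI:
  fixes A :: "'a::{real_inner, banach} \<Rightarrow>\<^sub>L 'b::{real_inner, banach}"
    and B :: "'a \<Rightarrow>\<^sub>L 'c::{real_inner, banach}"
  assumes "\<And>x. norm (blinfun_apply A x) = norm (blinfun_apply B x)"
  shows "radj A o\<^sub>L A = radj B o\<^sub>L B"
proof (intro blinfun_eqI, rule inner_eqI)
  fix x y
  have "inner (A y) (A x) = inner (B y) (B x)"
    using assms[of "y - x"] by (simp add: dot_norm_neg blinfun.diff_right assms)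
  then show "inner y ((radj A o\<^sub>L A) x) = inner y ((radj B o\<^sub>L B) x)"
    by (simp add: inner_radj[of A] inner_radj[of B])
qed

lemma J_op_P_op: "N > 0 \<Longrightarrow> J_op N n o\<^sub>L P_op (N ^ n) = J_op N n"
proof (rule blinfun_eqI, rule l2_eqI, rule l2_eqI)
  fix x D r assume "N > 0"
  then have le: "N ^ (n - D) \<le> N ^ n" by (intro power_increasing) auto
  have "N ^ (n - D) - Suc r < N ^ n" if "r < N ^ (n - D)" using that le by linarith
  then show "coord (coord ((J_op N n o\<^sub>L P_op (N ^ n)) x) D) r = coord (coord (J_op N n x) D) r"
    by (simp add: coord_J_op coord_P_op)
qed

text \<open>The bound on \<open>r\<close> says that the reflected index has exactly
  \<open>n - m\<close> digits, hence depth \<open>m\<close>. As \<open>m \<le> n div 2\<close>, its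
  whole mass sits at depth \<open>m\<close>, and \<open>J_op\<close> sends it to a single basis
  vector.\<close>

lemma J_op_iota:
  assumes N: "N \<ge> 2" and n: "m < n" "m \<le> n div 2" and r: "r < N ^ (n - m) - N ^ (n - m - 1)"
  shows "blinfun_apply (J_op N n) (blinfun_apply (iota (N ^ (n - m) - 1 - r)) c)
    = blinfun_apply (iota m) (blinfun_apply (iota r) c)"
proof -
  define k where "k = N ^ (n - m) - 1 - r"
  have le: "N ^ (n - m) \<le> N ^ n" using N by (intro power_increasing) auto
  have k: "k < N ^ (n - m)" "\<not> k < N ^ (n - m - 1)" using r by (auto simp: k_def)
  then have "m \<le> depth N n k" "\<not> Suc m \<le> depth N n k"
    using le_depth_iff[OF N, of k n m] le_depth_iff[OF N, of k n "Suc m"] n le by auto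
  then have d: "depth N n k = m" by simp
  show ?thesis
  proof (rule l2_eqI, rule l2_eqI)
    fix D s
    have amp: "amp N n k D = (if D = m then 1 else 0)"
      using n by (simp add: amp_def d weight_low)
    have r': "r < N ^ (n - m)" using r by linarith
    show "coord (coord (J_op N n (iota (N ^ (n - m) - 1 - r) c)) D) s
        = coord (coord (iota m (iota r c)) D) s"
    proof (cases "D = m")
      case True
      have eq: "a - 1 - s = a - 1 - r \<longleftrightarrow> s = r" if "s < a" "r < a" for a :: nat
        using that by auto
      show ?thesis
      proof (cases "s < N ^ (n - m)")
        case s: True
        show ?thesis
          using eq[OF s r'] n s amp[unfolded k_def] by (simp add: coord_J_op coord_iota True)
      next
        case False
        then show ?thesis using r' by (auto simp add: coord_J_op coord_iota True)
      qed
    next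
      case False
      then show ?thesis
        using amp[unfolded k_def] by (simp add: coord_J_op coord_iota)
    qed
  qed
qed

lemma norm_J_op_le: "N \<ge> 2 \<Longrightarrow> n \<ge> 2 \<Longrightarrow> norm (J_op N n) \<le> 1"
  by (rule norm_blinfun_bound) (simp_all add: norm_J_op_apply norm_P_op_apply_le)

lemma radj_J_op_J_op: "N \<ge> 2 \<Longrightarrow> n \<ge> 2 \<Longrightarrow> radj (J_op N n) o\<^sub>L J_op N n = P_op (N ^ n)"
  using radj_compose_self_eqI[OF norm_J_op_apply, of N n] by simp

text \<open>The operators \<open>Q n\<close> are contractions from \<open>n = 2\<close> on, and each
  basis vector of \<open>l2(l2)\<close> lies in the range of \<open>J_op N n\<close> for large
  \<open>n\<close>, where \<open>Q n\<close> acts as the identity. Uniform boundedness extends the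
  convergence to the closed span.\<close>

lemma J_op_tendsto:
  assumes N: "N \<ge> 2"
  shows "(\<lambda>n. blinfun_apply (J_op N n) (blinfun_apply (radj (J_op N n)) x)) \<longlonglongrightarrow> x"
proof -
  define Q where "Q n = J_op N n o\<^sub>L radj (J_op N n)" for n
  have Q: "norm (Q n) \<le> 1" if "n \<ge> 2" for n
    using norm_blinfun_compose[of "J_op N n" "radj (J_op N n)"] norm_J_op_le[OF N that]
      mult_mono[of "norm (J_op N n)" 1 "norm (J_op N n)" 1]
    by (simp add: Q_def norm_radj)
  define V where "V = {x. (\<lambda>n. Q n x) \<longlonglongrightarrow> x}"
  have sub: "subspace V"
    unfolding subspace_def V_def
    by (auto simp: blinfun.zero_right blinfun.add_right blinfun.scaleR_right intro: tendsto_intros)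
  have cl: "closed V"
    unfolding closed_sequential_limits
  proof (intro allI impI, elim conjE)
    fix f x assume f: "\<forall>n. f n \<in> V" "f \<longlonglongrightarrow> x"
    show "x \<in> V"
      unfolding V_def mem_Collect_eq
    proof (rule LIMSEQ_I)
      fix e :: real assume "e > 0"
      then obtain m where m: "norm (f m - x) < e / 3"
        using LIMSEQ_D[OF f(2), of "e / 3"] by auto
      have "(\<lambda>n. Q n (f m)) \<longlonglongrightarrow> f m" using f by (simp add: V_def)
      then obtain M where M: "\<And>n. n \<ge> M \<Longrightarrow> norm (Q n (f m) - f m) < e / 3"
        using LIMSEQ_D[of "\<lambda>n. Q n (f m)" "f m" "e / 3"] \<open>e > 0\<close> by auto
      have "norm (Q n x - x) < e" if "n \<ge> max M 2" for n
      proof -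
        have "norm (Q n (x - f m)) \<le> norm (x - f m)"
          using norm_blinfun[of "Q n" "x - f m"] Q[of n] that
            mult_right_mono[of "norm (Q n)" 1 "norm (x - f m)"] by simp
        moreover have "Q n x - x = Q n (x - f m) + (Q n (f m) - f m) + (f m - x)"
          by (simp add: blinfun.diff_right)
        then have "norm (Q n x - x) \<le> norm (Q n (x - f m)) + norm (Q n (f m) - f m) + norm (f m - x)"
          by (metis norm_triangle_le add_right_mono norm_triangle_ineq)
        moreover have "norm (Q n (f m) - f m) < e / 3" using M that by simp
        ultimately show ?thesis using m norm_minus_commute[of x "f m"] by linarith
      qed
      then show "\<exists>no. \<forall>n\<ge>no. norm (Q n x - x) < e" by blast
    qed
  qed
  have iota2: "iota m (iota r c) \<in> V" for m r c
  proof -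
    \<comment> \<open>This size of \<open>n\<close> gives \<open>m \<le> n div 2\<close> and leaves
      at least \<open>r + 1\<close> indices with exactly \<open>n - m\<close> digits, as
      \<open>J_op_iota\<close> demands.\<close>
    have "Q n (iota m (iota r c)) = iota m (iota r c)" if n: "n \<ge> 2 * m + r + 2" for n
    proof -
      have "r + 1 \<le> N ^ (n - m - 1)"
      proof -
        have "r + 1 \<le> 2 ^ r" using less_exp[of r] by linarith
        also have "(2::nat) ^ r \<le> 2 ^ (n - m - 1)" using n by (intro power_increasing) auto
        also have "\<dots> \<le> N ^ (n - m - 1)" using N by (intro power_mono) auto
        finally show ?thesis .
      qed
      also have "\<dots> \<le> N ^ (n - m) - N ^ (n - m - 1)"
      proof -
        have "n - m = Suc (n - m - 1)" using n by simp
        then have "N ^ (n - m) = N * N ^ (n - m - 1)" by (metis power_Suc)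
        moreover have "2 * N ^ (n - m - 1) \<le> N * N ^ (n - m - 1)" using N by simp
        ultimately show ?thesis by linarith
      qed
      finally have r: "r < N ^ (n - m) - N ^ (n - m - 1)" by simp
      have m: "m < n" "m \<le> n div 2" "n \<ge> 2" using n by auto
      have "radj (J_op N n) (J_op N n y) = P_op (N ^ n) y" for y
        using radj_J_op_J_op[OF N m(3)] by (metis blinfun_apply_blinfun_compose)
      moreover have "J_op N n (P_op (N ^ n) y) = J_op N n y" for y
        using J_op_P_op[of N n] N by (metis blinfun_apply_blinfun_compose less_le_trans pos2)
      ultimately have "Q n (J_op N n y) = J_op N n y" for y by (simp add: Q_def)
      then show ?thesis using J_op_iota[OF N m(1,2) r, of c] by metis
    qed
    then have "eventually (\<lambda>n. Q n (iota m (iota r c)) = iota m (iota r c)) sequentially"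
      by (rule eventually_sequentiallyI)
    then show ?thesis unfolding V_def by (simp add: tendsto_eventually)
  qed
  \<comment> \<open>Density is used twice: here inside the component at depth \<open>m\<close>, and
    afterwards over all depths.\<close>
  have iota1: "iota m z \<in> V" for m z
  proof -
    have sub': "subspace (iota m -` V)"
      using sub by (simp add: subspace_def blinfun.zero_right blinfun.add_right blinfun.scaleR_right)
    have cl': "closed (iota m -` V)"
      by (rule closed_vimage[OF cl]) (intro continuous_intros)
    have "z \<in> iota m -` V"
      by (rule l2_dense_induct[OF sub' cl']) (simp add: iota2)
    then show ?thesis by simp
  qed
  have "x \<in> V" by (rule l2_dense_induct[OF sub cl iota1])
  then show ?thesis by (simp add: V_def Q_def)
qed

text \<open>Depth 0 sees only the leaves \<open>N ^ (n - 1) \<le> k < N ^ n\<close>, each with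
  amplitude 1. This exact formula links \<open>J_op\<close> to the reflections in
  \<open>W00\<close>.\<close>

lemma proj_J_op:
  assumes "N \<ge> 2" "n \<ge> 2"
  shows "proj 0 o\<^sub>L J_op N n = R_op (N ^ n) o\<^sub>L (P_op (N ^ n) - P_op (N ^ (n - 1)))"
proof (rule blinfun_eqI, rule l2_eqI)
  fix x r
  have amp: "amp N n k 0 = (if k < N ^ (n - 1) then 0 else 1)" if "k < N ^ n" for k
    using le_depth_iff[OF assms(1) that, of 1] assms(2)
    by (cases "depth N n k") (auto simp: amp_def weight_0 weight_low)
  show "coord ((proj 0 o\<^sub>L J_op N n) x) r
      = coord ((R_op (N ^ n) o\<^sub>L (P_op (N ^ n) - P_op (N ^ (n - 1)))) x) r"
    by (auto simp: proj.rep_eq coord_J_op coord_R_op blinfun.diff_left coord_P_op amp)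
qed

text \<open>Reflection complements the last digit and reflects the remaining ones separately. Hence
  digit \<open>i\<close> turns into \<open>N - 1 - i\<close>, and a parent goes to the parent of the
  reflected child.\<close>

lemma reflect_div_mod:
  fixes r a N :: nat
  assumes "r < a * N"
  shows "r div N < a" "(a * N - 1 - r) div N = a - 1 - r div N" "(a * N - 1 - r) mod N = N - 1 - r mod N"
proof -
  have N: "N > 0" using assms by (cases N) auto
  show q: "r div N < a" using assms by (simp add: less_mult_imp_div_less)
  have s: "r mod N < N" using N by simp
  obtain b where b: "a = r div N + 1 + b" using q less_iff_Suc_add by auto
  have *: "A - 1 - r = B + (N - 1 - c)" if "A = Q + N + B" "r = Q + c" "c < N" for A B Q c
    using that by linarith
  define c where "c = N - 1 - r mod N"
  have eq: "a * N - 1 - r = b * N + c"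
    unfolding c_def using s by (intro *[of _ "r div N * N"]) (simp_all add: b algebra_simps)
  have "c < N" using N by (simp add: c_def)
  then show "(a * N - 1 - r) div N = a - 1 - r div N" "(a * N - 1 - r) mod N = N - 1 - r mod N"
    unfolding eq c_def[symmetric] by (simp_all add: b)
qed

definition defect :: "nat \<Rightarrow> real"
  where "defect n = sqrt (2 / real (n div 2))"

text \<open>Both products send the index \<open>k\<close> to the position of the reflected child
  \<open>k * N + i\<close> at depth \<open>D\<close>; only the amplitudes differ, by
  \<open>\<Delta> D k\<close>. Distinct \<open>k\<close> give distinct positions, so the squared
  norm of the error is a sum over \<open>k\<close>, and \<open>amp_diff_sum\<close> bounds the
  coefficient of each \<open>k\<close>.\<close>

lemma Sigma_op_J_op:
  assumes N: "N \<ge> 2" and n: "n \<ge> 2" and i: "i < N"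
  shows "norm ((Sigma_op N (N - 1 - i) o\<^sub>L J_op N n) - (J_op N n o\<^sub>L section_seq N (S_op N i) n)) \<le> defect n"
proof (rule norm_blinfun_bound)
  fix x
  define y where "y = ((Sigma_op N (N - 1 - i) o\<^sub>L J_op N n) - (J_op N n o\<^sub>L section_seq N (S_op N i) n)) x"
  define \<Delta> where "\<Delta> D k = amp N n k (Suc D) - amp N n (k * N + i) D" for D k
  define u where "u D = fin_vec (N ^ (n - Suc D)) (\<lambda>k. \<Delta> D k *\<^sub>R coord x k)" for D
  have y: "coord (coord y D) r =
     (if r mod N = N - 1 - i then coord (coord (J_op N n x) (Suc D)) (r div N) else 0)
     - coord (coord (J_op N n (section_seq N (S_op N i) n x)) D) r" for D r
    by (simp add: y_def blinfun.diff_left coord_Sigma_op coord_S_op)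
  have t: "coord (section_seq N (S_op N i) n x) k = (if k < N ^ n \<and> k mod N = i then coord x (k div N) else 0)" for k
    by (auto simp: section_seq_def coord_P_op coord_S_op intro: le_less_trans[OF div_le_dividend])
  have le: "N ^ (n - D) \<le> N ^ n" for D using N by (intro power_increasing) auto
  have yD: "norm (coord y D) \<le> norm (u D)" if D: "D < n" for D
  proof -
    define a where "a = N ^ (n - Suc D)"
    have "n - D = Suc (n - Suc D)" using D by simp
    then have aN: "N ^ (n - D) = a * N" by (simp add: a_def mult.commute)
    have J1: "coord (coord (J_op N n z) D) s =
        (if s < a * N then amp N n (a * N - 1 - s) D *\<^sub>R coord z (a * N - 1 - s) else 0)" for z s
      using D unfolding coord_J_op aN by simp
    have J2: "coord (coord (J_op N n z) (Suc D)) s =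
        (if s < a then amp N n (a - 1 - s) (Suc D) *\<^sub>R coord z (a - 1 - s) else 0)" for z s
      using D unfolding coord_J_op a_def by simp
    \<comment> \<open>\<open>?M\<close> collects the positions of reflected children with last digit
      \<open>i\<close>, and \<open>?g r\<close> is the parent of the child at position
      \<open>r\<close>.\<close>
    let ?g = "\<lambda>r. (a * N - 1 - r) div N"
    let ?M = "{r. r < a * N \<and> (a * N - 1 - r) mod N = i}"
    have yv: "coord (coord y D) r = (if r \<in> ?M then \<Delta> D (?g r) *\<^sub>R coord x (?g r) else 0)" for r
    proof (cases "r < a * N")
      case True
      note dm = reflect_div_mod[OF True]
      have 1: "r mod N = N - 1 - i \<longleftrightarrow> (a * N - 1 - r) mod N = i"
      proof -
        have "c = N - 1 - i \<longleftrightarrow> N - 1 - c = i" if "c < N" for c using that i by linarith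
        then show ?thesis using dm(3) N by simp
      qed
      have 2: "a * N - 1 - r < N ^ n" using le[of D] True unfolding aN by linarith
      show ?thesis
      proof (cases "(a * N - 1 - r) mod N = i")
        case mod: True
        then have "?g r * N + i = a * N - 1 - r" by (metis div_mult_mod_eq)
        then show ?thesis
          using True mod 1 2 dm unfolding y J1 J2 t
          by (simp add: \<Delta>_def scaleR_diff_left)
      next
        case False
        then show ?thesis using 1 unfolding y J1 J2 t by simp
      qed
    next
      case False
      have 2: "\<not> r div N < a" using False N by (metis div_less_iff_less_mult less_le_trans pos2)
      have 3: "r \<notin> ?M" using False by blast
      show ?thesis unfolding y J1 J2 if_not_P[OF False] if_not_P[OF 2] if_not_P[OF 3] by simp
    qed
    show ?thesis
    proof (rule norm_le_l2I[of ?g ?M])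
      show "inj_on ?g ?M"
      proof (rule inj_onI)
        fix r s assume rs: "r \<in> ?M" "s \<in> ?M" "?g r = ?g s"
        have "a * N - 1 - r = ?g r * N + i" "a * N - 1 - s = ?g s * N + i"
          using rs(1,2) div_mult_mod_eq[of "a * N - 1 - r" N] div_mult_mod_eq[of "a * N - 1 - s" N]
          by auto
        then have "a * N - 1 - r = a * N - 1 - s" unfolding rs(3) by linarith
        moreover have "r < a * N" "s < a * N" using rs by auto
        ultimately show "r = s" by linarith
      qed
      fix r assume r: "r \<in> ?M"
      then have "?g r < a" using reflect_div_mod[of r a N] by auto
      then show "norm (coord (coord y D) r) \<le> norm (coord (u D) (?g r))"
        using r unfolding yv by (simp add: u_def coord_fin_vec a_def)
    qed (simp only: yv if_False)
  qed
  \<comment> \<open>At depth \<open>n\<close> only the index 0 remains, and the root carries no mass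
    there.\<close>
  have y0: "coord y D = 0" if "D \<ge> n" for D
  proof (rule l2_eqI)
    fix r
    have "amp N n 0 n = 0" using n by (simp add: amp_def depth_0 weight_top)
    then show "coord (coord y D) r = coord 0 r"
      using that by (cases "D = n") (auto simp: y t coord_J_op)
  qed
  have "(norm y)\<^sup>2 = (\<Sum>D<n. (norm (coord y D))\<^sup>2)" by (rule norm_sq_finite) (rule y0)
  also have "\<dots> \<le> (\<Sum>D<n. (norm (u D))\<^sup>2)"
    by (intro sum_mono power_mono yD) auto
  also have "\<dots> = (\<Sum>D<n. \<Sum>k<N ^ (n - Suc D). (\<Delta> D k)\<^sup>2 * (norm (coord x k))\<^sup>2)"
    by (simp add: u_def norm_fin_vec_sq power_mult_distrib)
  also have "\<dots> \<le> (\<Sum>D<n. \<Sum>k<N ^ (n - 1). (\<Delta> D k)\<^sup>2 * (norm (coord x k))\<^sup>2)"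
  proof (intro sum_mono sum_mono2)
    fix D
    have "N ^ (n - Suc D) \<le> N ^ (n - 1)" using N by (intro power_increasing) auto
    then show "{..<N ^ (n - Suc D)} \<subseteq> {..<N ^ (n - 1)}" by auto
  qed auto
  also have "\<dots> = (\<Sum>k<N ^ (n - 1). (\<Sum>D<n. (\<Delta> D k)\<^sup>2) * (norm (coord x k))\<^sup>2)"
    unfolding sum_distrib_right by (rule sum.swap)
  also have "\<dots> \<le> (\<Sum>k<N ^ (n - 1). (2 / real (n div 2)) * (norm (coord x k))\<^sup>2)"
    using amp_diff_sum[OF N n _ i] unfolding \<Delta>_def by (intro sum_mono mult_right_mono) auto
  also have "\<dots> \<le> (2 / real (n div 2)) * (norm x)\<^sup>2"
    unfolding sum_distrib_left[symmetric] by (intro mult_left_mono sum_coord_le) auto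
  also have "\<dots> = (defect n * norm x)\<^sup>2" by (simp add: defect_def power_mult_distrib)
  finally have "norm y \<le> defect n * norm x"
    by (rule power2_le_imp_le) (simp add: defect_def)
  then show "norm (((Sigma_op N (N - 1 - i) o\<^sub>L J_op N n) - (J_op N n o\<^sub>L section_seq N (S_op N i) n)) x)
      \<le> defect n * norm x"
    by (simp add: y_def)
qed (simp add: defect_def)

section \<open>Compression along the intertwiners\<close>

lemma tendsto_norm_0_le:
  fixes f :: "nat \<Rightarrow> 'a::real_normed_vector"
  assumes "\<And>n. n \<ge> l \<Longrightarrow> norm (f n) \<le> g n" "g \<longlonglongrightarrow> 0"
  shows "f \<longlonglongrightarrow> 0"
  by (rule Lim_null_comparison[OF eventually_sequentiallyI[of l] assms(2)]) (rule assms(1))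

lemma norm_blinfun_compose_le:
  "norm A \<le> a \<Longrightarrow> norm B \<le> b \<Longrightarrow> norm (A o\<^sub>L B) \<le> a * b"
  by (rule order_trans[OF norm_blinfun_compose])
    (intro mult_mono, auto intro: order_trans[OF norm_ge_zero])

lemma tendsto_compose_0:
  assumes "A \<longlonglongrightarrow> 0" "\<And>n. n \<ge> l \<Longrightarrow> norm (B n) \<le> C"
  shows "(\<lambda>n. A n o\<^sub>L B n) \<longlonglongrightarrow> 0"
proof (rule tendsto_norm_0_le[where l = l])
  show "norm (A n o\<^sub>L B n) \<le> norm (A n) * C" if "n \<ge> l" for n
    using assms(2)[OF that] by (intro norm_blinfun_compose_le) auto
  show "(\<lambda>n. norm (A n) * C) \<longlonglongrightarrow> 0"
    using assms(1) by (intro tendsto_mult_left_zero) (simp add: tendsto_norm_zero_iff)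
qed

lemma tendsto_compose_0':
  assumes "A \<longlonglongrightarrow> 0" "\<And>n. n \<ge> l \<Longrightarrow> norm (B n) \<le> C"
  shows "(\<lambda>n. B n o\<^sub>L A n) \<longlonglongrightarrow> 0"
proof (rule tendsto_norm_0_le[where l = l])
  show "norm (B n o\<^sub>L A n) \<le> C * norm (A n)" if "n \<ge> l" for n
    using assms(2)[OF that] by (intro norm_blinfun_compose_le) auto
  show "(\<lambda>n. C * norm (A n)) \<longlonglongrightarrow> 0"
    using assms(1) by (intro tendsto_mult_right_zero) (simp add: tendsto_norm_zero_iff)
qed

lemma defect_tendsto: "defect \<longlonglongrightarrow> 0"
proof -
  have "filterlim (\<lambda>n. n div 2) sequentially sequentially"
    unfolding filterlim_at_top
  proof
    fix Z :: nat
    show "eventually (\<lambda>n. Z \<le> n div 2) sequentially"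
      by (rule eventually_sequentiallyI[of "2 * Z"]) auto
  qed
  then have "(\<lambda>n. 2 / real (n div 2)) \<longlonglongrightarrow> 0"
    by (rule filterlim_compose[OF lim_const_over_n])
  then have "(\<lambda>n. sqrt (2 / real (n div 2))) \<longlonglongrightarrow> sqrt 0" by (rule tendsto_real_sqrt)
  then show ?thesis by (simp add: defect_def[abs_def])
qed

lemma norm_Sigma_op_le: "norm (Sigma_op N i) \<le> 1"
proof (rule norm_blinfun_bound)
  fix x
  show "norm (Sigma_op N i x) \<le> 1 * norm x"
    by (simp, rule norm_le_l2I[of Suc UNIV]) (auto simp: coord_Sigma_op norm_S_op_le)
qed simp

lemma P_op_1: "P_op 1 = iota 0 o\<^sub>L proj 0"
  by (rule blinfun_eqI, rule l2_eqI) (simp add: coord_P_op coord_iota proj.rep_eq)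

locale finite_sections =
  fixes N :: nat
  assumes N2: "2 \<le> N"
begin

abbreviation J where "J n \<equiv> J_op N n"
abbreviation Pn :: "nat \<Rightarrow> complex l2 \<Rightarrow>\<^sub>L complex l2" where "Pn n \<equiv> P_op (N ^ n)"
abbreviation t where "t i n \<equiv> section_seq N (S_op N i) n"

lemma t_eq:
  assumes "i < N" "n \<ge> 1"
  shows "t i n = S_op N i o\<^sub>L Pn (n - 1)" "t i n = Pn n o\<^sub>L S_op N i"
proof -
  have e: "N ^ n = N ^ (n - 1) * N" using assms by (cases n) auto
  show 2: "t i n = S_op N i o\<^sub>L Pn (n - 1)"
    unfolding section_seq_def e P_op_S_op[OF assms(1)]
    unfolding blinfun_compose_assoc P_op_P_op
    using N2 by (simp add: min_def)
  show "t i n = Pn n o\<^sub>L S_op N i"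
    unfolding 2 e P_op_S_op[OF assms(1)] ..
qed

lemma sum_t:
  assumes "n \<ge> 1"
  shows "(\<Sum>i<N. t i n o\<^sub>L radj (t i n)) = Pn n"
proof -
  have "(\<Sum>i<N. t i n o\<^sub>L radj (t i n)) = (\<Sum>i<N. Pn n o\<^sub>L (S_op N i o\<^sub>L radj (S_op N i)) o\<^sub>L Pn n)"
    by (rule sum.cong) (use assms in \<open>simp_all add: t_eq(2) radj_compose blinfun_compose_assoc\<close>)
  also have "\<dots> = Pn n"
    using N2 by (simp add: blinfun_compose_sum[symmetric] sum_S_op)
  finally show ?thesis .
qed

lemma norm_t_le: "norm (t i n) \<le> 1"
  unfolding section_seq_def
  using norm_blinfun_compose_le[OF norm_blinfun_compose_le[OF norm_P_op_le norm_S_op_le1] norm_P_op_le]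
  by simp

lemma Pn_t [simp]: "Pn n o\<^sub>L t i n = t i n" "t i n o\<^sub>L Pn n = t i n"
  unfolding section_seq_def by (simp_all add: blinfun_compose_assoc)
    (simp_all add: blinfun_compose_assoc[symmetric])

lemma Pn_radj_t [simp]: "Pn n o\<^sub>L radj (t i n) = radj (t i n)" "radj (t i n) o\<^sub>L Pn n = radj (t i n)"
  by (metis Pn_t(2) radj_compose radj_P_op) (metis Pn_t(1) radj_compose radj_P_op)

text \<open>Inserting \<open>\<Sum> t\<^sub>k t\<^sub>k\<^sup>* = 1\<close> reduces the estimate for the adjoint to the one for
  \<open>\<Sigma>\<close> itself; the remaining term vanishes because \<open>t\<^sub>i\<^sup>*\<close> maps into the range of
  \<open>P\<close> with index \<open>N ^ (n - 1)\<close>.\<close>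

lemma radj_Sigma_op_J_op:
  assumes n: "n \<ge> 2" and i: "i < N"
  shows "norm ((radj (Sigma_op N (N - 1 - i)) o\<^sub>L J n) - (J n o\<^sub>L radj (t i n))) \<le> real N * defect n"
proof -
  let ?S = "\<lambda>i. Sigma_op N (N - 1 - i)"
  define E where "E k = (?S k o\<^sub>L J n) - (J n o\<^sub>L t k n)" for k
  have PJ: "P_op 1 o\<^sub>L (J n o\<^sub>L radj (t i n)) = 0"
  proof -
    have "N ^ (n - 1) \<le> N ^ n" using N2 by (intro power_increasing) auto
    then have "(Pn n - Pn (n - 1)) o\<^sub>L radj (t i n) = 0"
      using i n by (simp add: t_eq(1) radj_compose blinfun_compose_distrib
          blinfun_compose_assoc[symmetric] P_op_P_op min_def)
    then have "proj 0 o\<^sub>L (J n o\<^sub>L radj (t i n)) = 0"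
      using proj_J_op[OF N2 n] by (metis blinfun_compose_assoc blinfun_compose_simps(4))
    then show ?thesis unfolding P_op_1 by (simp add: blinfun_compose_assoc)
  qed
  have eq: "radj (?S i) o\<^sub>L ?S k = (if i = k then id_blinfun - P_op 1 else 0)" if "k < N" for k
    using i that by (subst radj_Sigma_op_Sigma_op) auto
  have "radj (?S i) o\<^sub>L J n = (radj (?S i) o\<^sub>L J n) o\<^sub>L (\<Sum>k<N. t k n o\<^sub>L radj (t k n))"
    using n N2 by (simp add: sum_t blinfun_compose_assoc J_op_P_op)
  also have "\<dots> = (\<Sum>k<N. radj (?S i) o\<^sub>L (J n o\<^sub>L t k n) o\<^sub>L radj (t k n))"
    by (simp add: blinfun_compose_sum blinfun_compose_assoc)
  also have "\<dots> = (\<Sum>k<N. (if i = k then J n o\<^sub>L radj (t k n) else 0)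
      - (radj (?S i) o\<^sub>L E k o\<^sub>L radj (t k n)))"
  proof (rule sum.cong[OF refl])
    fix k assume "k \<in> {..<N}"
    then have k: "k < N" by simp
    have J: "J n o\<^sub>L t k n = (?S k o\<^sub>L J n) - E k" by (simp add: E_def)
    have "radj (?S i) o\<^sub>L (J n o\<^sub>L t k n) o\<^sub>L radj (t k n)
        = ((radj (?S i) o\<^sub>L ?S k) o\<^sub>L (J n o\<^sub>L radj (t k n))) - (radj (?S i) o\<^sub>L E k o\<^sub>L radj (t k n))"
      unfolding J by (simp add: blinfun_compose_distrib blinfun_compose_assoc)
    then show "radj (?S i) o\<^sub>L (J n o\<^sub>L t k n) o\<^sub>L radj (t k n) = (if i = k then J n o\<^sub>L radj (t k n) else 0)
      - (radj (?S i) o\<^sub>L E k o\<^sub>L radj (t k n))"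
      using PJ unfolding eq[OF k] by (auto simp: blinfun_compose_distrib)
  qed
  also have "\<dots> = (J n o\<^sub>L radj (t i n)) - (\<Sum>k<N. radj (?S i) o\<^sub>L E k o\<^sub>L radj (t k n))"
    using i by (simp add: sum_subtractf)
  finally have "(radj (?S i) o\<^sub>L J n) - (J n o\<^sub>L radj (t i n)) = - (\<Sum>k<N. radj (?S i) o\<^sub>L E k o\<^sub>L radj (t k n))"
    by simp
  moreover have "norm (\<Sum>k<N. radj (?S i) o\<^sub>L E k o\<^sub>L radj (t k n)) \<le> (\<Sum>k<N. 1 * defect n * 1)"
    using Sigma_op_J_op[OF N2 n] norm_t_le
    by (intro sum_norm_le norm_blinfun_compose_le) (auto simp: E_def norm_radj norm_Sigma_op_le)
  ultimately show ?thesis by simp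
qed

text \<open>The first two entries are set to zero because \<^const>\<open>J_op\<close> is an isometry on the range of
  \<open>P_op (N ^ n)\<close> only from \<open>n = 2\<close> on.\<close>

definition Gam :: "(complex l2 l2 \<Rightarrow>\<^sub>L complex l2 l2) \<Rightarrow> nat \<Rightarrow> (complex l2 \<Rightarrow>\<^sub>L complex l2)"
  where "Gam T n = (if n < 2 then 0 else radj (J n) o\<^sub>L T o\<^sub>L J n)"

text \<open>For \<open>n \<ge> 2\<close> this is the part of \<open>T o\<^sub>L J n\<close>
  orthogonal to the range of \<open>J n\<close>, so it measures how far that range is from being
  invariant under \<open>T\<close>.\<close>

definition err where "err T n = (T o\<^sub>L J n) - (J n o\<^sub>L Gam T n)"

definition good where "good T \<longleftrightarrow> clinear_op T \<and> err T \<longlonglongrightarrow> 0"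

lemma Gam_simps:
  "Gam 0 n = 0" "Gam (A + B) n = Gam A n + Gam B n" "Gam (A - B) n = Gam A n - Gam B n"
  "clinear_op A \<Longrightarrow> Gam (scaleC_op c o\<^sub>L A) n = scaleC_op c o\<^sub>L Gam A n"
  "radj (Gam A n) = Gam (radj A) n"
proof -
  have comm: "radj (J n) o\<^sub>L (scaleC_op c o\<^sub>L B) = scaleC_op c o\<^sub>L (radj (J n) o\<^sub>L B)"
    for B :: "complex l2 \<Rightarrow>\<^sub>L complex l2 l2"
    by (rule blinfun_eqI) (simp add: clinear_opD[OF clinear_op_radj[OF clinear_J_op]])
  show "Gam 0 n = 0" "Gam (A + B) n = Gam A n + Gam B n" "Gam (A - B) n = Gam A n - Gam B n"
    "Gam (scaleC_op c o\<^sub>L A) n = scaleC_op c o\<^sub>L Gam A n" "radj (Gam A n) = Gam (radj A) n"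
    by (simp_all add: Gam_def blinfun_compose_distrib comm blinfun_compose_assoc radj_compose radj_radj)
qed

lemma norm_Gam_le: "norm (Gam T n) \<le> norm T"
proof (cases "n < 2")
  case False
  then have "norm (radj (J n) o\<^sub>L T o\<^sub>L J n) \<le> 1 * norm T * 1"
    using N2 norm_J_op_le[of N n] by (intro norm_blinfun_compose_le) (auto simp: norm_radj)
  then show ?thesis by (simp add: Gam_def)
qed (simp add: Gam_def)

lemma norm_err_le:
  assumes "n \<ge> 2"
  shows "norm (err T n) \<le> 2 * norm T"
proof -
  have "norm (T o\<^sub>L J n) \<le> norm T * 1"
    by (rule norm_blinfun_compose_le[OF order_refl norm_J_op_le[OF N2 assms]])
  moreover have "norm (J n o\<^sub>L Gam T n) \<le> 1 * norm T"
    by (rule norm_blinfun_compose_le[OF norm_J_op_le[OF N2 assms] norm_Gam_le])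
  ultimately show ?thesis
    unfolding err_def using norm_triangle_ineq4[of "T o\<^sub>L J n" "J n o\<^sub>L Gam T n"] by simp
qed

lemma Pn_radj_J: "Pn n o\<^sub>L radj (J n) = radj (J n)"
  using arg_cong[OF J_op_P_op[of N n], of radj] N2 by (simp add: radj_compose)

lemma Gam_mult:
  assumes n: "n \<ge> 2"
  shows "Gam (A o\<^sub>L B) n = (Gam A n o\<^sub>L Gam B n) + (radj (J n) o\<^sub>L (A o\<^sub>L err B n))"
  using n by (simp add: Gam_def err_def blinfun_compose_distrib blinfun_compose_assoc)

lemma err_mult:
  assumes n: "n \<ge> 2"
  shows "err (A o\<^sub>L B) n = (A o\<^sub>L err B n) - (J n o\<^sub>L (radj (J n) o\<^sub>L (A o\<^sub>L err B n))) + (err A n o\<^sub>L Gam B n)"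
  using n by (simp add: Gam_def err_def blinfun_compose_distrib blinfun_compose_assoc)

text \<open>Inserting the range projection of \<open>J n\<close> between the factors costs only the
  error of the right factor. Compression is therefore multiplicative up to null sequences as soon as
  errors vanish.\<close>

lemma good_mult:
  assumes A: "clinear_op A" "err A \<longlonglongrightarrow> 0" and B: "good B"
  shows "good (A o\<^sub>L B)" "(\<lambda>n. Gam (A o\<^sub>L B) n - (Gam A n o\<^sub>L Gam B n)) \<longlonglongrightarrow> 0"
proof -
  have 1: "(\<lambda>n. A o\<^sub>L err B n) \<longlonglongrightarrow> 0"
    using B by (intro tendsto_compose_0'[where C = "norm A"]) (auto simp: good_def)
  have 2: "(\<lambda>n. radj (J n) o\<^sub>L (A o\<^sub>L err B n)) \<longlonglongrightarrow> 0"
    by (rule tendsto_compose_0'[OF 1, where l = 2 and C = 1]) (simp add: norm_radj norm_J_op_le N2)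
  have 3: "(\<lambda>n. J n o\<^sub>L (radj (J n) o\<^sub>L (A o\<^sub>L err B n))) \<longlonglongrightarrow> 0"
    by (rule tendsto_compose_0'[OF 2, where l = 2 and C = 1]) (simp add: norm_J_op_le N2)
  have 4: "(\<lambda>n. err A n o\<^sub>L Gam B n) \<longlonglongrightarrow> 0"
    by (rule tendsto_compose_0[OF A(2), where l = 0]) (rule norm_Gam_le)
  have "(\<lambda>n. (A o\<^sub>L err B n) - (J n o\<^sub>L (radj (J n) o\<^sub>L (A o\<^sub>L err B n))) + (err A n o\<^sub>L Gam B n)) \<longlonglongrightarrow> 0 - 0 + 0"
    by (intro tendsto_add tendsto_diff 1 3 4)
  then have "(\<lambda>n. (A o\<^sub>L err B n) - (J n o\<^sub>L (radj (J n) o\<^sub>L (A o\<^sub>L err B n))) + (err A n o\<^sub>L Gam B n)) \<longlonglongrightarrow> 0"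
    by simp
  then have "(\<lambda>n. err (A o\<^sub>L B) n) \<longlonglongrightarrow> 0"
    by (rule Lim_transform_eventually[OF _ eventually_sequentiallyI[of 2]]) (auto simp: err_mult)
  then show "good (A o\<^sub>L B)" using A(1) B by (simp add: good_def clinear_op_compose)
  show "(\<lambda>n. Gam (A o\<^sub>L B) n - (Gam A n o\<^sub>L Gam B n)) \<longlonglongrightarrow> 0"
    using 2 by (rule Lim_transform_eventually[OF _ eventually_sequentiallyI[of 2]]) (auto simp: Gam_mult)
qed

lemma err_simps:
  "err 0 n = 0" "err (A + B) n = err A n + err B n" "err (A - B) n = err A n - err B n"
  "clinear_op A \<Longrightarrow> err (scaleC_op c o\<^sub>L A) n = scaleC_op c o\<^sub>L err A n"
proof -
  have comm: "J n o\<^sub>L (scaleC_op c o\<^sub>L B) = scaleC_op c o\<^sub>L (J n o\<^sub>L B)"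
    for B :: "complex l2 \<Rightarrow>\<^sub>L complex l2"
    by (rule blinfun_eqI) (simp add: clinear_opD[OF clinear_J_op])
  show "err 0 n = 0" "err (A + B) n = err A n + err B n" "err (A - B) n = err A n - err B n"
    "clinear_op A \<Longrightarrow> err (scaleC_op c o\<^sub>L A) n = scaleC_op c o\<^sub>L err A n"
    by (simp_all add: err_def Gam_simps blinfun_compose_distrib blinfun_compose_assoc comm)
qed

lemma closed_subalgebra_good: "closed_subalgebra bounded_ops (Collect good)"
proof (rule closed_subalgebra_opsI)
  show "0 \<in> Collect good" by (simp add: good_def err_simps(1)[abs_def])
  fix x y and c assume x: "x \<in> Collect good" and y: "y \<in> Collect good"
  show "x + y \<in> Collect good"
    using x y tendsto_add[of "err x" 0 _ "err y" 0]
    by (simp add: good_def err_simps(2)[abs_def] clinear_op_add)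
  show "x o\<^sub>L y \<in> Collect good" using x y good_mult by (auto simp: good_def)
  have "err (scaleC_op c o\<^sub>L x) = (\<lambda>n. scaleC_op c o\<^sub>L err x n)"
    using x by (intro ext) (simp add: good_def err_simps)
  then show "scaleC_op c o\<^sub>L x \<in> Collect good"
    using x tendsto_compose_0'[of "err x" 0 "\<lambda>_. scaleC_op c" "norm (scaleC_op c :: complex l2 l2 \<Rightarrow>\<^sub>L _)"]
    by (auto simp: good_def clinear_op_compose)
next
  fix f x assume f: "\<And>n::nat. f n \<in> Collect good" "f \<longlonglongrightarrow> x" "clinear_op x"
  have "err x \<longlonglongrightarrow> 0"
  proof (rule LIMSEQ_I)
    fix e :: real assume "e > 0"
    then obtain m where m: "norm (f m - x) < e / 4"
      using LIMSEQ_D[OF f(2), of "e / 4"] by auto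
    have "err (f m) \<longlonglongrightarrow> 0" using f(1) by (simp add: good_def)
    then obtain M where M: "\<And>n. n \<ge> M \<Longrightarrow> norm (err (f m) n) < e / 2"
      using LIMSEQ_D[of "err (f m)" 0 "e / 2"] \<open>e > 0\<close> by auto
    have "norm (err x n - 0) < e" if "n \<ge> max M 2" for n
    proof -
      have "err x n = err (f m) n - err (f m - x) n" by (simp add: err_simps)
      then have "norm (err x n) \<le> norm (err (f m) n) + norm (err (f m - x) n)"
        by (simp add: norm_triangle_ineq4)
      moreover have "norm (err (f m - x) n) \<le> 2 * norm (f m - x)" using that by (intro norm_err_le) auto
      ultimately show ?thesis using m M[of n] that by simp
    qed
    then show "\<exists>no. \<forall>n\<ge>no. norm (err x n - 0) < e" by blast
  qed
  then show "x \<in> Collect good" using f by (simp add: good_def)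
qed (simp add: good_def)

text \<open>Multiplying the approximate relation by \<open>radj (J n)\<close> from the left shows
  that any asymptotic intertwining partner \<open>a\<close> is the compression of \<open>T\<close>
  up to a null sequence, because \<open>J n\<close> is isometric on the range of
  \<open>Pn n\<close>.\<close>

lemma good_approx:
  assumes "clinear_op T" "(\<lambda>n. (T o\<^sub>L J n) - (J n o\<^sub>L a n)) \<longlonglongrightarrow> 0" "\<And>n. Pn n o\<^sub>L a n = a n"
  shows "good T" "(\<lambda>n. Gam T n - a n) \<longlonglongrightarrow> 0"
proof -
  define E where "E n = (T o\<^sub>L J n) - (J n o\<^sub>L a n)" for n
  have E: "E \<longlonglongrightarrow> 0" using assms(2) by (simp add: E_def[abs_def])
  have T: "T o\<^sub>L J n = E n + (J n o\<^sub>L a n)" for n by (simp add: E_def)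
  have Ja: "radj (J n) o\<^sub>L (J n o\<^sub>L a n) = a n" if "n \<ge> 2" for n
    using radj_J_op_J_op[OF N2 that] assms(3) by (metis blinfun_compose_assoc)
  have G: "Gam T n = (radj (J n) o\<^sub>L E n) + a n" if "n \<ge> 2" for n
    using that by (simp add: Gam_def blinfun_compose_assoc T blinfun_compose_distrib Ja)
  have 1: "(\<lambda>n. radj (J n) o\<^sub>L E n) \<longlonglongrightarrow> 0"
    by (rule tendsto_compose_0'[OF E, where l = 2 and C = 1]) (simp add: norm_radj norm_J_op_le N2)
  then show "(\<lambda>n. Gam T n - a n) \<longlonglongrightarrow> 0"
    by (rule Lim_transform_eventually[OF _ eventually_sequentiallyI[of 2]]) (auto simp: G)
  have "(\<lambda>n. J n o\<^sub>L (radj (J n) o\<^sub>L E n)) \<longlonglongrightarrow> 0"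
    by (rule tendsto_compose_0'[OF 1, where l = 2 and C = 1]) (simp add: norm_J_op_le N2)
  then have "(\<lambda>n. E n - (J n o\<^sub>L (radj (J n) o\<^sub>L E n))) \<longlonglongrightarrow> 0 - 0"
    by (intro tendsto_diff E)
  then have "(\<lambda>n. E n - (J n o\<^sub>L (radj (J n) o\<^sub>L E n))) \<longlonglongrightarrow> 0" by simp
  then have "err T \<longlonglongrightarrow> 0"
    by (rule Lim_transform_eventually[OF _ eventually_sequentiallyI[of 2]])
      (auto simp: G err_def T blinfun_compose_distrib)
  then show "good T" using assms(1) by (simp add: good_def)
qed

lemma good_Sigma_op:
  assumes "i < N"
  shows "good (Sigma_op N (N - 1 - i))" "(\<lambda>n. Gam (Sigma_op N (N - 1 - i)) n - t i n) \<longlonglongrightarrow> 0"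
    "good (radj (Sigma_op N (N - 1 - i)))" "(\<lambda>n. Gam (radj (Sigma_op N (N - 1 - i))) n - radj (t i n)) \<longlonglongrightarrow> 0"
proof -
  have 1: "(\<lambda>n. (Sigma_op N (N - 1 - i) o\<^sub>L J n) - (J n o\<^sub>L t i n)) \<longlonglongrightarrow> 0"
    by (rule tendsto_norm_0_le[OF Sigma_op_J_op[OF N2 _ assms] defect_tendsto])
  have 2: "(\<lambda>n. (radj (Sigma_op N (N - 1 - i)) o\<^sub>L J n) - (J n o\<^sub>L radj (t i n))) \<longlonglongrightarrow> 0"
    by (rule tendsto_norm_0_le[OF radj_Sigma_op_J_op[OF _ assms]])
      (auto intro: tendsto_mult_right_zero defect_tendsto)
  show "good (Sigma_op N (N - 1 - i))" "(\<lambda>n. Gam (Sigma_op N (N - 1 - i)) n - t i n) \<longlonglongrightarrow> 0"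
    using good_approx[OF clinear_Sigma_op 1] by auto
  show "good (radj (Sigma_op N (N - 1 - i)))" "(\<lambda>n. Gam (radj (Sigma_op N (N - 1 - i))) n - radj (t i n)) \<longlonglongrightarrow> 0"
    using good_approx[OF clinear_op_radj[OF clinear_Sigma_op] 2] by auto
qed

text \<open>\<open>Q n\<close> tends strongly to the identity, so \<open>Q n\<close> applied to
  \<open>T (Q n x)\<close> tends to \<open>T x\<close>, while its norm is controlled by the
  compression. The null sequence \<open>g\<close> admits an arbitrary representative of the
  coset.\<close>

lemma norm_le_Gam:
  assumes g: "g \<longlonglongrightarrow> 0" and C: "\<And>n. norm (Gam T n + g n) \<le> C"
  shows "norm T \<le> C"
proof (rule norm_blinfun_bound)
  show "C \<ge> 0" using C[of 0] norm_ge_zero[of "Gam T 0 + g 0"] by linarith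
  fix x
  define Q where "Q n = J n o\<^sub>L radj (J n)" for n
  have Q: "(\<lambda>n. Q n y) \<longlonglongrightarrow> y" for y using J_op_tendsto[OF N2] by (simp add: Q_def)
  have Q1: "norm (Q n) \<le> 1" if "n \<ge> 2" for n
    using norm_blinfun_compose_le[of "J n" 1 "radj (J n)" 1] norm_J_op_le[OF N2 that]
    by (simp add: Q_def norm_radj)
  have "(\<lambda>n. T (Q n x) - T x) \<longlonglongrightarrow> 0"
    by (intro LIM_zero blinfun.tendsto tendsto_const Q)
  then have "(\<lambda>n. Q n (T (Q n x) - T x)) \<longlonglongrightarrow> 0"
  proof (rule_tac tendsto_norm_0_le[where l = 2])
    show "norm (Q n (T (Q n x) - T x)) \<le> norm (T (Q n x) - T x)" if "n \<ge> 2" for n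
      using norm_blinfun[of "Q n" "T (Q n x) - T x"]
        mult_right_mono[OF Q1[OF that] norm_ge_zero[of "T (Q n x) - T x"]]
      by linarith
  qed (rule tendsto_norm_zero)
  then have "(\<lambda>n. Q n (T (Q n x) - T x) + Q n (T x)) \<longlonglongrightarrow> 0 + T x"
    by (intro tendsto_add Q)
  then have lim: "(\<lambda>n. norm (Q n (T (Q n x)))) \<longlonglongrightarrow> norm (T x)"
    by (intro tendsto_norm) (simp add: blinfun.diff_right)
  show "norm (T x) \<le> C * norm x"
  proof (rule LIMSEQ_le[OF lim])
    show "(\<lambda>n. (C + norm (g n)) * norm x) \<longlonglongrightarrow> C * norm x"
      using tendsto_mult[OF tendsto_add[OF tendsto_const tendsto_norm[OF g]] tendsto_const] by simp
    have "norm (Q n (T (Q n x))) \<le> (C + norm (g n)) * norm x" if n: "n \<ge> 2" for n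
    proof -
      have "Q n (T (Q n x)) = (J n o\<^sub>L Gam T n o\<^sub>L radj (J n)) x" using n by (simp add: Q_def Gam_def)
      moreover have "norm (Gam T n) \<le> C + norm (g n)"
        using norm_triangle_ineq4[of "Gam T n + g n" "g n"] C[of n] by simp
      then have "norm (J n o\<^sub>L Gam T n o\<^sub>L radj (J n)) \<le> 1 * (C + norm (g n)) * 1"
        using norm_J_op_le[OF N2 n] by (intro norm_blinfun_compose_le) (auto simp: norm_radj)
      ultimately show ?thesis
        using norm_blinfun[of "J n o\<^sub>L Gam T n o\<^sub>L radj (J n)" x]
          mult_right_mono[of "norm (J n o\<^sub>L Gam T n o\<^sub>L radj (J n))" "C + norm (g n)" "norm x"]
        by simp
    qed
    then show "\<exists>M. \<forall>n\<ge>M. norm (Q n (T (Q n x))) \<le> (C + norm (g n)) * norm x" by blast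
  qed
qed

end

section \<open>The algebra of bounded matrix sequences\<close>

lemma F_alg_simps [simp]:
  "mult (F_alg N) = (\<lambda>A B n. A n o\<^sub>L B n)" "one (F_alg N) = (\<lambda>n. P_op (N ^ n))"
  "zero (F_alg N) = (\<lambda>n. 0)" "add (F_alg N) = (\<lambda>A B n. A n + B n)"
  "smult (F_alg N) = (\<lambda>c A n. scaleC_op c o\<^sub>L A n)" "star (F_alg N) = (\<lambda>A n. adj_op (A n))"
  "nrm (F_alg N) = (\<lambda>A. SUP n. norm (A n))"
  by (simp_all add: F_alg_def)

lemma F_carrier_iff:
  "A \<in> carrier (F_alg N) \<longleftrightarrow>
    (\<forall>n. clinear_op (A n) \<and> P_op (N ^ n) o\<^sub>L A n = A n \<and> A n o\<^sub>L P_op (N ^ n) = A n) \<and>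
    (\<exists>C. \<forall>n. norm (A n) \<le> C)"
proof -
  have "P_op m o\<^sub>L B o\<^sub>L P_op m = B \<longleftrightarrow> P_op m o\<^sub>L B = B \<and> B o\<^sub>L P_op m = B"
    for m and B :: "complex l2 \<Rightarrow>\<^sub>L complex l2"
    by (metis P_op_idem blinfun_compose_assoc)
  then show ?thesis
    by (auto simp: F_alg_def bdd_above_def)
qed

lemma F_carrierI:
  assumes "\<And>n. clinear_op (A n)" "\<And>n. P_op (N ^ n) o\<^sub>L A n = A n" "\<And>n. A n o\<^sub>L P_op (N ^ n) = A n"
    "\<And>n. norm (A n) \<le> C"
  shows "A \<in> carrier (F_alg N)"
  using assms unfolding F_carrier_iff by blast

lemma F_carrierD:
  assumes "A \<in> carrier (F_alg N)"
  shows "clinear_op (A n)" "P_op (N ^ n) o\<^sub>L A n = A n" "A n o\<^sub>L P_op (N ^ n) = A n"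
    "\<exists>C. \<forall>n. norm (A n) \<le> C"
  using assms unfolding F_carrier_iff by blast+

lemma norm_le_nrm_F:
  assumes "A \<in> carrier (F_alg N)"
  shows "norm (A n) \<le> nrm (F_alg N) A"
proof -
  obtain C where "\<And>n. norm (A n) \<le> C" using F_carrierD(4)[OF assms] by blast
  then show ?thesis by (auto intro!: cSUP_upper bdd_aboveI2)
qed

lemma nrm_F_le: "(\<And>n. norm (A n) \<le> C) \<Longrightarrow> nrm (F_alg N) A \<le> C"
  by (auto intro!: cSUP_least)

lemma F_carrier_closed:
  assumes A: "A \<in> carrier (F_alg N)" and B: "B \<in> carrier (F_alg N)"
  shows "(\<lambda>n. A n + B n) \<in> carrier (F_alg N)" "(\<lambda>n. A n o\<^sub>L B n) \<in> carrier (F_alg N)"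
    "(\<lambda>n. A n - B n) \<in> carrier (F_alg N)" "(\<lambda>n. - A n) \<in> carrier (F_alg N)"
    "(\<lambda>n. scaleC_op c o\<^sub>L A n) \<in> carrier (F_alg N)" "(\<lambda>n. radj (A n)) \<in> carrier (F_alg N)"
proof -
  note a = F_carrierD(1-3)[OF A] and b = F_carrierD(1-3)[OF B]
  obtain C where C: "\<And>n. norm (A n) \<le> C" using F_carrierD(4)[OF A] by blast
  obtain D where D: "\<And>n. norm (B n) \<le> D" using F_carrierD(4)[OF B] by blast
  have m: "P_op m o\<^sub>L (- X) = - (P_op m o\<^sub>L X)" "(- X) o\<^sub>L P_op m = - (X o\<^sub>L P_op m)"
    for m and X :: "complex l2 \<Rightarrow>\<^sub>L complex l2"
    by (auto intro!: blinfun_eqI simp: blinfun.minus_left blinfun.minus_right)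
  have sc: "P_op m o\<^sub>L (scaleC_op c o\<^sub>L X) = scaleC_op c o\<^sub>L (P_op m o\<^sub>L X)"
    for m and X :: "complex l2 \<Rightarrow>\<^sub>L complex l2"
    by (rule blinfun_eqI) (simp add: clinear_opD[OF clinear_P_op])
  show "(\<lambda>n. A n + B n) \<in> carrier (F_alg N)"
    using a b C D by (intro F_carrierI[where C = "C + D"])
      (auto simp: clinear_op_intros blinfun_compose_distrib intro: norm_triangle_mono)
  show "(\<lambda>n. A n o\<^sub>L B n) \<in> carrier (F_alg N)"
    by (intro F_carrierI[where C = "C * D"])
      (auto simp: clinear_op_intros a b blinfun_compose_assoc[of _ _ "P_op _"]
        blinfun_compose_assoc[of "P_op _", symmetric] intro: norm_blinfun_compose_le C D)
  have "norm (A n - B n) \<le> C + D" for n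
    by (rule order_trans[OF norm_triangle_ineq4 add_mono[OF C D]])
  then show "(\<lambda>n. A n - B n) \<in> carrier (F_alg N)"
    using a b by (intro F_carrierI[where C = "C + D"])
      (auto simp: clinear_op_intros blinfun_compose_distrib)
  show "(\<lambda>n. - A n) \<in> carrier (F_alg N)"
    using a C by (intro F_carrierI[where C = C]) (auto simp: clinear_op_intros m)
  show "(\<lambda>n. scaleC_op c o\<^sub>L A n) \<in> carrier (F_alg N)"
    using a C by (intro F_carrierI[where C = "cmod c * C"])
      (auto simp: clinear_op_intros sc blinfun_compose_assoc norm_scaleC_op_compose intro: mult_left_mono)
  show "(\<lambda>n. radj (A n)) \<in> carrier (F_alg N)"
    using C by (intro F_carrierI[where C = C])
      (auto simp: clinear_op_radj a norm_radj arg_cong[OF a(2), of radj, unfolded radj_compose, simplified]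
        arg_cong[OF a(3), of radj, unfolded radj_compose, simplified])
qed

context
  fixes N :: nat and U :: "(nat \<Rightarrow> (complex l2 \<Rightarrow>\<^sub>L complex l2)) set"
  assumes U: "U \<subseteq> carrier (F_alg N)"
    "\<And>x y. \<lbrakk>x \<in> U; y \<in> U\<rbrakk> \<Longrightarrow> (\<lambda>n. x n + y n) \<in> U"
    "\<And>x y. \<lbrakk>x \<in> U; y \<in> U\<rbrakk> \<Longrightarrow> (\<lambda>n. x n o\<^sub>L y n) \<in> U" "\<And>x. x \<in> U \<Longrightarrow> (\<lambda>n. - x n) \<in> U"
    "(\<lambda>n. 0) \<in> U" "(\<lambda>n. P_op (N ^ n)) \<in> U"
begin

lemma ring_F: "ring ((F_alg N)\<lparr>carrier := U\<rparr>)"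
proof (rule ringI)
  let ?A = "(F_alg N)\<lparr>carrier := U\<rparr>"
  show "abelian_group ?A"
  proof (rule abelian_groupI)
    fix x assume "x \<in> carrier ?A"
    then show "\<exists>y\<in>carrier ?A.
        y \<oplus>\<^bsub>?A\<^esub> x = \<zero>\<^bsub>?A\<^esub>"
      using U by (intro bexI[of _ "\<lambda>n. - x n"]) auto
  qed (simp_all add: U add_ac)
  show "Group.monoid ?A"
    by (rule monoidI) (simp_all add: U blinfun_compose_assoc F_carrierD(2,3)[OF subsetD[OF U(1)]])
qed (simp_all add: blinfun_compose_distrib)

lemma minus_F:
  assumes "x \<in> U" "y \<in> U"
  shows "x \<ominus>\<^bsub>(F_alg N)\<lparr>carrier := U\<rparr>\<^esub> y = (\<lambda>n. x n - y n)"
proof -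
  interpret ring "(F_alg N)\<lparr>carrier := U\<rparr>" by (rule ring_F)
  have "\<ominus>\<^bsub>(F_alg N)\<lparr>carrier := U\<rparr>\<^esub> y = (\<lambda>n. - y n)"
    using assms U by (intro minus_equality) auto
  then show ?thesis using assms by (simp add: minus_eq)
qed

end

lemma one_F_carrier: "(\<lambda>n. P_op (N ^ n)) \<in> carrier (F_alg N)"
  by (rule F_carrierI[where C = 1]) (auto simp: norm_P_op_le)

lemma zero_F_carrier: "(\<lambda>n. 0) \<in> carrier (F_alg N)"
  by (rule F_carrierI[where C = 0]) auto

lemma norm_conv_F:
  assumes "\<And>m. f m \<in> carrier (F_alg N)" "x \<in> carrier (F_alg N)"
  shows "norm_conv (F_alg N) f x \<longleftrightarrow> (\<forall>e>0. \<exists>M. \<forall>m\<ge>M. \<forall>n. norm (f m n - x n) \<le> e)"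
proof -
  have eq: "(F_alg N)\<lparr>carrier := carrier (F_alg N)\<rparr> = F_alg N" by simp
  have "f m \<ominus>\<^bsub>F_alg N\<^esub> x = (\<lambda>n. f m n - x n)" for m
    using minus_F[of "carrier (F_alg N)" N "f m" x, unfolded eq] assms
    by (simp add: F_carrier_closed one_F_carrier zero_F_carrier del: F_alg_simps)
  then have nc: "norm_conv (F_alg N) f x \<longleftrightarrow> (\<lambda>m. nrm (F_alg N) (\<lambda>n. f m n - x n)) \<longlonglongrightarrow> 0"
    by (simp only: norm_conv_def)
  have car: "(\<lambda>n. f m n - x n) \<in> carrier (F_alg N)" for m
    using assms by (simp add: F_carrier_closed)
  have pos: "0 \<le> nrm (F_alg N) (\<lambda>n. f m n - x n)" for m
    using norm_le_nrm_F[OF car, of m 0] norm_ge_zero order_trans by blast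
  show ?thesis
    unfolding nc
  proof
    assume L: "(\<lambda>m. nrm (F_alg N) (\<lambda>n. f m n - x n)) \<longlonglongrightarrow> 0"
    show "\<forall>e>0. \<exists>M. \<forall>m\<ge>M. \<forall>n. norm (f m n - x n) \<le> e"
    proof (intro allI impI)
      fix e :: real assume "e > 0"
      then obtain M where M: "\<And>m. m \<ge> M \<Longrightarrow> norm (nrm (F_alg N) (\<lambda>n. f m n - x n) - 0) < e"
        using LIMSEQ_D[OF L] by blast
      have "norm (f m n - x n) \<le> e" if "m \<ge> M" for m n
        using M[OF that] norm_le_nrm_F[OF car, of m n] by (simp del: F_alg_simps)
      then show "\<exists>M. \<forall>m\<ge>M. \<forall>n. norm (f m n - x n) \<le> e" by blast
    qed
  next
    assume R: "\<forall>e>0. \<exists>M. \<forall>m\<ge>M. \<forall>n. norm (f m n - x n) \<le> e"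
    show "(\<lambda>m. nrm (F_alg N) (\<lambda>n. f m n - x n)) \<longlonglongrightarrow> 0"
    proof (rule LIMSEQ_I)
      fix e :: real assume "e > 0"
      then obtain M where M: "\<forall>m\<ge>M. \<forall>n. norm (f m n - x n) \<le> e / 2"
        using R half_gt_zero by blast
      have "norm (nrm (F_alg N) (\<lambda>n. f m n - x n) - 0) < e" if "m \<ge> M" for m
        using nrm_F_le[of "\<lambda>n. f m n - x n" "e / 2" N] M that pos[of m] \<open>e > 0\<close>
        by (simp del: F_alg_simps)
      then show "\<exists>M. \<forall>m\<ge>M. norm (nrm (F_alg N) (\<lambda>n. f m n - x n) - 0) < e" by blast
    qed
  qed
qed

lemma c_star_subalgebra_FI:
  assumes car: "U \<subseteq> carrier (F_alg N)" and "(\<lambda>n. 0) \<in> U"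
    "\<And>x y. \<lbrakk>x \<in> U; y \<in> U\<rbrakk> \<Longrightarrow> (\<lambda>n. x n + y n) \<in> U"
    "\<And>x y. \<lbrakk>x \<in> U; y \<in> U\<rbrakk> \<Longrightarrow> (\<lambda>n. x n o\<^sub>L y n) \<in> U"
    "\<And>c x. x \<in> U \<Longrightarrow> (\<lambda>n. scaleC_op c o\<^sub>L x n) \<in> U"
    and st: "\<And>x. x \<in> U \<Longrightarrow> (\<lambda>n. radj (x n)) \<in> U"
    and lim: "\<And>(f :: nat \<Rightarrow> _) x. \<lbrakk>\<And>m. f m \<in> U; x \<in> carrier (F_alg N);
      \<And>e. e > 0 \<Longrightarrow> \<exists>M. \<forall>m\<ge>M. \<forall>n. norm (f m n - x n) \<le> e\<rbrakk> \<Longrightarrow> x \<in> U"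
  shows "c_star_subalgebra (F_alg N) U"
proof -
  have "norm_closed (F_alg N) U"
    unfolding norm_closed_def
  proof (intro allI impI)
    fix f x assume f: "range f \<subseteq> U" and x: "x \<in> carrier (F_alg N)" and nc: "norm_conv (F_alg N) f x"
    have "f m \<in> U" for m using f by auto
    moreover have "\<forall>e>0. \<exists>M. \<forall>m\<ge>M. \<forall>n. norm (f m n - x n) \<le> e"
      using nc norm_conv_F[of f N x] f car x by (simp add: image_subset_iff subset_iff)
    ultimately show "x \<in> U" using lim[of f x] x by blast
  qed
  moreover have "star (F_alg N) x \<in> U" if "x \<in> U" for x
    using st[OF that] F_carrierD(1)[of x N] car that by (auto simp: adj_op_eq_radj subset_iff)
  ultimately show ?thesis
    using assms(1-5) by (simp add: c_star_subalgebra_def closed_subalgebra_def)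
qed

lemma c_star_subalgebra_FD:
  fixes f :: "nat \<Rightarrow> nat \<Rightarrow> (complex l2 \<Rightarrow>\<^sub>L complex l2)"
  assumes U: "c_star_subalgebra (F_alg N) U"
  shows "U \<subseteq> carrier (F_alg N)" "(\<lambda>n. 0) \<in> U"
    "\<lbrakk>x \<in> U; y \<in> U\<rbrakk> \<Longrightarrow> (\<lambda>n. x n + y n) \<in> U"
    "\<lbrakk>x \<in> U; y \<in> U\<rbrakk> \<Longrightarrow> (\<lambda>n. x n o\<^sub>L y n) \<in> U"
    "x \<in> U \<Longrightarrow> (\<lambda>n. scaleC_op c o\<^sub>L x n) \<in> U"
    "x \<in> U \<Longrightarrow> (\<lambda>n. radj (x n)) \<in> U"
    "x \<in> U \<Longrightarrow> (\<lambda>n. - x n) \<in> U"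
    "\<lbrakk>x \<in> U; y \<in> U\<rbrakk> \<Longrightarrow> (\<lambda>n. x n - y n) \<in> U"
    "\<lbrakk>\<And>m. f m \<in> U; x \<in> carrier (F_alg N);
      \<And>e. e > 0 \<Longrightarrow> \<exists>M. \<forall>m\<ge>M. \<forall>n. norm (f m n - x n) \<le> e\<rbrakk> \<Longrightarrow> x \<in> U"
proof -
  show car: "U \<subseteq> carrier (F_alg N)" and "(\<lambda>n. 0) \<in> U"
    using U by (auto simp: c_star_subalgebra_def closed_subalgebra_def)
  show ad: "(\<lambda>n. x n + y n) \<in> U" and "(\<lambda>n. x n o\<^sub>L y n) \<in> U" if "x \<in> U" "y \<in> U" for x y
    using U that by (auto simp: c_star_subalgebra_def closed_subalgebra_def)
  show sc: "(\<lambda>n. scaleC_op c o\<^sub>L x n) \<in> U" if "x \<in> U" for c x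
    using U that by (auto simp: c_star_subalgebra_def closed_subalgebra_def)
  show mi: "(\<lambda>n. - x n) \<in> U" if "x \<in> U" for x using sc[OF that, of "- 1"] by simp
  show "(\<lambda>n. x n - y n) \<in> U" if "x \<in> U" "y \<in> U" using ad[OF that(1) mi[OF that(2)]] by simp
  show "(\<lambda>n. radj (x n)) \<in> U" if "x \<in> U"
  proof -
    have "star (F_alg N) x \<in> U" using U that by (simp add: c_star_subalgebra_def)
    then show ?thesis using F_carrierD(1)[of x N] car that by (auto simp: adj_op_eq_radj subset_iff)
  qed
  show "x \<in> U" if f: "\<And>m. f m \<in> U" "x \<in> carrier (F_alg N)"
    "\<And>e. e > 0 \<Longrightarrow> \<exists>M. \<forall>m\<ge>M. \<forall>n. norm (f m n - x n) \<le> e"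
  proof -
    have "f m \<in> carrier (F_alg N)" for m using f(1) car by blast
    then have "norm_conv (F_alg N) f x" using norm_conv_F[of f N x] f(2,3) by simp
    then show ?thesis
      using U f(1,2) unfolding c_star_subalgebra_def closed_subalgebra_def norm_closed_def
      by (metis image_subsetI)
  qed
qed

lemma c_star_subalgebra_F_carrier: "c_star_subalgebra (F_alg N) (carrier (F_alg N))"
  by (rule c_star_subalgebra_FI) (auto simp: F_carrier_closed zero_F_carrier)

lemma c_star_subalgebra_opsI:
  fixes B :: "('a::{complex_inner, banach} \<Rightarrow>\<^sub>L 'a) set"
  assumes "closed_subalgebra bounded_ops B" "\<And>x. x \<in> B \<Longrightarrow> radj x \<in> B"
  shows "c_star_subalgebra bounded_ops B"
  using assms closed_subalgebra_opsD(1)[OF assms(1)]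
  by (auto simp: c_star_subalgebra_def adj_op_eq_radj)

lemma c_star_subalgebra_opsD:
  fixes B :: "('a::{complex_inner, banach} \<Rightarrow>\<^sub>L 'a) set"
  assumes "c_star_subalgebra bounded_ops B"
  shows "closed_subalgebra bounded_ops B" "x \<in> B \<Longrightarrow> radj x \<in> B"
proof -
  show *: "closed_subalgebra bounded_ops B" using assms by (simp add: c_star_subalgebra_def)
  show "radj x \<in> B" if "x \<in> B"
    using assms closed_subalgebra_opsD(1)[OF * that] that
    by (auto simp: c_star_subalgebra_def adj_op_eq_radj[symmetric])
qed

lemma G_ideal_iff: "A \<in> G_ideal N \<longleftrightarrow> A \<in> carrier (F_alg N) \<and> A \<longlonglongrightarrow> 0"
  by (simp add: G_ideal_def tendsto_norm_zero_iff)

section \<open>The Cuntz algebra and the generators\<close>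

lemma norm_section_le: "norm (section_seq N A n) \<le> norm A"
proof -
  have "norm (P_op (N ^ n) o\<^sub>L A o\<^sub>L P_op (N ^ n)) \<le> 1 * norm A * 1"
    by (intro norm_blinfun_compose_le norm_P_op_le order_refl)
  then show ?thesis by (simp add: section_seq_def)
qed

lemma section_seq_F:
  assumes "clinear_op A"
  shows "section_seq N A \<in> carrier (F_alg N)"
proof (rule F_carrierI[OF _ _ _ norm_section_le])
  fix n
  show "P_op (N ^ n) o\<^sub>L section_seq N A n = section_seq N A n"
    by (simp add: section_seq_def blinfun_compose_assoc[symmetric])
  show "section_seq N A n o\<^sub>L P_op (N ^ n) = section_seq N A n"
    by (simp add: section_seq_def blinfun_compose_assoc)
qed (use assms in \<open>auto simp: section_seq_def clinear_op_intros\<close>)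

context finite_sections
begin

lemma c_star_subalgebra_Cuntz: "c_star_subalgebra bounded_ops (Cuntz N)"
  and S_op_Cuntz: "i < N \<Longrightarrow> S_op N i \<in> Cuntz N"
proof -
  have *: "c_star_subalgebra bounded_ops (Collect clinear_op :: (complex l2 \<Rightarrow>\<^sub>L complex l2) set)"
    by (rule c_star_subalgebra_opsI[OF closed_subalgebra_Collect_clinear]) (simp add: clinear_op_radj)
  show "c_star_subalgebra bounded_ops (Cuntz N)"
    unfolding Cuntz_def by (rule c_star_subalgebra_gen[OF *]) auto
  show "S_op N i \<in> Cuntz N" if "i < N"
    unfolding Cuntz_def using that by (intro subsetD[OF c_star_subalgebra_gen(2)[OF *]]) auto
qed

lemmas Cuntz = closed_subalgebra_opsD[OF c_star_subalgebra_opsD(1)[OF c_star_subalgebra_Cuntz]]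
  c_star_subalgebra_opsD(2)[OF c_star_subalgebra_Cuntz]

lemma id_Cuntz: "id_blinfun \<in> Cuntz N"
proof -
  have "(\<Sum>i\<in>I. S_op N i o\<^sub>L radj (S_op N i)) \<in> Cuntz N" if "I \<subseteq> {..<N}" for I
    using finite_subset[OF that finite_lessThan] that
    by (induction rule: finite_induct) (auto intro!: Cuntz(2-4,9) S_op_Cuntz)
  from this[OF order_refl] show ?thesis using N2 by (simp add: sum_S_op)
qed

definition U where "U = carrier (section_alg N)"

lemma c_star_subalgebra_U: "c_star_subalgebra (F_alg N) U"
  and section_seq_U: "A \<in> Cuntz N \<Longrightarrow> section_seq N A \<in> U"
proof -
  have *: "section_seq N ` Cuntz N \<subseteq> carrier (F_alg N)"
    using Cuntz(1) by (auto intro!: section_seq_F)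
  have U: "U = c_star_subalgebra_gen (F_alg N) (section_seq N ` Cuntz N)"
    by (simp add: U_def section_alg_def)
  show "c_star_subalgebra (F_alg N) U"
    unfolding U by (rule c_star_subalgebra_gen[OF c_star_subalgebra_F_carrier *])
  show "section_seq N A \<in> U" if "A \<in> Cuntz N"
    unfolding U using c_star_subalgebra_gen(2)[OF c_star_subalgebra_F_carrier *] that by blast
qed

lemmas U = c_star_subalgebra_FD[OF c_star_subalgebra_U]

lemma U_least:
  "c_star_subalgebra (F_alg N) B \<Longrightarrow> (\<And>A. A \<in> Cuntz N \<Longrightarrow> section_seq N A \<in> B) \<Longrightarrow> U \<subseteq> B"
  unfolding U_def section_alg_def by (auto simp: c_star_subalgebra_gen_def)

lemma one_U: "Pn \<in> U"
proof -
  have "section_seq N id_blinfun = Pn" by (simp add: section_seq_def fun_eq_iff)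
  then show ?thesis using section_seq_U[OF id_Cuntz] by simp
qed

lemma t_U: "i < N \<Longrightarrow> section_seq N (S_op N i) \<in> U"
  by (intro section_seq_U S_op_Cuntz)

lemma sum_U: "(\<And>i. i \<in> I \<Longrightarrow> f i \<in> U) \<Longrightarrow> (\<lambda>n. \<Sum>i\<in>I. f i n) \<in> U"
  by (induction I rule: infinite_finite_induct) (auto intro: U)

end

section \<open>Null sequences are sections\<close>

context finite_sections
begin

lemma t_P_op_t:
  assumes "i < N"
  shows "coord (blinfun_apply (radj (t i n) o\<^sub>L P_op e o\<^sub>L t i n) x) k =
    (if k * N + i < e \<and> k * N + i < N ^ n then coord x k else 0)"
proof -
  have "k \<le> k * N" using N2 by simp
  then have "k < N ^ n" if "k * N + i < N ^ n" using that by linarith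
  moreover have "(k * N + i) div N = k" "(k * N + i) mod N = i" using assms by simp_all
  ultimately show ?thesis
    using assms by (auto simp: section_seq_def radj_compose coord_P_op coord_radj_S_op coord_S_op)
qed

text \<open>The products project onto the parents of those indices below \<open>N ^ (n - m)\<close>
  that end in the given digit. For \<open>m \<ge> n\<close> only the index 0 is left: it is its own
  parent under digit 0, matching truncated subtraction, but has no digit 1.\<close>

lemma P_op_shift:
  "radj (t 0 n) o\<^sub>L P_op (N ^ (n - m)) o\<^sub>L t 0 n = P_op (N ^ (n - Suc m))"
  "radj (t 1 n) o\<^sub>L P_op (N ^ (n - m)) o\<^sub>L t 1 n = (if m < n then P_op (N ^ (n - Suc m)) else 0)"
proof -
  have 0: "N ^ (n - m) \<le> N ^ n" using N2 by (intro power_increasing) auto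
  have 1: "N ^ (n - m) = N ^ (n - Suc m) * N" if "m < n"
    using that by (metis Suc_diff_Suc mult.commute power_Suc)
  have 2: "k * N + i < a * N \<longleftrightarrow> k < a" if "i < N" for k i a
  proof
    assume "k < a"
    then have "Suc k * N \<le> a * N" by (intro mult_le_mono1) simp
    then show "k * N + i < a * N" using that by simp
  next
    assume "k * N + i < a * N"
    then have "k * N < a * N" by linarith
    then show "k < a" by simp
  qed
  have N: "0 < N" "1 < N" using N2 by auto
  have 3: "k * N < 1 \<longleftrightarrow> k < 1" for k using N by simp
  show "radj (t 0 n) o\<^sub>L P_op (N ^ (n - m)) o\<^sub>L t 0 n = P_op (N ^ (n - Suc m))"
  proof (rule blinfun_eqI, rule l2_eqI)
    fix x k
    have "k * N + 0 < N ^ (n - m) \<and> k * N + 0 < N ^ n \<longleftrightarrow> k < N ^ (n - Suc m)"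
    proof (cases "m < n")
      case True
      show ?thesis using 0 2[OF N(1), of k "N ^ (n - Suc m)"] unfolding 1[OF True] by linarith
    next
      case False
      then have "n - m = 0" "n - Suc m = 0" by auto
      moreover have "k * N < N ^ n" if "k = 0" using that N by simp
      ultimately show ?thesis using 3[of k] by auto
    qed
    then show "coord ((radj (t 0 n) o\<^sub>L P_op (N ^ (n - m)) o\<^sub>L t 0 n) x) k = coord (P_op (N ^ (n - Suc m)) x) k"
      unfolding t_P_op_t[OF N(1)] coord_P_op by presburger
  qed
  show "radj (t 1 n) o\<^sub>L P_op (N ^ (n - m)) o\<^sub>L t 1 n = (if m < n then P_op (N ^ (n - Suc m)) else 0)"
  proof (rule blinfun_eqI, rule l2_eqI)
    fix x k
    have "k * N + 1 < N ^ (n - m) \<and> k * N + 1 < N ^ n \<longleftrightarrow> m < n \<and> k < N ^ (n - Suc m)"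
    proof (cases "m < n")
      case True
      show ?thesis using 0 True 2[OF N(2), of k "N ^ (n - Suc m)"] unfolding 1[OF True] by linarith
    qed auto
    then show "coord ((radj (t 1 n) o\<^sub>L P_op (N ^ (n - m)) o\<^sub>L t 1 n) x) k
        = coord ((if m < n then P_op (N ^ (n - Suc m)) else 0) x) k"
      unfolding t_P_op_t[OF N(2)] by (auto simp: coord_P_op)
  qed
qed

lemma shift_U: "(\<lambda>n. P_op (N ^ (n - m))) \<in> U"
proof (induction m)
  case 0
  then show ?case using one_U by simp
next
  case (Suc m)
  have "(\<lambda>n. radj (t 0 n) o\<^sub>L P_op (N ^ (n - m)) o\<^sub>L t 0 n) \<in> U"
    using N2 by (intro U(4,6) t_U Suc.IH) auto
  then show ?case by (simp only: P_op_shift)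
qed

text \<open>The sections of \<open>S\<^sub>0\<close> and \<open>S\<^sub>1\<close> behave differently only on the first basis vector;
  comparing both isolates a single entry of a sequence.\<close>

lemma corner_U: "(\<lambda>n. if n = m then P_op 1 else 0) \<in> U"
proof -
  have D: "(\<lambda>n. if n \<le> m then P_op 1 else 0) \<in> U" for m
  proof -
    have "(\<lambda>n. P_op (N ^ (n - Suc m)) - (radj (t 1 n) o\<^sub>L P_op (N ^ (n - m)) o\<^sub>L t 1 n)) \<in> U"
      using N2 by (intro U(4,6,8) t_U shift_U) auto
    also have "(\<lambda>n. P_op (N ^ (n - Suc m)) - (radj (t 1 n) o\<^sub>L P_op (N ^ (n - m)) o\<^sub>L t 1 n))
        = (\<lambda>n. if n \<le> m then P_op 1 else 0)"
      unfolding P_op_shift by (auto simp: fun_eq_iff not_less)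
    finally show ?thesis .
  qed
  show ?thesis
  proof (cases m)
    case 0
    then show ?thesis using D[of 0] by simp
  next
    case (Suc l)
    have "(\<lambda>n. (if n \<le> m then P_op 1 else 0) - (if n \<le> l then P_op 1 else 0)) \<in> U"
      by (intro U(8) D)
    also have "(\<lambda>n. (if n \<le> m then P_op 1 else 0) - (if n \<le> l then P_op 1 else 0))
        = (\<lambda>n. if n = m then P_op 1 else 0 :: complex l2 \<Rightarrow>\<^sub>L complex l2)"
      using Suc by (auto simp: fun_eq_iff)
    finally show ?thesis .
  qed
qed

definition unit_seq where "unit_seq m k l n = (if n = m then iota k o\<^sub>L proj l else (0 :: complex l2 \<Rightarrow>\<^sub>L complex l2))"

text \<open>Induction along the tree: multiplying by the section of \<open>S_op N i\<close>, with
  \<open>i\<close> the last digit, carries the matrix unit of the parent \<open>k div N\<close> to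
  that of \<open>k\<close>.\<close>

lemma unit_seq_0_U: "k < N ^ m \<Longrightarrow> unit_seq m k 0 \<in> U"
proof (induction k rule: less_induct)
  case (less k)
  show ?case
  proof (cases "k = 0")
    case True
    have "unit_seq m 0 0 = (\<lambda>n. if n = m then P_op 1 else 0)"
      by (simp add: fun_eq_iff unit_seq_def P_op_1[symmetric] del: One_nat_def)
    then show ?thesis using True corner_U by simp
  next
    case False
    define i where "i = k mod N"
    have i: "i < N" using N2 by (simp add: i_def)
    have k: "k div N < k" "k div N < N ^ m" "k = k div N * N + i"
      using False N2 less.prems by (auto simp: i_def intro: le_less_trans[OF div_le_dividend])
    have "(\<lambda>n. t i n o\<^sub>L unit_seq m (k div N) 0 n) \<in> U"
      by (intro U(4) t_U less.IH i k)
    also have "(\<lambda>n. t i n o\<^sub>L unit_seq m (k div N) 0 n) = unit_seq m k 0"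
    proof (rule ext)
      fix n
      have "t i m o\<^sub>L (iota (k div N) o\<^sub>L proj 0) = iota k o\<^sub>L proj 0"
        using k less.prems i
        by (intro blinfun_eqI) (simp add: section_seq_def P_op_iota S_op_iota blinfun.zero_right del: div_mult_mod_eq)
      then show "t i n o\<^sub>L unit_seq m (k div N) 0 n = unit_seq m k 0 n"
        by (simp add: unit_seq_def)
    qed
    finally show ?thesis .
  qed
qed

lemma unit_seq_U: 
  assumes "k < N ^ m" "l < N ^ m"
  shows "unit_seq m k l \<in> U"
proof -
  have "(\<lambda>n. unit_seq m k 0 n o\<^sub>L radj (unit_seq m l 0 n)) \<in> U"
    using assms by (intro U(4,6) unit_seq_0_U)
  also have "(\<lambda>n. unit_seq m k 0 n o\<^sub>L radj (unit_seq m l 0 n)) = unit_seq m k l"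
  proof (rule ext)
    fix n
    have "(iota k o\<^sub>L proj 0) o\<^sub>L (iota 0 o\<^sub>L proj l) = iota k o\<^sub>L (proj l :: complex l2 \<Rightarrow>\<^sub>L complex)"
      by (intro blinfun_eqI) (simp add: proj.rep_eq coord_iota)
    then show "unit_seq m k 0 n o\<^sub>L radj (unit_seq m l 0 n) = unit_seq m k l n"
      by (simp add: unit_seq_def radj_compose radj_iota radj_proj)
  qed
  finally show ?thesis .
qed

lemma matrix_expansion:
  fixes X :: "complex l2 \<Rightarrow>\<^sub>L complex l2"
  assumes X: "clinear_op X" "P_op L o\<^sub>L X = X" "X o\<^sub>L P_op L = X"
  shows "X = (\<Sum>k<L. \<Sum>l<L. scaleC_op (coord (X (iota l 1)) k) o\<^sub>L (iota k o\<^sub>L proj l))"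
proof (rule blinfun_eqI, rule l2_eqI)
  fix x j
  have sc: "iota l c = scaleC c (iota l 1)" for l c
    by (rule l2_eqI) (simp add: coord_iota scaleC_complex_def)
  have "X x = X (P_op L x)" using X(3) by (metis blinfun_apply_blinfun_compose)
  also have "\<dots> = (\<Sum>l<L. scaleC (coord x l) (X (iota l 1)))"
    unfolding P_op_eq_sum blinfun.sum_right
    by (rule sum.cong[OF refl], subst sc) (simp add: clinear_opD[OF X(1)])
  finally have "coord (X x) j = (\<Sum>l<L. coord x l * coord (X (iota l 1)) j)"
    by (simp add: coord_sum scaleC_complex_def)
  moreover have "coord (X y) j = 0" if "\<not> j < L" for y
    using that X(2) coord_P_op[of L "X y" j] by (metis blinfun_apply_blinfun_compose)
  moreover have "coord ((\<Sum>k<L. \<Sum>l<L. scaleC_op (coord (X (iota l 1)) k) o\<^sub>L (iota k o\<^sub>L proj l)) x) j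
      = (\<Sum>k<L. if j = k then \<Sum>l<L. coord x l * coord (X (iota l 1)) j else 0)"
    unfolding blinfun_sum_apply coord_sum
    by (rule sum.cong[OF refl]) (auto simp: coord_iota proj.rep_eq scaleC_complex_def mult.commute)
  ultimately show "coord (X x) j
      = coord ((\<Sum>k<L. \<Sum>l<L. scaleC_op (coord (X (iota l 1)) k) o\<^sub>L (iota k o\<^sub>L proj l)) x) j"
    by (cases "j < L") auto
qed

lemma single_U:
  assumes A: "A \<in> carrier (F_alg N)"
  shows "(\<lambda>n. if n = m then A n else 0) \<in> U"
proof -
  let ?c = "\<lambda>k l. coord (A m (iota l 1)) k"
  have "(\<lambda>n. \<Sum>k<N ^ m. \<Sum>l<N ^ m. scaleC_op (?c k l) o\<^sub>L unit_seq m k l n) \<in> U"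
    by (intro sum_U U(5) unit_seq_U) auto
  also have "(\<lambda>n. \<Sum>k<N ^ m. \<Sum>l<N ^ m. scaleC_op (?c k l) o\<^sub>L unit_seq m k l n)
      = (\<lambda>n. if n = m then A n else 0)"
    using matrix_expansion[OF F_carrierD(1-3)[OF A, of m]] by (auto simp: fun_eq_iff unit_seq_def)
  finally show ?thesis .
qed

text \<open>Each single entry of a sequence can be realized, and the finite truncations of a null
  sequence approximate it in the supremum norm.\<close>

lemma G_ideal_U: "G_ideal N \<subseteq> U"
proof
  fix A assume "A \<in> G_ideal N"
  then have A: "A \<in> carrier (F_alg N)" "A \<longlonglongrightarrow> 0" by (auto simp: G_ideal_iff)
  define f where "f m n = (if n < m then A n else 0)" for m n :: nat
  have "f m \<in> U" for m
  proof (induction m)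
    case 0
    then show ?case using U(2) by (simp add: f_def)
  next
    case (Suc m)
    have "f (Suc m) = (\<lambda>n. f m n + (if n = m then A n else 0))"
      by (auto simp: f_def fun_eq_iff less_Suc_eq)
    then show ?case using U(3)[OF Suc single_U[OF A(1)]] by simp
  qed
  then show "A \<in> U"
  proof (rule U(9)[OF _ A(1)])
    fix e :: real assume "e > 0"
    then obtain M where M: "\<And>n. n \<ge> M \<Longrightarrow> norm (A n - 0) < e" using LIMSEQ_D[OF A(2)] by blast
    have "norm (f m n - A n) \<le> e" if "m \<ge> M" for m n
      using M[of n] that \<open>e > 0\<close> by (auto simp: f_def intro: less_imp_le)
    then show "\<exists>M. \<forall>m\<ge>M. \<forall>n. norm (f m n - A n) \<le> e" by blast
  qed
qed

end

section \<open>Normal forms in the Cuntz algebra\<close>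

text \<open>Words with all adjoints on the right: \<open>left\<close> adds only isometries,
  \<open>right\<close> only adjoints, and the order in which the rules are applied does not affect
  this form.\<close>

inductive_set monomials for N :: nat where
  id: "id_blinfun \<in> monomials N"
| left: "C \<in> monomials N \<Longrightarrow> i < N \<Longrightarrow> S_op N i o\<^sub>L C \<in> monomials N"
| right: "C \<in> monomials N \<Longrightarrow> i < N \<Longrightarrow> C o\<^sub>L radj (S_op N i) \<in> monomials N"

text \<open>The new adjoint meets either an isometry, where the product is 0 or the identity, or a
  word consisting of adjoints only, which it extends.\<close>

lemma monomials_radj_left:
  "C \<in> monomials N \<Longrightarrow> i < N \<Longrightarrow> radj (S_op N i) o\<^sub>L C \<in> insert 0 (monomials N)"
proof (induction rule: monomials.induct)
  case id
  then show ?case using monomials.right[OF monomials.id] by simp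
next
  case (left C j)
  then show ?case
    by (simp add: blinfun_compose_assoc[symmetric] radj_S_op_S_op)
next
  case (right C j)
  then have "(radj (S_op N i) o\<^sub>L C) o\<^sub>L radj (S_op N j) \<in> insert 0 (monomials N)"
    using monomials.right by auto
  then show ?case by (simp only: blinfun_compose_assoc)
qed

lemma clinear_op_monomials: "C \<in> monomials N \<Longrightarrow> clinear_op C"
  by (induction rule: monomials.induct)
    (auto intro: clinear_op_compose clinear_op_radj clinear_S_op)

text \<open>The closed complex span; \<open>span\<close> is real, so all complex multiples are put
  among the generators.\<close>

definition monomial_span :: "nat \<Rightarrow> (complex l2 \<Rightarrow>\<^sub>L complex l2) set"
  where "monomial_span N = closure (span {scaleC_op c o\<^sub>L C | c C. C \<in> monomials N})"

lemma bounded_linear_compose_left: "bounded_linear (\<lambda>C. A o\<^sub>L C)"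
  and bounded_linear_compose_right: "bounded_linear (\<lambda>C. C o\<^sub>L A)"
  using bounded_bilinear.bounded_linear_right[OF bounded_bilinear_blinfun_compose]
    bounded_bilinear.bounded_linear_left[OF bounded_bilinear_blinfun_compose] by auto

lemma closure_span_image:
  assumes f: "bounded_linear f" and X: "\<And>x. x \<in> X \<Longrightarrow> f x \<in> span X" and x: "x \<in> closure (span X)"
  shows "f x \<in> closure (span X)"
proof -
  have "f ` span X = span (f ` X)"
    by (rule linear_span_image[symmetric]) (rule bounded_linear.linear[OF f])
  also have "\<dots> \<subseteq> span X" using X by (intro span_minimal) auto
  finally have "f ` closure (span X) \<subseteq> closure (span X)"
    by (intro image_closure_subset closed_closure linear_continuous_on[OF f])
      (auto intro: subsetD[OF closure_subset])
  then show ?thesis using x by blast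
qed

lemma monomial_span_left:
  assumes A: "clinear_op A" and AC: "\<And>C. C \<in> monomials N \<Longrightarrow> A o\<^sub>L C \<in> insert 0 (monomials N)"
    and C: "C \<in> monomial_span N"
  shows "A o\<^sub>L C \<in> monomial_span N"
  unfolding monomial_span_def
proof (rule closure_span_image[OF bounded_linear_compose_left _ C[unfolded monomial_span_def]])
  fix x assume "x \<in> {scaleC_op c o\<^sub>L C | c C. C \<in> monomials N}"
  then obtain c D where D: "D \<in> monomials N" "x = scaleC_op c o\<^sub>L D" by blast
  have "A o\<^sub>L x = scaleC_op c o\<^sub>L (A o\<^sub>L D)"
    using A by (intro blinfun_eqI) (simp add: D clinear_opD)
  then show "A o\<^sub>L x \<in> span {scaleC_op c o\<^sub>L C | c C. C \<in> monomials N}"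
    using AC[OF D(1)] by (auto intro: span_base span_zero)
qed

lemma monomial_span_scale:
  assumes C: "C \<in> monomial_span N"
  shows "scaleC_op c o\<^sub>L C \<in> monomial_span N"
  unfolding monomial_span_def
proof (rule closure_span_image[OF bounded_linear_compose_left _ C[unfolded monomial_span_def]])
  fix x assume "x \<in> {scaleC_op c o\<^sub>L C | c C. C \<in> monomials N}"
  then obtain d D where D: "D \<in> monomials N" "x = scaleC_op d o\<^sub>L D" by blast
  have "scaleC_op c o\<^sub>L x = scaleC_op (c * d) o\<^sub>L D"
    by (intro blinfun_eqI) (simp add: D scaleC_scaleC)
  then show "scaleC_op c o\<^sub>L x \<in> span {scaleC_op c o\<^sub>L C | c C. C \<in> monomials N}"
    using D(1) by (auto intro: span_base)
qed

lemma monomials_subset_span: "C \<in> monomials N \<Longrightarrow> C \<in> monomial_span N"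
proof -
  assume "C \<in> monomials N"
  moreover have "C = scaleC_op 1 o\<^sub>L C" by (rule blinfun_eqI) simp
  ultimately have "C \<in> span {scaleC_op c o\<^sub>L C | c C. C \<in> monomials N}"
    by (intro span_base) blast
  then show ?thesis unfolding monomial_span_def using closure_subset by blast
qed

lemma subspace_closure:
  fixes S :: "'a::real_normed_vector set"
  assumes S: "subspace S"
  shows "subspace (closure S)"
  unfolding subspace_def
proof (intro conjI ballI allI)
  show "0 \<in> closure S" using subspace_0[OF S] closure_subset by blast
  fix x assume "x \<in> closure S"
  then obtain f where f: "\<And>n. f n \<in> S" "f \<longlonglongrightarrow> x" by (auto simp: closure_sequential)
  {
    fix y assume "y \<in> closure S"
    then obtain g where g: "\<And>n. g n \<in> S" "g \<longlonglongrightarrow> y" by (auto simp: closure_sequential)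
    show "x + y \<in> closure S"
      unfolding closure_sequential
      by (intro exI[of _ "\<lambda>n. f n + g n"] conjI allI tendsto_add f g subspace_add[OF S])
  }
  show "c *\<^sub>R x \<in> closure S" for c
    unfolding closure_sequential
    by (intro exI[of _ "\<lambda>n. c *\<^sub>R f n"] conjI allI tendsto_scaleR tendsto_const f subspace_scale[OF S])
qed

lemma subspace_monomial_span: "subspace (monomial_span N)" and closed_monomial_span: "closed (monomial_span N)"
  unfolding monomial_span_def by (auto intro: subspace_closure subspace_span)

text \<open>Left multiplication by \<open>S\<^sub>i\<close> and \<open>S\<^sub>i\<^sup>*\<close> preserves the closed span of the monomials, hence so
  does left multiplication by the whole Cuntz algebra; apply this to the identity. No products of
  monomials need to be computed.\<close>

lemma (in finite_sections) Cuntz_monomial_span: "Cuntz N \<subseteq> monomial_span N"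
proof -
  let ?M = "monomial_span N"
  \<comment> \<open>The condition on \<open>radj A\<close> makes \<open>B\<close> closed under
    adjoints, so that it contains the generated C*-algebra.\<close>
  define B where "B = {A. clinear_op A \<and> (\<forall>C\<in>?M. A o\<^sub>L C \<in> ?M \<and> radj A o\<^sub>L C \<in> ?M)}"
  have lim: "x o\<^sub>L C \<in> ?M" if "\<And>n::nat. f n o\<^sub>L C \<in> ?M" "f \<longlonglongrightarrow> x"
    for f and x C :: "complex l2 \<Rightarrow>\<^sub>L complex l2"
    by (rule closed_sequentially[OF closed_monomial_span that(1)])
      (rule bounded_linear.tendsto[OF bounded_linear_compose_right that(2)])
  have "closed_subalgebra bounded_ops B"
  proof (rule closed_subalgebra_opsI)
    fix x y c assume xy: "x \<in> B" "y \<in> B"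
    show "x + y \<in> B"
      using xy by (auto simp: B_def clinear_op_add radj_add blinfun_compose_distrib
          intro: subspace_add[OF subspace_monomial_span])
    show "x o\<^sub>L y \<in> B"
      using xy by (auto simp: B_def clinear_op_compose radj_compose blinfun_compose_assoc)
    show "scaleC_op c o\<^sub>L x \<in> B"
      using xy by (auto simp: B_def clinear_op_compose radj_scaleC_compose blinfun_compose_assoc monomial_span_scale)
  next
    fix f x assume f: "\<And>n::nat. f n \<in> B" "f \<longlonglongrightarrow> x" "clinear_op x"
    show "x \<in> B" using f tendsto_radj[OF f(2)] lim[of f _ x] lim[of "\<lambda>n. radj (f n)" _ "radj x"] by (auto simp: B_def)
  qed (auto simp: B_def subspace_0[OF subspace_monomial_span])
  then have "c_star_subalgebra bounded_ops B"
    by (rule c_star_subalgebra_opsI) (auto simp: B_def radj_radj clinear_op_radj)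
  moreover have "S_op N i \<in> B" if "i < N" for i
    using that monomials_radj_left[of _ N i] monomials.left[of _ N i]
    by (simp add: B_def monomial_span_left clinear_op_radj)
  then have "S_op N ` {..<N} \<subseteq> B" by blast
  ultimately have "Cuntz N \<subseteq> B"
    unfolding Cuntz_def by (rule c_star_subalgebra_gen(3))
  moreover have "A \<in> ?M" if "A \<in> B" for A
    using that monomials_subset_span[OF monomials.id] unfolding B_def
    by (metis (no_types, lifting) blinfun_compose_simps(2) mem_Collect_eq)
  ultimately show ?thesis by blast
qed

section \<open>Sections are compressions up to null sequences\<close>

context finite_sections
begin

definition TT where "TT = carrier (T_alg N)"

lemma closed_subalgebra_TT: "closed_subalgebra bounded_ops TT"
  and Sigma_op_TT: "i < N \<Longrightarrow> Sigma_op N i \<in> TT"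
  and radj_Sigma_op_TT: "i < N \<Longrightarrow> radj (Sigma_op N i) \<in> TT"
  and TT_least: "closed_subalgebra bounded_ops B \<Longrightarrow>
    (\<And>i. i < N \<Longrightarrow> Sigma_op N i \<in> B \<and> radj (Sigma_op N i) \<in> B) \<Longrightarrow> TT \<subseteq> B"
proof -
  have TT: "TT = closed_subalgebra_gen bounded_ops
      (Sigma_op N ` {..<N} \<union> (\<lambda>i. radj (Sigma_op N i)) ` {..<N})"
    by (simp add: TT_def T_alg_def adj_op_eq_radj)
  note gen = closed_subalgebra_gen[OF closed_subalgebra_Collect_clinear,
      of "Sigma_op N ` {..<N} \<union> (\<lambda>i. radj (Sigma_op N i)) ` {..<N}", folded TT]
  have sub: "Sigma_op N ` {..<N} \<union> (\<lambda>i. radj (Sigma_op N i)) ` {..<N} \<subseteq> Collect clinear_op"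
    by (auto intro: clinear_op_radj clinear_Sigma_op)
  show "closed_subalgebra bounded_ops TT" by (rule gen(1)[OF sub])
  show "i < N \<Longrightarrow> Sigma_op N i \<in> TT" "i < N \<Longrightarrow> radj (Sigma_op N i) \<in> TT"
    using gen(2)[OF sub] by auto
  show "TT \<subseteq> B" if "closed_subalgebra bounded_ops B"
    "\<And>i. i < N \<Longrightarrow> Sigma_op N i \<in> B \<and> radj (Sigma_op N i) \<in> B"
    unfolding TT using that by (intro closed_subalgebra_gen(3)) auto
qed

lemmas TT = closed_subalgebra_opsD[OF closed_subalgebra_TT]

text \<open>The generating set is closed under adjoints, and \<open>radj\<close> is continuous,
  additive and reverses products.\<close>

lemma radj_TT: "x \<in> TT \<Longrightarrow> radj x \<in> TT"
proof -
  have "closed_subalgebra bounded_ops {x \<in> TT. radj x \<in> TT}"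
  proof (rule closed_subalgebra_opsI)
    fix x y c assume xy: "x \<in> {x \<in> TT. radj x \<in> TT}" "y \<in> {x \<in> TT. radj x \<in> TT}"
    then show "x + y \<in> {x \<in> TT. radj x \<in> TT}" "x o\<^sub>L y \<in> {x \<in> TT. radj x \<in> TT}"
      by (auto simp: radj_add radj_compose TT)
    show "scaleC_op c o\<^sub>L x \<in> {x \<in> TT. radj x \<in> TT}"
      using xy by (auto simp: radj_scaleC_compose TT)
  next
    fix f x assume f: "\<And>n::nat. f n \<in> {x \<in> TT. radj x \<in> TT}" "f \<longlonglongrightarrow> x"
    then show "x \<in> {x \<in> TT. radj x \<in> TT}"
      using TT(8)[of f x] TT(8)[OF _ tendsto_radj[OF f(2)]] by auto
  qed (simp_all add: TT)
  then have "TT \<subseteq> {x \<in> TT. radj x \<in> TT}"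
    by (rule TT_least) (auto simp: radj_radj Sigma_op_TT radj_Sigma_op_TT)
  then show "x \<in> TT \<Longrightarrow> radj x \<in> TT" by blast
qed

lemma id_TT: "id_blinfun \<in> TT"
proof -
  have "(\<Sum>i\<in>I. Sigma_op N i o\<^sub>L radj (Sigma_op N i)) \<in> TT" if "I \<subseteq> {..<N}" for I
    using finite_subset[OF that finite_lessThan] that
    by (induction rule: finite_induct) (auto intro!: TT(2-4) Sigma_op_TT radj_Sigma_op_TT)
  from this[OF order_refl] show ?thesis using N2 by (simp add: sum_Sigma_op)
qed

lemma c_star_algebra_T_alg: "c_star_algebra (T_alg N)"
proof -
  have "T_alg N = bounded_ops\<lparr>carrier := TT\<rparr>" by (simp add: TT_def T_alg_def)
  then show ?thesis
    using c_star_algebra_ops[OF closed_subalgebra_TT id_TT radj_TT] by simp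
qed

lemma reflect_index: "i < N \<Longrightarrow> N - 1 - i < N \<and> N - 1 - (N - 1 - i) = i"
  using N2 by auto

lemma good_TT: "T \<in> TT \<Longrightarrow> good T"
proof -
  have "TT \<subseteq> Collect good"
  proof (rule TT_least[OF closed_subalgebra_good])
    fix i assume "i < N"
    then show "Sigma_op N i \<in> Collect good \<and> radj (Sigma_op N i) \<in> Collect good"
      using good_Sigma_op[of "N - 1 - i"] reflect_index[of i] by simp
  qed
  then show "T \<in> TT \<Longrightarrow> good T" by blast
qed

lemma Gam_mult_TT:
  assumes "A \<in> TT" "B \<in> TT"
  shows "(\<lambda>n. Gam (A o\<^sub>L B) n - (Gam A n o\<^sub>L Gam B n)) \<longlonglongrightarrow> 0"
  using good_mult(2)[of A B] good_TT[OF assms(1)] good_TT[OF assms(2)] by (simp add: good_def)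

lemma Gam_F: "clinear_op T \<Longrightarrow> Gam T \<in> carrier (F_alg N)"
proof (rule F_carrierI[where C = "norm T"])
  fix n assume T: "clinear_op T"
  show "clinear_op (Gam T n)"
    using T by (simp add: Gam_def clinear_op_compose clinear_op_radj)
  have JP: "J n o\<^sub>L Pn n = J n" using J_op_P_op[of N n] N2 by simp
  show "Pn n o\<^sub>L Gam T n = Gam T n"
    by (simp add: Gam_def blinfun_compose_assoc[symmetric] Pn_radj_J)
  show "Gam T n o\<^sub>L Pn n = Gam T n"
    by (simp add: Gam_def blinfun_compose_assoc JP)
qed (rule norm_Gam_le)

text \<open>Membership of the whole section algebra in \<open>lifts\<close> is exactly what the
  surjectivity of \<open>Psi\<close> requires.\<close>

definition lifts where "lifts = {A \<in> carrier (F_alg N). \<exists>T\<in>TT. (\<lambda>n. A n - Gam T n) \<longlonglongrightarrow> 0}"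

lemma liftsI: "A \<in> carrier (F_alg N) \<Longrightarrow> T \<in> TT \<Longrightarrow> (\<lambda>n. A n - Gam T n) \<longlonglongrightarrow> 0 \<Longrightarrow> A \<in> lifts"
  unfolding lifts_def by blast

text \<open>The operator attached to a sequence depends contractively on it, so a Cauchy family of
  sequences has a Cauchy family of operators. This gives closedness of \<open>lifts\<close>.\<close>

lemma norm_diff_TT_le:
  assumes "(\<lambda>n. A n - Gam S n) \<longlonglongrightarrow> 0" "(\<lambda>n. A' n - Gam T n) \<longlonglongrightarrow> 0"
    "\<And>n. norm (A n - A' n) \<le> C"
  shows "norm (S - T) \<le> C"
proof (rule norm_le_Gam)
  show "(\<lambda>n. (A n - Gam S n) - (A' n - Gam T n)) \<longlonglongrightarrow> 0"
    using tendsto_diff[OF assms(1,2)] by simp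
  show "norm (Gam (S - T) n + ((A n - Gam S n) - (A' n - Gam T n))) \<le> C" for n
    using assms(3)[of n] by (simp add: Gam_simps)
qed

lemma c_star_subalgebra_lifts: "c_star_subalgebra (F_alg N) lifts"
proof (rule c_star_subalgebra_FI)
  show "lifts \<subseteq> carrier (F_alg N)" by (auto simp: lifts_def)
  show "(\<lambda>n. 0) \<in> lifts"
    by (rule liftsI[OF zero_F_carrier TT(2)]) (simp add: Gam_simps)
next
  fix x y c assume "x \<in> lifts" "y \<in> lifts"
  then obtain S T where x: "x \<in> carrier (F_alg N)" "S \<in> TT" "(\<lambda>n. x n - Gam S n) \<longlonglongrightarrow> 0"
    and y: "y \<in> carrier (F_alg N)" "T \<in> TT" "(\<lambda>n. y n - Gam T n) \<longlonglongrightarrow> 0"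
    by (auto simp: lifts_def)
  show "(\<lambda>n. x n + y n) \<in> lifts"
  proof (rule liftsI[OF F_carrier_closed(1)[OF x(1) y(1)] TT(3)[OF x(2) y(2)]])
    show "(\<lambda>n. x n + y n - Gam (S + T) n) \<longlonglongrightarrow> 0"
      using tendsto_add[OF x(3) y(3)] by (simp add: Gam_simps algebra_simps)
  qed
  show "(\<lambda>n. x n o\<^sub>L y n) \<in> lifts"
  proof (rule liftsI[OF F_carrier_closed(2)[OF x(1) y(1)] TT(4)[OF x(2) y(2)]])
    obtain C where C: "\<And>n. norm (x n) \<le> C" using F_carrierD(4)[OF x(1)] by blast
    have 1: "(\<lambda>n. x n o\<^sub>L (y n - Gam T n)) \<longlonglongrightarrow> 0"
      by (rule tendsto_compose_0'[OF y(3), where l = 0]) (rule C)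
    have 2: "(\<lambda>n. (x n - Gam S n) o\<^sub>L Gam T n) \<longlonglongrightarrow> 0"
      by (rule tendsto_compose_0[OF x(3), where l = 0]) (rule norm_Gam_le)
    have "(\<lambda>n. (x n o\<^sub>L (y n - Gam T n)) + ((x n - Gam S n) o\<^sub>L Gam T n)
        - (Gam (S o\<^sub>L T) n - (Gam S n o\<^sub>L Gam T n))) \<longlonglongrightarrow> 0 + 0 - 0"
      by (intro tendsto_diff tendsto_add 1 2 Gam_mult_TT x y)
    then show "(\<lambda>n. (x n o\<^sub>L y n) - Gam (S o\<^sub>L T) n) \<longlonglongrightarrow> 0"
      by (simp add: blinfun_compose_distrib)
  qed
  show "(\<lambda>n. scaleC_op c o\<^sub>L x n) \<in> lifts"
  proof (rule liftsI[OF F_carrier_closed(5)[OF x(1) x(1)] TT(5)[OF x(2)]])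
    have "(\<lambda>n. scaleC_op c o\<^sub>L (x n - Gam S n)) \<longlonglongrightarrow> 0"
      by (rule tendsto_compose_0'[OF x(3), where l = 0]) (rule order_refl)
    then show "(\<lambda>n. (scaleC_op c o\<^sub>L x n) - Gam (scaleC_op c o\<^sub>L S) n) \<longlonglongrightarrow> 0"
      using TT(1)[OF x(2)] by (simp add: Gam_simps blinfun_compose_distrib)
  qed
  show "(\<lambda>n. radj (x n)) \<in> lifts"
  proof (rule liftsI[OF F_carrier_closed(6)[OF x(1) x(1)] radj_TT[OF x(2)]])
    have "norm (radj (x n) - Gam (radj S) n) = norm (x n - Gam S n)" for n
      by (simp add: Gam_simps(5)[symmetric] radj_diff[symmetric] norm_radj)
    then show "(\<lambda>n. radj (x n) - Gam (radj S) n) \<longlonglongrightarrow> 0"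
      using x(3) by (intro tendsto_norm_0_le[OF _ tendsto_norm_zero[OF x(3)]]) simp
  qed
next
  fix f :: "nat \<Rightarrow> nat \<Rightarrow> (complex l2 \<Rightarrow>\<^sub>L complex l2)" and x
  assume f: "\<And>m. f m \<in> lifts" and x: "x \<in> carrier (F_alg N)"
    and lim: "\<And>e. e > 0 \<Longrightarrow> \<exists>M. \<forall>m\<ge>M. \<forall>n. norm (f m n - x n) \<le> e"
  have "\<forall>m. \<exists>T\<in>TT. (\<lambda>n. f m n - Gam T n) \<longlonglongrightarrow> 0" using f by (auto simp: lifts_def)
  then obtain T where T: "\<And>m. T m \<in> TT" "\<And>m. (\<lambda>n. f m n - Gam (T m) n) \<longlonglongrightarrow> 0" by metis
  have "Cauchy T"
  proof (rule CauchyI)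
    fix e :: real assume "e > 0"
    then obtain M where M: "\<And>m n. m \<ge> M \<Longrightarrow> norm (f m n - x n) \<le> e / 3"
      using lim[of "e / 3"] by auto
    have "norm (T m - T k) < e" if "m \<ge> M" "k \<ge> M" for m k
    proof -
      have "norm (f m n - f k n) \<le> e / 3 + e / 3" for n
        using M[OF that(1), of n] M[OF that(2), of n] norm_triangle_ineq4[of "f m n - x n" "f k n - x n"]
        by simp
      then have "norm (T m - T k) \<le> e / 3 + e / 3" by (rule norm_diff_TT_le[OF T(2) T(2)])
      then show ?thesis using \<open>e > 0\<close> by linarith
    qed
    then show "\<exists>M. \<forall>m\<ge>M. \<forall>n\<ge>M. norm (T m - T n) < e" by blast
  qed
  then obtain S where S: "T \<longlonglongrightarrow> S" by (metis Cauchy_convergent convergent_def)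
  have "(\<lambda>n. x n - Gam S n) \<longlonglongrightarrow> 0"
  proof (rule LIMSEQ_I)
    fix e :: real assume "e > 0"
    then obtain M where M: "\<And>m n. m \<ge> M \<Longrightarrow> norm (f m n - x n) \<le> e / 4"
      using lim[of "e / 4"] by auto
    obtain K where K: "\<And>m. m \<ge> K \<Longrightarrow> norm (T m - S) < e / 4"
      using LIMSEQ_D[OF S, of "e / 4"] \<open>e > 0\<close> by auto
    define m where "m = max M K"
    obtain L where L: "\<And>n. n \<ge> L \<Longrightarrow> norm (f m n - Gam (T m) n - 0) < e / 4"
      using LIMSEQ_D[OF T(2)[of m], of "e / 4"] \<open>e > 0\<close> by auto
    have "norm (x n - Gam S n - 0) < e" if "n \<ge> L" for n
    proof -
      have "x n - Gam S n = (f m n - Gam (T m) n) - (f m n - x n) + Gam (T m - S) n"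
        by (simp add: Gam_simps)
      then have "norm (x n - Gam S n) \<le> norm (f m n - Gam (T m) n) + norm (f m n - x n) + norm (Gam (T m - S) n)"
        by (simp only:) (rule order_trans[OF norm_triangle_ineq add_right_mono[OF norm_triangle_ineq4]])
      moreover have "norm (Gam (T m - S) n) \<le> norm (T m - S)" by (rule norm_Gam_le)
      moreover have "norm (f m n - x n) \<le> e / 4" "norm (T m - S) < e / 4"
        using M[of m n] K[of m] by (simp_all add: m_def)
      moreover have "norm (f m n - Gam (T m) n) < e / 4" using L[OF that] by simp
      ultimately have "norm (x n - Gam S n) < e" using \<open>e > 0\<close> by linarith
      then show ?thesis by simp
    qed
    then show "\<exists>L. \<forall>n\<ge>L. norm (x n - Gam S n - 0) < e" by blast
  qed
  then show "x \<in> lifts" using x TT(8)[OF T(1) S] by (intro liftsI)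
qed

lemmas lifts = c_star_subalgebra_FD[OF c_star_subalgebra_lifts]

section \<open>Sections of elements of the Cuntz algebra as compressions\<close>

lemma lifts_eventually:
  assumes "A \<in> lifts" "A' \<in> carrier (F_alg N)" "\<And>n. n \<ge> 1 \<Longrightarrow> A' n = A n"
  shows "A' \<in> lifts"
proof -
  obtain T where T: "T \<in> TT" "(\<lambda>n. A n - Gam T n) \<longlonglongrightarrow> 0" using assms(1) by (auto simp: lifts_def)
  have "(\<lambda>n. A' n - Gam T n) \<longlonglongrightarrow> 0"
    using T(2) by (rule Lim_transform_eventually[OF _ eventually_sequentiallyI[of 1]]) (simp add: assms(3))
  then show ?thesis using assms(2) T(1) by (intro liftsI)
qed

lemma t_lifts: "i < N \<Longrightarrow> section_seq N (S_op N i) \<in> lifts"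
proof (rule liftsI[OF section_seq_F[OF clinear_S_op], of "Sigma_op N (N - 1 - i)"])
  assume i: "i < N"
  show "Sigma_op N (N - 1 - i) \<in> TT" using i by (intro Sigma_op_TT) auto
  show "(\<lambda>n. t i n - Gam (Sigma_op N (N - 1 - i)) n) \<longlonglongrightarrow> 0"
    using tendsto_minus[OF good_Sigma_op(2)[OF i]] by simp
qed

lemma Gam_id: "n \<ge> 2 \<Longrightarrow> Gam id_blinfun n = Pn n"
  using N2 by (simp add: Gam_def radj_J_op_J_op)

text \<open>The outermost factor splits off exactly, because \<open>Pn n o\<^sub>L S_op N i\<close>
  is already the finite section. In the opposite order this fails: \<open>S_op N i\<close> is an
  isometry, but its section times the adjoint on the left is only the projection of rank
  \<open>N ^ (n - 1)\<close>. Hence the normal form with adjoints on the right.\<close>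

lemma section_monomials_lifts: "C \<in> monomials N \<Longrightarrow> section_seq N C \<in> lifts"
proof (induction rule: monomials.induct)
  case id
  have "section_seq N id_blinfun = Pn" by (simp add: section_seq_def fun_eq_iff)
  moreover have "Pn \<in> lifts"
  proof (rule liftsI[OF one_F_carrier id_TT])
    show "(\<lambda>n. Pn n - Gam id_blinfun n) \<longlonglongrightarrow> 0"
      by (rule tendsto_eventually, rule eventually_sequentiallyI[of 2]) (simp add: Gam_id)
  qed
  ultimately show ?case by simp
next
  case (left C i)
  show ?case
  proof (rule lifts_eventually[OF lifts(4)[OF t_lifts[OF left.hyps(2)] left.IH]])
    show "section_seq N (S_op N i o\<^sub>L C) \<in> carrier (F_alg N)"
      by (intro section_seq_F clinear_op_compose clinear_S_op clinear_op_monomials[OF left.hyps(1)])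
    fix n :: nat assume "n \<ge> 1"
    then have t: "t i n = Pn n o\<^sub>L S_op N i" by (simp add: t_eq(2) left.hyps(2))
    have "section_seq N (S_op N i o\<^sub>L C) n = t i n o\<^sub>L (C o\<^sub>L Pn n)"
      unfolding t by (simp add: section_seq_def blinfun_compose_assoc)
    also have "\<dots> = (t i n o\<^sub>L Pn n) o\<^sub>L (C o\<^sub>L Pn n)" by simp
    also have "\<dots> = t i n o\<^sub>L section_seq N C n"
      by (simp only: section_seq_def[of N C] blinfun_compose_assoc)
    finally show "section_seq N (S_op N i o\<^sub>L C) n = t i n o\<^sub>L section_seq N C n" .
  qed
next
  case (right C i)
  show ?case
  proof (rule lifts_eventually[OF lifts(4)[OF right.IH lifts(6)[OF t_lifts[OF right.hyps(2)]]]])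
    show "section_seq N (C o\<^sub>L radj (S_op N i)) \<in> carrier (F_alg N)"
      by (intro section_seq_F clinear_op_compose clinear_op_radj clinear_S_op clinear_op_monomials[OF right.hyps(1)])
    fix n :: nat assume "n \<ge> 1"
    then have t: "radj (t i n) = radj (S_op N i) o\<^sub>L Pn n"
      by (simp add: t_eq(2)[OF right.hyps(2)] radj_compose)
    have "section_seq N (C o\<^sub>L radj (S_op N i)) n = (Pn n o\<^sub>L C) o\<^sub>L radj (t i n)"
      unfolding t by (simp add: section_seq_def blinfun_compose_assoc)
    also have "\<dots> = (Pn n o\<^sub>L C) o\<^sub>L (Pn n o\<^sub>L radj (t i n))" by simp
    also have "\<dots> = section_seq N C n o\<^sub>L radj (t i n)"
      by (simp only: section_seq_def[of N C] blinfun_compose_assoc)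
    finally show "section_seq N (C o\<^sub>L radj (S_op N i)) n = section_seq N C n o\<^sub>L radj (t i n)" .
  qed
qed

lemma bounded_linear_section: "bounded_linear (\<lambda>C. section_seq N C n)"
  unfolding section_seq_def
  by (rule bounded_linear_compose[OF bounded_linear_compose_right bounded_linear_compose_left])

text \<open>\<open>section_seq\<close> is linear and contractive but not multiplicative, so the
  operators whose sections lift form merely a closed subspace. The monomials supply a set with dense
  span.\<close>

lemma section_Cuntz_lifts:
  assumes "A \<in> Cuntz N"
  shows "section_seq N A \<in> lifts"
proof -
  define X where "X = {scaleC_op c o\<^sub>L C | c C. C \<in> monomials N}"
  define V where "V = {C. clinear_op C \<and> section_seq N C \<in> lifts}"
  note lin = bounded_linear.linear[OF bounded_linear_section]
  have scaleR: "r *\<^sub>R C = scaleC_op (of_real r) o\<^sub>L C" for r and C :: "complex l2 \<Rightarrow>\<^sub>L complex l2"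
    by (rule blinfun_eqI) (simp add: scaleC_of_real blinfun.scaleR_left)
  have sc: "section_seq N (scaleC_op c o\<^sub>L C) = (\<lambda>n. scaleC_op c o\<^sub>L section_seq N C n)" for c C
    by (intro ext blinfun_eqI) (simp add: section_seq_def clinear_opD[OF clinear_P_op])
  have scV: "scaleC_op c o\<^sub>L C \<in> V" if "C \<in> V" for c C
    using that by (auto simp: V_def sc lifts(5) clinear_op_compose)
  have "subspace V"
    unfolding subspace_def
  proof (intro conjI ballI allI)
    have "section_seq N 0 = (\<lambda>n. 0)" by (simp add: section_seq_def)
    then show "0 \<in> V" by (simp add: V_def lifts(2))
    show "x + y \<in> V" if "x \<in> V" "y \<in> V" for x y
    proof -
      have "section_seq N (x + y) = (\<lambda>n. section_seq N x n + section_seq N y n)"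
        by (simp add: section_seq_def blinfun_compose_distrib)
      then show ?thesis using that by (simp add: V_def lifts(3) clinear_op_add)
    qed
    show "c *\<^sub>R x \<in> V" if "x \<in> V" for c x
      unfolding scaleR using that by (rule scV)
  qed
  moreover have "closed V"
    unfolding closed_sequential_limits
  proof (intro allI impI, elim conjE)
    fix f x assume f: "\<forall>n. f n \<in> V" "f \<longlonglongrightarrow> x"
    have x: "clinear_op x" using f by (auto simp: V_def intro: clinear_op_LIMSEQ)
    have "section_seq N x \<in> lifts"
    proof (rule lifts(9)[of "\<lambda>m. section_seq N (f m)"])
      fix e :: real assume "e > 0"
      then obtain M where M: "\<And>m. m \<ge> M \<Longrightarrow> norm (f m - x) < e" using LIMSEQ_D[OF f(2)] by blast
      have "norm (section_seq N (f m) n - section_seq N x n) \<le> e" if "m \<ge> M" for m n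
        using M[OF that] norm_section_le[of N "f m - x" n] by (simp add: linear_diff[OF lin])
      then show "\<exists>M. \<forall>m\<ge>M. \<forall>n. norm (section_seq N (f m) n - section_seq N x n) \<le> e" by blast
    qed (use f x in \<open>auto simp: V_def section_seq_F\<close>)
    then show "x \<in> V" using x by (simp add: V_def)
  qed
  moreover have "X \<subseteq> V"
    by (auto simp: X_def intro!: scV) (simp add: V_def section_monomials_lifts clinear_op_monomials)
  ultimately have "closure (span X) \<subseteq> V" by (intro closure_minimal span_minimal)
  then show ?thesis
    using Cuntz_monomial_span assms by (auto simp: monomial_span_def X_def V_def)
qed

lemma U_subset_lifts: "U \<subseteq> lifts"
  by (rule U_least[OF c_star_subalgebra_lifts section_Cuntz_lifts])

lemma null_U: "A \<in> carrier (F_alg N) \<Longrightarrow> A \<longlonglongrightarrow> 0 \<Longrightarrow> A \<in> U"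
  using G_ideal_U by (auto simp: G_ideal_iff)

lemma U_approx:
  assumes "A \<in> U" "A' \<in> carrier (F_alg N)" "(\<lambda>n. A' n - A n) \<longlonglongrightarrow> 0"
  shows "A' \<in> U"
proof -
  have "A \<in> carrier (F_alg N)" using assms(1) U(1) by blast
  then have "(\<lambda>n. A' n - A n) \<in> U" using assms(2,3) by (intro null_U F_carrier_closed)
  then have "(\<lambda>n. (A' n - A n) + A n) \<in> U" using assms(1) by (intro U(3))
  then show ?thesis by simp
qed

text \<open>\<open>Gam\<close> is multiplicative only up to null sequences, and \<open>Gam\<close>
  of a generator is a section only up to a null sequence. Both differences are absorbed because null
  sequences belong to \<open>U\<close>.\<close>

lemma Gam_U: "T \<in> TT \<Longrightarrow> Gam T \<in> U"
proof -
  have "closed_subalgebra bounded_ops {T \<in> TT. Gam T \<in> U}"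
  proof (rule closed_subalgebra_opsI)
    fix x y c assume xy: "x \<in> {T \<in> TT. Gam T \<in> U}" "y \<in> {T \<in> TT. Gam T \<in> U}"
    have "Gam (x + y) = (\<lambda>n. Gam x n + Gam y n)" "Gam (scaleC_op c o\<^sub>L x) = (\<lambda>n. scaleC_op c o\<^sub>L Gam x n)"
      using xy TT(1) by (auto simp: Gam_simps)
    then show "x + y \<in> {T \<in> TT. Gam T \<in> U}" "scaleC_op c o\<^sub>L x \<in> {T \<in> TT. Gam T \<in> U}"
      using xy by (auto simp: TT U)
    have xyT: "x o\<^sub>L y \<in> TT" using xy by (auto intro: TT(4))
    have "Gam (x o\<^sub>L y) \<in> U"
      by (rule U_approx[OF _ Gam_F[OF TT(1)[OF xyT]] Gam_mult_TT]) (use xy in \<open>auto intro: U(4)\<close>)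
    then show "x o\<^sub>L y \<in> {T \<in> TT. Gam T \<in> U}" using xyT by simp
  next
    fix f x assume f: "\<And>n::nat. f n \<in> {T \<in> TT. Gam T \<in> U}" "f \<longlonglongrightarrow> x" and x: "clinear_op x"
    have "Gam x \<in> U"
    proof (rule U(9)[of "\<lambda>m. Gam (f m)", OF _ Gam_F[OF x]])
      fix e :: real assume "e > 0"
      then obtain M where M: "\<And>m. m \<ge> M \<Longrightarrow> norm (f m - x) < e" using LIMSEQ_D[OF f(2)] by blast
      have "norm (Gam (f m) n - Gam x n) \<le> e" if "m \<ge> M" for m n
        using M[OF that] norm_Gam_le[of "f m - x" n] by (simp add: Gam_simps)
      then show "\<exists>M. \<forall>m\<ge>M. \<forall>n. norm (Gam (f m) n - Gam x n) \<le> e" by blast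
    qed (use f in auto)
    then show "x \<in> {T \<in> TT. Gam T \<in> U}" using TT(8)[of f x] f by auto
  next
    have "Gam 0 = (\<lambda>n. 0)" by (simp add: Gam_simps fun_eq_iff)
    then show "0 \<in> {T \<in> TT. Gam T \<in> U}" by (simp add: TT U(2))
  qed (simp add: TT)
  moreover have "Sigma_op N i \<in> {T \<in> TT. Gam T \<in> U} \<and> radj (Sigma_op N i) \<in> {T \<in> TT. Gam T \<in> U}"
    if i: "i < N" for i
  proof -
    define j where "j = N - 1 - i"
    have j: "j < N" "N - 1 - j = i" using reflect_index[OF i] by (auto simp: j_def)
    have "Gam (Sigma_op N i) \<in> U"
      by (rule U_approx[OF t_U[OF j(1)] Gam_F[OF clinear_Sigma_op] good_Sigma_op(2)[OF j(1), unfolded j(2)]])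
    moreover have "Gam (radj (Sigma_op N i)) \<in> U"
      by (rule U_approx[OF U(6)[OF t_U[OF j(1)]] Gam_F[OF clinear_op_radj[OF clinear_Sigma_op]]
            good_Sigma_op(4)[OF j(1), unfolded j(2)]])
    ultimately have "Gam (Sigma_op N i) \<in> U" "Gam (radj (Sigma_op N i)) \<in> U" by auto
    then show ?thesis using i by (simp add: Sigma_op_TT radj_Sigma_op_TT)
  qed
  ultimately have "TT \<subseteq> {T \<in> TT. Gam T \<in> U}" by (rule TT_least)
  then show "T \<in> TT \<Longrightarrow> Gam T \<in> U" by blast
qed

end

section \<open>The quotient algebra\<close>

context finite_sections
begin

lemma section_alg_eq: "section_alg N = (F_alg N)\<lparr>carrier := U\<rparr>"
  by (simp add: U_def section_alg_def)

lemma ring_section_alg: "ring (section_alg N)"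
  unfolding section_alg_eq by (rule ring_F) (use U one_U in auto)

definition cls where "cls x = G_ideal N +>\<^bsub>section_alg N\<^esub> x"

lemma cls_eq: "x \<in> U \<Longrightarrow> cls x = {y \<in> U. (\<lambda>n. y n - x n) \<longlonglongrightarrow> 0}"
proof
  assume x: "x \<in> U"
  have c: "cls x = {(\<lambda>n. g n + x n) | g. g \<in> G_ideal N}"
    by (auto simp: cls_def a_r_coset_def' section_alg_eq)
  show "cls x \<subseteq> {y \<in> U. (\<lambda>n. y n - x n) \<longlonglongrightarrow> 0}"
    using x G_ideal_U by (auto simp: c G_ideal_iff intro!: U(3))
  show "{y \<in> U. (\<lambda>n. y n - x n) \<longlonglongrightarrow> 0} \<subseteq> cls x"
  proof
    fix y assume y: "y \<in> {y \<in> U. (\<lambda>n. y n - x n) \<longlonglongrightarrow> 0}"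
    have "(\<lambda>n. y n - x n) \<in> carrier (F_alg N)"
      by (rule F_carrier_closed(3)) (use x y U(1) in auto)
    then have "(\<lambda>n. y n - x n) \<in> G_ideal N"
      using y by (simp add: G_ideal_iff)
    then show "y \<in> cls x"
      unfolding c by (intro CollectI exI[of _ "\<lambda>n. y n - x n"]) simp
  qed
qed

lemma cls_eqI:
  assumes "x \<in> U" "y \<in> U" "(\<lambda>n. x n - y n) \<longlonglongrightarrow> 0"
  shows "cls x = cls y"
proof -
  have "(\<lambda>n. z n - x n) \<longlonglongrightarrow> 0 \<longleftrightarrow> (\<lambda>n. z n - y n) \<longlonglongrightarrow> 0" for z
    using tendsto_add[OF _ assms(3), of "\<lambda>n. z n - x n" 0] tendsto_diff[OF _ assms(3), of "\<lambda>n. z n - y n" 0]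
    by auto
  then show ?thesis using assms(1,2) by (simp add: cls_eq)
qed

lemma cls_zero: "cls (\<lambda>n. 0) = G_ideal N"
  using U(1) G_ideal_U by (auto simp: cls_eq U(2) G_ideal_iff)

lemma self_cls: "x \<in> U \<Longrightarrow> x \<in> cls x"
  by (simp add: cls_eq)

lemma ideal_G: "ideal (G_ideal N) (section_alg N)"
proof (rule idealI)
  interpret S: ring "section_alg N" by (rule ring_section_alg)
  have inv: "inv\<^bsub>add_monoid (section_alg N)\<^esub> x = (\<lambda>n. - x n)" if "x \<in> U" for x
  proof -
    have "\<ominus>\<^bsub>section_alg N\<^esub> x = (\<lambda>n. - x n)"
      using that by (intro S.minus_equality) (auto simp: section_alg_eq U)
    then show ?thesis by (simp add: a_inv_def)
  qed
  show "subgroup (G_ideal N) (add_monoid (section_alg N))"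
  proof
    show "G_ideal N \<subseteq> carrier (add_monoid (section_alg N))"
      using G_ideal_U by (simp add: section_alg_eq)
    show "\<one>\<^bsub>add_monoid (section_alg N)\<^esub> \<in> G_ideal N"
      by (simp add: section_alg_eq G_ideal_iff zero_F_carrier)
  next
    fix x y assume "x \<in> G_ideal N" "y \<in> G_ideal N"
    then show "x \<otimes>\<^bsub>add_monoid (section_alg N)\<^esub> y \<in> G_ideal N"
      using tendsto_add[of x 0 _ y 0] by (simp add: section_alg_eq G_ideal_iff F_carrier_closed)
  next
    fix x assume x: "x \<in> G_ideal N"
    then have "inv\<^bsub>add_monoid (section_alg N)\<^esub> x = (\<lambda>n. - x n)"
      using G_ideal_U by (intro inv) blast
    then show "inv\<^bsub>add_monoid (section_alg N)\<^esub> x \<in> G_ideal N"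
      using x tendsto_minus[of x 0] F_carrier_closed(4)[of x N x] by (simp add: G_ideal_iff)
  qed
next
  fix a x assume a: "a \<in> G_ideal N" and "x \<in> carrier (section_alg N)"
  then have x: "x \<in> carrier (F_alg N)" using U(1) by (auto simp: section_alg_eq)
  then obtain C where C: "\<And>n. norm (x n) \<le> C" using F_carrierD(4)[OF x] by blast
  have "a \<longlonglongrightarrow> 0" using a by (simp add: G_ideal_iff)
  then have "(\<lambda>n. x n o\<^sub>L a n) \<longlonglongrightarrow> 0" "(\<lambda>n. a n o\<^sub>L x n) \<longlonglongrightarrow> 0"
    using tendsto_compose_0'[of a 0 x C] tendsto_compose_0[of a 0 x C] C by auto
  then show "x \<otimes>\<^bsub>section_alg N\<^esub> a \<in> G_ideal N" "a \<otimes>\<^bsub>section_alg N\<^esub> x \<in> G_ideal N"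
    using a x by (simp_all add: section_alg_eq G_ideal_iff F_carrier_closed)
qed (rule ring_section_alg)

lemma Un_const: "X \<noteq> {} \<Longrightarrow> (\<And>x. x \<in> X \<Longrightarrow> f x = Y) \<Longrightarrow> (\<Union>x\<in>X. f x) = Y"
  by auto

lemma S_alg_simps:
  "carrier (S_alg N) = cls ` U"
  "one (S_alg N) = cls Pn" "zero (S_alg N) = cls (\<lambda>n. 0)"
  "x \<in> U \<Longrightarrow> y \<in> U \<Longrightarrow> cls x \<otimes>\<^bsub>S_alg N\<^esub> cls y = cls (\<lambda>n. x n o\<^sub>L y n)"
  "x \<in> U \<Longrightarrow> y \<in> U \<Longrightarrow> cls x \<oplus>\<^bsub>S_alg N\<^esub> cls y = cls (\<lambda>n. x n + y n)"
  "x \<in> U \<Longrightarrow> c \<odot>\<^bsub>S_alg N\<^esub> cls x = cls (\<lambda>n. scaleC_op c o\<^sub>L x n)"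
  "x \<in> U \<Longrightarrow> star (S_alg N) (cls x) = cls (\<lambda>n. radj (x n))"
  "x \<in> U \<Longrightarrow> nrm (S_alg N) (cls x) = Inf (nrm (F_alg N) ` cls x)"
proof -
  interpret I: ideal "G_ideal N" "section_alg N" by (rule ideal_G)
  have S: "carrier (section_alg N) = U" "add (section_alg N) = (\<lambda>A B n. A n + B n)"
    "mult (section_alg N) = (\<lambda>A B n. A n o\<^sub>L B n)" "one (section_alg N) = Pn"
    "smult (section_alg N) = (\<lambda>c A n. scaleC_op c o\<^sub>L A n)" "star (section_alg N) = (\<lambda>A n. adj_op (A n))"
    "nrm (section_alg N) = nrm (F_alg N)"
    by (simp_all add: section_alg_eq)
  have ne: "cls x \<noteq> {}" if "x \<in> U" for x using self_cls[OF that] by blast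
  note Q = S_alg_def star_alg_quot_def FactRing_def
  show "carrier (S_alg N) = cls ` U"
    by (auto simp: Q A_RCOSETS_def' S cls_def)
  show "one (S_alg N) = cls Pn" by (simp add: Q cls_def S)
  show "zero (S_alg N) = cls (\<lambda>n. 0)" by (simp add: Q cls_zero)
  show "cls x \<otimes>\<^bsub>S_alg N\<^esub> cls y = cls (\<lambda>n. x n o\<^sub>L y n)" if "x \<in> U" "y \<in> U"
    using I.rcoset_mult_add[of x y] that by (simp add: Q cls_def S)
  show "cls x \<oplus>\<^bsub>S_alg N\<^esub> cls y = cls (\<lambda>n. x n + y n)" if "x \<in> U" "y \<in> U"
    using I.a_rcos_sum[of x y] that by (simp add: Q cls_def S)
  show "c \<odot>\<^bsub>S_alg N\<^esub> cls x = cls (\<lambda>n. scaleC_op c o\<^sub>L x n)" if x: "x \<in> U"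
  proof -
    have *: "cls (\<lambda>n. scaleC_op c o\<^sub>L y n) = cls (\<lambda>n. scaleC_op c o\<^sub>L x n)" if "y \<in> cls x" for y
    proof (rule cls_eqI)
      have y: "y \<in> U" "(\<lambda>n. y n - x n) \<longlonglongrightarrow> 0" using that x by (auto simp: cls_eq)
      then show "(\<lambda>n. scaleC_op c o\<^sub>L y n) \<in> U" by (intro U(5))
      show "(\<lambda>n. (scaleC_op c o\<^sub>L y n) - (scaleC_op c o\<^sub>L x n)) \<longlonglongrightarrow> 0"
        using tendsto_compose_0'[OF y(2), of 0 "\<lambda>_. scaleC_op c"] by (auto simp: blinfun_compose_distrib)
    qed (use x in \<open>auto intro: U(5)\<close>)
    have "(\<Union>y\<in>cls x. cls (\<lambda>n. scaleC_op c o\<^sub>L y n)) = cls (\<lambda>n. scaleC_op c o\<^sub>L x n)"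
      by (rule Un_const[OF ne[OF x] *])
    then show ?thesis by (simp add: Q cls_def S)
  qed
  show "star (S_alg N) (cls x) = cls (\<lambda>n. radj (x n))" if x: "x \<in> U"
  proof -
    have adj: "(\<lambda>n. adj_op (y n)) = (\<lambda>n. radj (y n))" if "y \<in> U" for y
      using that U(1) F_carrierD(1)[of y N] by (auto simp: adj_op_eq_radj subset_iff)
    have *: "cls (\<lambda>n. adj_op (y n)) = cls (\<lambda>n. radj (x n))" if "y \<in> cls x" for y
    proof -
      have y: "y \<in> U" "(\<lambda>n. y n - x n) \<longlonglongrightarrow> 0" using that x by (auto simp: cls_eq)
      have "(\<lambda>n. radj (y n) - radj (x n)) \<longlonglongrightarrow> 0"
        by (rule tendsto_norm_0_le[OF _ tendsto_norm_zero[OF y(2)]]) (simp add: radj_diff[symmetric] norm_radj)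
      then have "cls (\<lambda>n. radj (y n)) = cls (\<lambda>n. radj (x n))"
        using x y by (intro cls_eqI U(6))
      then show ?thesis by (simp add: adj[OF y(1)])
    qed
    have "(\<Union>y\<in>cls x. cls (\<lambda>n. adj_op (y n))) = cls (\<lambda>n. radj (x n))"
      by (rule Un_const[OF ne[OF x] *])
    then show ?thesis by (simp add: Q cls_def S)
  qed
  show "nrm (S_alg N) (cls x) = Inf (nrm (F_alg N) ` cls x)"
    by (simp only: Q S star_alg.simps)
qed

section \<open>The isometric isomorphism from T_N onto the quotient\<close>

definition Psi where "Psi T = cls (Gam T)"

lemma Psi_eqI: "T \<in> TT \<Longrightarrow> x \<in> U \<Longrightarrow> (\<lambda>n. Gam T n - x n) \<longlonglongrightarrow> 0 \<Longrightarrow> Psi T = cls x"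
  unfolding Psi_def by (intro cls_eqI Gam_U)

lemma T_alg_simps:
  "carrier (T_alg N) = TT" "mult (T_alg N) = (o\<^sub>L)" "one (T_alg N) = id_blinfun"
  "zero (T_alg N) = 0" "add (T_alg N) = (+)" "smult (T_alg N) = (\<lambda>c A. scaleC_op c o\<^sub>L A)"
  "star (T_alg N) = adj_op" "nrm (T_alg N) = norm"
  by (simp_all add: TT_def) (simp_all add: T_alg_def)

lemma isometric_iso_Psi: "isometric_iso (T_alg N) (S_alg N) Psi"
proof -
  interpret A: c_star_algebra "T_alg N" by (rule c_star_algebra_T_alg)
  show ?thesis
  proof
    show "bij_betw Psi (carrier (T_alg N)) (carrier (S_alg N))"
      unfolding bij_betw_def T_alg_simps S_alg_simps
    proof
      show "inj_on Psi TT"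
      proof (rule inj_onI)
        fix S T assume ST: "S \<in> TT" "T \<in> TT" "Psi S = Psi T"
        then have "Gam S \<in> cls (Gam T)" using self_cls[OF Gam_U[OF ST(1)]] by (simp add: Psi_def)
        then have "(\<lambda>n. Gam S n - Gam T n) \<longlonglongrightarrow> 0" using Gam_U[OF ST(2)] by (simp add: cls_eq)
        then have "norm (S - T) \<le> 0"
          using tendsto_minus[of "\<lambda>n. Gam S n - Gam T n" 0]
          by (intro norm_le_Gam[of "\<lambda>n. - (Gam S n - Gam T n)"]) (auto simp: Gam_simps)
        then show "S = T" by simp
      qed
      show "Psi ` TT = cls ` U"
      proof
        show "Psi ` TT \<subseteq> cls ` U" using Gam_U by (auto simp: Psi_def)
        show "cls ` U \<subseteq> Psi ` TT"
        proof (rule image_subsetI)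
          fix x assume x: "x \<in> U"
          then obtain T where T: "T \<in> TT" "(\<lambda>n. x n - Gam T n) \<longlonglongrightarrow> 0"
            using U_subset_lifts by (auto simp: lifts_def)
          then have "cls x = Psi T" unfolding Psi_def using x by (intro cls_eqI Gam_U)
          then show "cls x \<in> Psi ` TT" using T(1) by blast
        qed
      qed
    qed
  next
    fix x y assume "x \<in> carrier (T_alg N)" "y \<in> carrier (T_alg N)"
    then have x: "x \<in> TT" and y: "y \<in> TT" by (simp_all add: T_alg_simps)
    note Gx = Gam_U[OF x] and Gy = Gam_U[OF y]
    show "Psi (x \<oplus>\<^bsub>T_alg N\<^esub> y) = Psi x \<oplus>\<^bsub>S_alg N\<^esub> Psi y"
      unfolding T_alg_simps Psi_def S_alg_simps(5)[OF Gx Gy] by (simp add: Gam_simps(2)[abs_def])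
    show "Psi (x \<otimes>\<^bsub>T_alg N\<^esub> y) = Psi x \<otimes>\<^bsub>S_alg N\<^esub> Psi y"
      unfolding T_alg_simps Psi_def S_alg_simps(4)[OF Gx Gy]
      by (intro cls_eqI Gam_U TT(4) U(4) Gx Gy x y Gam_mult_TT)
  next
    show "Psi \<one>\<^bsub>T_alg N\<^esub> = \<one>\<^bsub>S_alg N\<^esub>"
      unfolding T_alg_simps S_alg_simps
    proof (rule Psi_eqI[OF id_TT one_U])
      show "(\<lambda>n. Gam id_blinfun n - Pn n) \<longlonglongrightarrow> 0"
        by (rule tendsto_eventually, rule eventually_sequentiallyI[of 2]) (simp add: Gam_id)
    qed
    have "Gam 0 = (\<lambda>n. 0)" by (simp add: Gam_simps fun_eq_iff)
    then show "Psi \<zero>\<^bsub>T_alg N\<^esub> = \<zero>\<^bsub>S_alg N\<^esub>"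
      by (simp add: T_alg_simps S_alg_simps Psi_def)
  next
    fix x c assume "x \<in> carrier (T_alg N)"
    then have x: "x \<in> TT" by (simp add: T_alg_simps)
    note Gx = Gam_U[OF x]
    have "Gam (scaleC_op c o\<^sub>L x) = (\<lambda>n. scaleC_op c o\<^sub>L Gam x n)"
      using TT(1)[OF x] by (simp add: Gam_simps fun_eq_iff)
    then show "Psi (c \<odot>\<^bsub>T_alg N\<^esub> x) = c \<odot>\<^bsub>S_alg N\<^esub> Psi x"
      unfolding T_alg_simps Psi_def S_alg_simps(6)[OF Gx] by simp
    have "Gam (radj x) = (\<lambda>n. radj (Gam x n))" by (simp add: Gam_simps(5) fun_eq_iff)
    then show "Psi (star (T_alg N) x) = star (S_alg N) (Psi x)"
      unfolding T_alg_simps Psi_def S_alg_simps(7)[OF Gx] adj_op_eq_radj[OF TT(1)[OF x]] by simp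
    have F: "y \<in> carrier (F_alg N)" if "y \<in> cls (Gam x)" for y
      using that Gx U(1) by (auto simp: cls_eq)
    \<comment> \<open>Every representative is a compression plus a null sequence, so
      \<open>norm_le_Gam\<close> applies. \<open>Gam x\<close> itself attains this bound, and the
      quotient norm is a minimum.\<close>
    have lower: "norm x \<le> nrm (F_alg N) y" if "y \<in> cls (Gam x)" for y
    proof (rule norm_le_Gam)
      show "(\<lambda>n. y n - Gam x n) \<longlonglongrightarrow> 0" using that Gx by (simp add: cls_eq)
      show "norm (Gam x n + (y n - Gam x n)) \<le> nrm (F_alg N) y" for n
        using norm_le_nrm_F[OF F[OF that], of n] by simp
    qed
    have "nrm (F_alg N) (Gam x) = norm x"
      by (rule antisym[OF nrm_F_le[OF norm_Gam_le] lower[OF self_cls[OF Gx]]])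
    then have "Inf (nrm (F_alg N) ` cls (Gam x)) = norm x"
      using lower self_cls[OF Gx] by (intro cInf_eq_minimum) (auto intro!: image_eqI[of _ _ "Gam x"] simp del: F_alg_simps)
    then show "nrm (S_alg N) (Psi x) = nrm (T_alg N) x"
      unfolding T_alg_simps Psi_def S_alg_simps(8)[OF Gx] .
  qed
qed

interpretation Psi: isometric_iso "T_alg N" "S_alg N" Psi
  by (rule isometric_iso_Psi)

section \<open>Identification of the entries\<close>

lemma nat_pow_0': "x [^]\<^bsub>G\<^esub> (0::nat) = \<one>\<^bsub>G\<^esub>"
  and nat_pow_Suc': "x [^]\<^bsub>G\<^esub> Suc n = x [^]\<^bsub>G\<^esub> n \<otimes>\<^bsub>G\<^esub> x"
  by (simp_all add: nat_pow_def)

abbreviation pow_op :: "('a::complex_inner \<Rightarrow>\<^sub>L 'a) \<Rightarrow> nat \<Rightarrow> ('a \<Rightarrow>\<^sub>L 'a)" (infixr "\<up>" 75)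
  where "x \<up> k \<equiv> x [^]\<^bsub>bounded_ops\<^esub> k"

lemma Psi_pow:
  "x \<in> TT \<Longrightarrow> x \<up> k \<in> TT \<and>
    Psi (x \<up> k) = Psi x [^]\<^bsub>S_alg N\<^esub> k"
proof (induction k)
  case 0
  then show ?case using Psi.hom_one by (simp add: nat_pow_0' id_TT T_alg_simps)
next
  case (Suc k)
  then show ?case
    using Psi.hom_mult[of "x \<up> k" x]
    by (simp add: nat_pow_Suc' T_alg_simps TT(4))
qed

abbreviation Sig where "Sig \<equiv> Sigma_op N (N - 1)"
abbreviation S1 where "S1 \<equiv> S_op N (N - 1)"

lemma pred_less: "N - 1 < N"
  using N2 by simp

text \<open>Reflection turns the digit 0 into \<open>N - 1\<close>. This is why
  \<open>W_entry\<close> pairs powers of \<open>s_gen N 0\<close> with powers of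
  \<open>S_op N (N - 1)\<close>.\<close>

lemma s_gen_0: "s_gen N 0 = Psi Sig"
proof -
  have "Psi Sig = cls (section_seq N (S_op N 0))"
    using good_Sigma_op(2)[of 0] N2 by (intro Psi_eqI Sigma_op_TT t_U pred_less) auto
  then show ?thesis by (simp add: s_gen_def cls_def)
qed

lemma star_s_gen_0: "star (S_alg N) (s_gen N 0) = Psi (radj Sig)"
  unfolding s_gen_0 using Psi.hom_star[of Sig] Sigma_op_TT[OF pred_less]
  by (simp add: T_alg_simps adj_op_eq_radj)

lemma P_op_1_eq: "P_op 1 = id_blinfun - (radj Sig o\<^sub>L Sig)"
  by (simp add: radj_Sigma_op_Sigma_op pred_less del: One_nat_def)

lemma P_op_1_TT: "P_op 1 \<in> TT"
  unfolding P_op_1_eq by (intro TT(4,7) id_TT Sigma_op_TT radj_Sigma_op_TT pred_less)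

lemma minus_T_alg: "x \<in> TT \<Longrightarrow> y \<in> TT \<Longrightarrow> x \<ominus>\<^bsub>T_alg N\<^esub> y = x - y"
  using minus_ops[OF TT(3,4,6,2) id_TT, of x y] by (simp add: T_alg_def TT_def)

lemma q1_eq: "q1 N = Psi (P_op 1)"
proof -
  note S = Sigma_op_TT[OF pred_less] radj_Sigma_op_TT[OF pred_less]
  have SS: "radj Sig o\<^sub>L Sig \<in> TT" by (intro TT(4) S)
  have "p1 N = Psi (radj Sig o\<^sub>L Sig)"
    using Psi.hom_mult[of "radj Sig" Sig] S
    unfolding p1_def star_s_gen_0 by (simp add: s_gen_0 T_alg_simps)
  then show ?thesis
    using Psi.hom_minus[of id_blinfun "radj Sig o\<^sub>L Sig"] Psi.hom_one SS id_TT
    by (simp add: q1_def P_op_1_eq T_alg_simps minus_T_alg del: One_nat_def)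
qed

text \<open>\<open>N ^ n - N ^ (n - 1)\<close> is the number of leaves, which is at least
  \<open>N ^ (n - 1)\<close>.\<close>

lemma window_tendsto: "(\<lambda>n. blinfun_apply (P_op (N ^ n - N ^ (n - 1))) x) \<longlonglongrightarrow> x"
proof -
  have "filterlim (\<lambda>n. N ^ n - N ^ (n - 1)) sequentially sequentially"
    unfolding filterlim_at_top
  proof
    fix Z
    have "Z \<le> N ^ n - N ^ (n - 1)" if "n \<ge> Suc Z" for n
    proof -
      have n: "N ^ n = N * N ^ (n - 1)" using that by (cases n) auto
      have "Z \<le> n - 1" using that by simp
      also have "\<dots> \<le> 2 ^ (n - 1)" using less_exp[of "n - 1"] by linarith
      also have "\<dots> \<le> N ^ (n - 1)" using N2 by (intro power_mono) auto
      also have "\<dots> \<le> N ^ n - N ^ (n - 1)"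
      proof -
        have "2 * N ^ (n - 1) \<le> N * N ^ (n - 1)" using N2 by (intro mult_le_mono1)
        then show ?thesis unfolding n by linarith
      qed
      finally show ?thesis .
    qed
    then show "eventually (\<lambda>n. Z \<le> N ^ n - N ^ (n - 1)) sequentially"
      by (rule eventually_sequentiallyI)
  qed
  then show ?thesis by (rule filterlim_compose[OF P_op_tendsto])
qed

text \<open>The leaves are the last indices below \<open>N ^ n\<close>; reflection moves them to the
  front.\<close>

lemma R_window: "R_op (N ^ n) o\<^sub>L (Pn n - Pn (n - 1)) o\<^sub>L R_op (N ^ n) = P_op (N ^ n - N ^ (n - 1))"
  by (intro blinfun_eqI l2_eqI)
    (auto simp: coord_R_op coord_P_op blinfun.diff_left)

lemma proj_iota: "proj m o\<^sub>L iota m = id_blinfun"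
  by (intro blinfun_eqI) (simp add: proj.rep_eq coord_iota)

text \<open>Since \<open>P_op 1\<close> factors through depth 0, the compression involves only the
  depth 0 component of \<open>J n\<close>. That component is a reflection of the leaves, and the
  outer reflection undoes it, leaving a truncation of the corner entry of \<open>T\<close>.\<close>

lemma reflected_Gam:
  assumes n: "n \<ge> 2"
  shows "R_op (N ^ n) o\<^sub>L Gam (P_op 1 o\<^sub>L T o\<^sub>L P_op 1) n o\<^sub>L R_op (N ^ n)
    = P_op (N ^ n - N ^ (n - 1)) o\<^sub>L (proj 0 o\<^sub>L T o\<^sub>L iota 0) o\<^sub>L P_op (N ^ n - N ^ (n - 1))"
proof -
  let ?R = "R_op (N ^ n)" and ?D = "P_op (N ^ n - N ^ (n - 1)) :: complex l2 \<Rightarrow>\<^sub>L complex l2"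
  have 1: "proj 0 o\<^sub>L (J n o\<^sub>L ?R) = ?D"
    using proj_J_op[OF N2 n] R_window[of n] by (simp add: blinfun_compose_assoc[symmetric])
  have "radj (proj 0 o\<^sub>L (J n o\<^sub>L ?R)) = ?R o\<^sub>L (radj (J n) o\<^sub>L iota 0)"
    by (simp add: radj_compose radj_proj blinfun_compose_assoc)
  then have 2: "?R o\<^sub>L (radj (J n) o\<^sub>L iota 0) = ?D" unfolding 1 by simp
  have "?R o\<^sub>L Gam (P_op 1 o\<^sub>L T o\<^sub>L P_op 1) n o\<^sub>L ?R
      = (?R o\<^sub>L (radj (J n) o\<^sub>L iota 0)) o\<^sub>L (proj 0 o\<^sub>L T o\<^sub>L iota 0) o\<^sub>L (proj 0 o\<^sub>L (J n o\<^sub>L ?R))"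
    using n unfolding P_op_1 by (simp add: Gam_def blinfun_compose_assoc)
  then show ?thesis unfolding 1 2 .
qed

text \<open>The truncations of the corner entry converge strongly to it. Passing to another
  representative adds a null sequence, which the contractive reflections keep null.\<close>

lemma W00_Psi:
  assumes T: "T \<in> TT"
  shows "W00 N (Psi T) = proj 0 o\<^sub>L T o\<^sub>L iota 0"
proof -
  define V where "V = proj 0 o\<^sub>L T o\<^sub>L iota 0"
  define T' where "T' = P_op 1 o\<^sub>L T o\<^sub>L P_op 1"
  let ?R = "\<lambda>n. R_op (N ^ n)" and ?D = "\<lambda>n. P_op (N ^ n - N ^ (n - 1)) :: complex l2 \<Rightarrow>\<^sub>L complex l2"
  have T': "T' \<in> TT" unfolding T'_def by (intro TT(4) P_op_1_TT T)
  have X: "q1 N \<otimes>\<^bsub>S_alg N\<^esub> Psi T \<otimes>\<^bsub>S_alg N\<^esub> q1 N = cls (Gam T')"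
    using Psi.hom_mult[of "P_op 1" T] Psi.hom_mult[of "P_op 1 o\<^sub>L T" "P_op 1"] T P_op_1_TT TT(4)
    by (simp add: q1_eq T_alg_simps T'_def Psi_def)
  have lim: "(\<lambda>n. (?R n o\<^sub>L A n o\<^sub>L ?R n) x) \<longlonglongrightarrow> V x" if A: "A \<in> cls (Gam T')" for A x
  proof -
    have g: "(\<lambda>n. A n - Gam T' n) \<longlonglongrightarrow> 0" using A by (simp add: cls_eq Gam_U T')
    have "(\<lambda>n. ?R n o\<^sub>L (A n - Gam T' n)) \<longlonglongrightarrow> 0"
      by (rule tendsto_compose_0'[OF g, where l = 0]) (rule norm_R_op_le)
    then have "(\<lambda>n. ?R n o\<^sub>L (A n - Gam T' n) o\<^sub>L ?R n) \<longlonglongrightarrow> 0"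
      by (rule tendsto_compose_0[where l = 0]) (rule norm_R_op_le)
    then have 1: "(\<lambda>n. (?R n o\<^sub>L (A n - Gam T' n) o\<^sub>L ?R n) x) \<longlonglongrightarrow> (0 :: complex l2 \<Rightarrow>\<^sub>L complex l2) x"
      by (rule blinfun_tendsto_apply)
    have "(\<lambda>n. V (?D n x) - V x) \<longlonglongrightarrow> 0"
      by (intro LIM_zero blinfun.tendsto tendsto_const window_tendsto)
    then have "(\<lambda>n. ?D n (V (?D n x) - V x)) \<longlonglongrightarrow> 0"
      by (intro tendsto_norm_0_le[OF norm_P_op_apply_le, OF tendsto_norm_zero])
    then have "(\<lambda>n. ?D n (V (?D n x) - V x) + ?D n (V x)) \<longlonglongrightarrow> 0 + V x"
      by (intro tendsto_add window_tendsto)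
    then have "(\<lambda>n. ?D n (V (?D n x))) \<longlonglongrightarrow> V x" by (simp add: blinfun.diff_right)
    then have 2: "(\<lambda>n. (?R n o\<^sub>L Gam T' n o\<^sub>L ?R n) x) \<longlonglongrightarrow> V x"
      by (rule Lim_transform_eventually[OF _ eventually_sequentiallyI[of 2]])
        (simp add: T'_def reflected_Gam V_def del: One_nat_def)
    show ?thesis
      using tendsto_add[OF 1 2] by (simp add: blinfun.diff_left blinfun.diff_right)
  qed
  show ?thesis
    unfolding W00_def X V_def[symmetric]
  proof (rule the_equality)
    show "\<forall>A\<in>cls (Gam T'). \<forall>x. (\<lambda>n. (?R n o\<^sub>L A n o\<^sub>L ?R n) x) \<longlonglongrightarrow> V x" using lim by blast
    fix V' assume "\<forall>A\<in>cls (Gam T'). \<forall>x. (\<lambda>n. (?R n o\<^sub>L A n o\<^sub>L ?R n) x) \<longlonglongrightarrow> blinfun_apply V' x"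
    then have "(\<lambda>n. (?R n o\<^sub>L Gam T' n o\<^sub>L ?R n) x) \<longlonglongrightarrow> V' x" for x
      using self_cls[OF Gam_U[OF T']] by blast
    then show "V' = V"
      using lim[OF self_cls[OF Gam_U[OF T']]] LIMSEQ_unique by (intro blinfun_eqI) blast
  qed
qed

lemma pow_ops:
  "x \<up> 0 = id_blinfun"
  "x \<up> Suc n = x \<up> n o\<^sub>L x"
  by (simp_all add: nat_pow_0' nat_pow_Suc')

lemma pow_ops_Suc2: "x \<up> Suc n = x o\<^sub>L x \<up> n"
  by (induction n) (simp_all add: pow_ops blinfun_compose_assoc)

section \<open>Matrix entries away from the corner\<close>

lemma proj_Sig: "proj m o\<^sub>L Sig = S1 o\<^sub>L proj (Suc m)"
  by (rule blinfun_eqI) (simp add: proj.rep_eq coord_Sigma_op)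

lemma Sig_iota: "radj Sig o\<^sub>L iota m = iota (Suc m) o\<^sub>L radj S1"
  using arg_cong[OF proj_Sig[of m], of radj] by (simp add: radj_compose radj_proj)

lemma proj_Sig_pow: "proj 0 o\<^sub>L (Sig \<up> i) = (S1 \<up> i) o\<^sub>L proj i"
proof (induction i)
  case (Suc i)
  have "proj 0 o\<^sub>L (Sig \<up> Suc i) = (proj 0 o\<^sub>L (Sig \<up> i)) o\<^sub>L Sig"
    by (simp add: pow_ops blinfun_compose_assoc)
  also have "\<dots> = (S1 \<up> i) o\<^sub>L (proj i o\<^sub>L Sig)"
    unfolding Suc by (simp add: blinfun_compose_assoc)
  also have "\<dots> = (S1 \<up> Suc i) o\<^sub>L proj (Suc i)"
    unfolding proj_Sig by (simp add: pow_ops blinfun_compose_assoc)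
  finally show ?case .
qed (simp add: pow_ops)

lemma Sig_pow_iota:
  "(radj Sig \<up> j) o\<^sub>L iota m = iota (m + j) o\<^sub>L (radj S1 \<up> j)"
proof (induction j arbitrary: m)
  case (Suc j)
  have "(radj Sig \<up> Suc j) o\<^sub>L iota m
      = ((radj Sig \<up> j) o\<^sub>L iota (Suc m)) o\<^sub>L radj S1"
    by (simp add: pow_ops blinfun_compose_assoc Sig_iota del: One_nat_def)
  also have "\<dots> = iota (m + Suc j) o\<^sub>L (radj S1 \<up> Suc j)"
    unfolding Suc by (simp add: pow_ops blinfun_compose_assoc)
  finally show ?case .
qed (simp add: pow_ops)

lemma S1_pow: "(radj S1 \<up> i) o\<^sub>L (S1 \<up> i) = id_blinfun"
proof (induction i)
  case (Suc i)
  have "(radj S1 \<up> Suc i) o\<^sub>L (S1 \<up> Suc i)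
      = (radj S1 \<up> i) o\<^sub>L (radj S1 o\<^sub>L S1) o\<^sub>L (S1 \<up> i)"
    unfolding pow_ops_Suc2[of S1] pow_ops(2)[of "radj S1"] by (simp add: blinfun_compose_assoc)
  then show ?case using Suc pred_less by (simp add: radj_S_op_S_op del: One_nat_def)
qed (simp add: pow_ops)

text \<open>Powers of \<open>Sig\<close> and of its adjoint move the entry at \<open>i\<close>,
  \<open>j\<close> into the corner at the cost of the factors \<open>S1 \<up> i\<close> and
  \<open>radj S1 \<up> j\<close>. The outer powers in \<open>W_entry\<close> cancel them because
  \<open>S1\<close> is an isometry.\<close>

lemma W_entry_Psi:
  assumes T: "T \<in> TT"
  shows "W_entry N i j (Psi T) = proj i o\<^sub>L T o\<^sub>L iota j"
proof -
  let ?a = "Sig \<up> i" and ?b = "radj Sig \<up> j"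
  note a = Psi_pow[OF Sigma_op_TT[OF pred_less], of i] and b = Psi_pow[OF radj_Sigma_op_TT[OF pred_less], of j]
  have mult: "Psi x \<otimes>\<^bsub>S_alg N\<^esub> Psi y = Psi (x o\<^sub>L y)" if "x \<in> TT" "y \<in> TT" for x y
    using Psi.hom_mult[of x y] that by (simp add: T_alg_simps)
  have X: "q1 N \<otimes>\<^bsub>S_alg N\<^esub> (s_gen N 0 [^]\<^bsub>S_alg N\<^esub> i) \<otimes>\<^bsub>S_alg N\<^esub> Psi T
      \<otimes>\<^bsub>S_alg N\<^esub> (star (S_alg N) (s_gen N 0) [^]\<^bsub>S_alg N\<^esub> j) \<otimes>\<^bsub>S_alg N\<^esub> q1 N
      = Psi (P_op 1 o\<^sub>L ?a o\<^sub>L T o\<^sub>L ?b o\<^sub>L P_op 1)"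
    unfolding star_s_gen_0 unfolding s_gen_0 q1_eq a[THEN conjunct2, symmetric] b[THEN conjunct2, symmetric]
    using a[THEN conjunct1] b[THEN conjunct1] T P_op_1_TT by (simp add: mult TT(4) del: One_nat_def)
  have in_TT: "P_op 1 o\<^sub>L ?a o\<^sub>L T o\<^sub>L ?b o\<^sub>L P_op 1 \<in> TT"
    using a b T P_op_1_TT by (intro TT(4)) auto
  have "proj 0 o\<^sub>L (P_op 1 o\<^sub>L ?a o\<^sub>L T o\<^sub>L ?b o\<^sub>L P_op 1) o\<^sub>L iota 0
      = (proj 0 o\<^sub>L iota 0) o\<^sub>L (proj 0 o\<^sub>L ?a) o\<^sub>L T o\<^sub>L (?b o\<^sub>L iota 0) o\<^sub>L (proj 0 o\<^sub>L iota 0)"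
    unfolding P_op_1 by (simp add: blinfun_compose_assoc)
  also have "\<dots> = (S1 \<up> i) o\<^sub>L (proj i o\<^sub>L T o\<^sub>L iota j) o\<^sub>L (radj S1 \<up> j)"
    unfolding proj_iota proj_Sig_pow Sig_pow_iota by (simp add: blinfun_compose_assoc)
  finally have W: "W00 N (Psi (P_op 1 o\<^sub>L ?a o\<^sub>L T o\<^sub>L ?b o\<^sub>L P_op 1))
      = (S1 \<up> i) o\<^sub>L (proj i o\<^sub>L T o\<^sub>L iota j) o\<^sub>L (radj S1 \<up> j)"
    by (simp only: W00_Psi[OF in_TT])
  have "W_entry N i j (Psi T) = ((radj S1 \<up> i) o\<^sub>L (S1 \<up> i))
      o\<^sub>L (proj i o\<^sub>L T o\<^sub>L iota j) o\<^sub>L ((radj S1 \<up> j) o\<^sub>L (S1 \<up> j))"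
    unfolding W_entry_def X W adj_op_eq_radj[OF clinear_S_op] by (simp add: blinfun_compose_assoc)
  then show ?thesis unfolding S1_pow by simp
qed

text \<open>The partial sums are coordinates of \<open>T\<close> applied to truncations of
  \<open>x\<close>, so continuity of \<open>T\<close> gives convergence. Uniqueness of sums
  determines the operator chosen by \<open>THE\<close>.\<close>

lemma W_tilde_Psi:
  assumes T: "T \<in> TT"
  shows "W_tilde N (Psi T) = T"
  unfolding W_tilde_def
proof (rule the_equality)
  have sums: "(\<lambda>j. (W_entry N i j (Psi T)) (coord x j)) sums coord (T x) i" for x i
    unfolding sums_def
  proof -
    have "(\<Sum>j<n. (W_entry N i j (Psi T)) (coord x j)) = coord (T (P_op n x)) i" for n
      by (simp add: W_entry_Psi[OF T] proj.rep_eq P_op_eq_sum blinfun.sum_right coord_sum)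
    moreover have "(\<lambda>n. coord (T (P_op n x)) i) \<longlonglongrightarrow> coord (T x) i"
      by (intro bounded_linear.tendsto[OF bounded_linear_coord] blinfun.tendsto tendsto_const P_op_tendsto)
    ultimately show "(\<lambda>n. \<Sum>j<n. (W_entry N i j (Psi T)) (coord x j)) \<longlonglongrightarrow> coord (T x) i" by simp
  qed
  then show "\<forall>x i. (\<lambda>j. (W_entry N i j (Psi T)) (coord x j)) sums coord (T x) i" by blast
  fix T' assume T': "\<forall>x i. (\<lambda>j. (W_entry N i j (Psi T)) (coord x j)) sums coord (blinfun_apply T' x) i"
  have "coord (T' x) i = coord (T x) i" for x i
    by (rule sums_unique2[OF T'[rule_format] sums])
  then have "T' x = T x" for x by (rule l2_eqI)
  then show "T' = T" by (rule blinfun_eqI)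
qed

text \<open>\<open>W_tilde N\<close> is the inverse of \<open>Psi\<close>, and it sends the
  generator \<open>q1 N\<close> of one ideal to the generator \<open>P_op 1\<close> of the other;
  isometric isomorphisms respect generated closed ideals.\<close>

lemma W_tilde_isomorphism:
  "c_star_algebra (S_alg N) \<and> c_star_algebra (T_alg N) \<and>
    star_isomorphism (S_alg N) (T_alg N) (W_tilde N) \<and>
    W_tilde N ` J_ideal N = C_ideal N"
proof -
  interpret W: isometric_iso "S_alg N" "T_alg N" "W_tilde N"
    by (rule Psi.inverse) (simp add: W_tilde_Psi T_alg_simps)
  have "q1 N \<in> carrier (S_alg N)"
    unfolding q1_eq Psi.car using P_op_1_TT by (simp add: T_alg_simps)
  then have "W_tilde N ` J_ideal N = closed_ideal_gen (T_alg N) (W_tilde N ` {q1 N})"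
    unfolding J_ideal_def by (intro W.closed_ideal_gen_image) simp
  also have "W_tilde N ` {q1 N} = {P_op 1}"
    by (simp add: q1_eq W_tilde_Psi[OF P_op_1_TT] del: One_nat_def)
  finally show ?thesis
    using Psi.c_star_algebra_image c_star_algebra_T_alg W.star_isomorphism by (simp add: C_ideal_def)
qed

end

theorem theorem6p8:
  fixes N :: nat
  assumes "N \<ge> 2"
  shows "c_star_algebra (S_alg N) \<and> c_star_algebra (T_alg N) \<and>
    star_isomorphism (S_alg N) (T_alg N) (W_tilde N) \<and>
    W_tilde N ` J_ideal N = C_ideal N"
proof -
  interpret finite_sections N using assms by unfold_locales
  show ?thesis by (rule W_tilde_isomorphism)
qed

end
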